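(* Let $\mu$ be a Gibbs point process on $\Lambda$ with a finite-range repulsive pair potential and constant activity $\lambda$, and suppose $\gamma>0$ satisfies $\mathcal E(f,f)\ge\gamma\operatorname{Var}_\mu(f)$ for all bounded measurable $f$. Let $(\mu_t)_{t\ge0}$ be the laws of Continuum Glauber dynamics on $\Lambda$ started from a nonempty finite configuration $S\subseteq\Lambda$. Then for every $\epsilon\in(0,1)$ and every $t\ge\frac1\gamma\big(\lambda|\Lambda|/2+\log(1/\epsilon)\big)+\log(2|S|/\epsilon)$, we have $d_{TV}(\mu_t,\mu)\le\epsilon$.
   Context: $\Lambda\subseteq\mathbb{R}^d$ bounded measurable, $\Omega$ its finite subsets. $\mu$ has density proportional to $\lambda^{|\eta|}e^{-H(\eta)}$ with respect to the Poisson process, where $H(\eta)=\sum_{\{x,y\}\subseteq\eta}\phi(x,y)$ and $\phi\ge0$ is symmetric with finite range. Continuum Glauber dynamics: each point dies at rate $1$; a point is born at $x\in\Lambda$ with rate density $\lambda e^{-(H(\eta\cup\{x\})-H(\eta))}$. $\mathcal E(f,f)=\int\sum_{x\in\eta}(f(\eta\setminus\{x\})-f(\eta))^2d\mu(\eta)$. *)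

theory Defs
  imports "HOL-Probability.Probability"
begin

section \<open>Finite configurations and the Poisson process\<close>

definition conf_sets :: "'a::euclidean_space set \<Rightarrow> 'a set set" where
  "conf_sets \<Lambda> = {\<eta>. finite \<eta> \<and> \<eta> \<subseteq> \<Lambda>}"

text \<open>The usual sigma-algebra on configurations: the one generated by the counting maps
  \<open>\<eta> \<mapsto> card (\<eta> \<inter> B)\<close> for Borel sets \<open>B\<close>.\<close>

definition conf_space :: "'a::euclidean_space set \<Rightarrow> 'a set measure" where
  "conf_space \<Lambda> = sigma (conf_sets \<Lambda>)
     {{\<eta> \<in> conf_sets \<Lambda>. card (\<eta> \<inter> B) = n} | B n. B \<in> sets borel}"

text \<open>The Poisson point process of unit intensity on \<open>\<Lambda>\<close>: \<open>P(A)\<close> is the sum over \<open>n\<close> of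
  \<open>exp (-|\<Lambda>|) / n!\<close> times the Lebesgue measure of the set of \<open>n\<close>-tuples in \<open>\<Lambda>\<close> whose set of
  coordinates belongs to \<open>A\<close>. The tuples with coinciding coordinates form a null set.\<close>

definition poisson_process :: "'a::euclidean_space set \<Rightarrow> 'a set measure" where
  "poisson_process \<Lambda> = measure_of (space (conf_space \<Lambda>)) (sets (conf_space \<Lambda>))
     (\<lambda>A. \<Sum>n. ennreal (exp (- measure lebesgue \<Lambda>) / fact n) *
        emeasure (Pi\<^sub>M {..<n} (\<lambda>_. lebesgue_on \<Lambda>))
          {x \<in> space (Pi\<^sub>M {..<n} (\<lambda>_. lebesgue_on \<Lambda>)). x ` {..<n} \<in> A})"

section \<open>The Gibbs point process\<close>

text \<open>Potentials take values in \<open>[0,\<infinity>]\<close>, so that hard-core interactions are included.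
  The sum over unordered pairs is half the sum over ordered pairs of distinct points.\<close>

definition energy :: "('a \<Rightarrow> 'a \<Rightarrow> ennreal) \<Rightarrow> 'a set \<Rightarrow> ennreal" where
  "energy \<phi> \<eta> = (\<Sum>x\<in>\<eta>. \<Sum>y\<in>\<eta> - {x}. \<phi> x y) / 2"

definition exp_neg :: "ennreal \<Rightarrow> real" where
  "exp_neg u = (if u = \<infinity> then 0 else exp (- enn2real u))"

definition gibbs_weight :: "real \<Rightarrow> ('a \<Rightarrow> 'a \<Rightarrow> ennreal) \<Rightarrow> 'a set \<Rightarrow> ennreal" where
  "gibbs_weight lam \<phi> \<eta> = ennreal (lam ^ card \<eta> * exp_neg (energy \<phi> \<eta>))"

definition gibbs_measure ::
  "'a::euclidean_space set \<Rightarrow> real \<Rightarrow> ('a \<Rightarrow> 'a \<Rightarrow> ennreal) \<Rightarrow> 'a set measure" where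
  "gibbs_measure \<Lambda> lam \<phi> = density (poisson_process \<Lambda>)
     (\<lambda>\<eta>. gibbs_weight lam \<phi> \<eta> / (\<integral>\<^sup>+\<zeta>. gibbs_weight lam \<phi> \<zeta> \<partial>poisson_process \<Lambda>))"

definition repulsive_finite_range ::
  "('a::euclidean_space \<Rightarrow> 'a \<Rightarrow> ennreal) \<Rightarrow> bool" where
  "repulsive_finite_range \<phi> \<longleftrightarrow>
     case_prod \<phi> \<in> borel_measurable (borel \<Otimes>\<^sub>M borel) \<and>
     (\<forall>x y. \<phi> x y = \<phi> y x) \<and>
     (\<exists>r. \<forall>x y. dist x y > r \<longrightarrow> \<phi> x y = 0)"

section \<open>Dirichlet form and variance\<close>

definition dirichlet_form :: "'a set measure \<Rightarrow> ('a set \<Rightarrow> real) \<Rightarrow> real" where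
  "dirichlet_form \<mu> f = (\<integral>\<eta>. (\<Sum>x\<in>\<eta>. (f (\<eta> - {x}) - f \<eta>)\<^sup>2) \<partial>\<mu>)"

definition poincare_inequality :: "'a set measure \<Rightarrow> real \<Rightarrow> bool" where
  "poincare_inequality \<mu> \<gamma> \<longleftrightarrow>
     (\<forall>f \<in> borel_measurable \<mu>. bounded (f ` space \<mu>) \<longrightarrow>
        dirichlet_form \<mu> f \<ge> \<gamma> * prob_space.variance \<mu> f)"

section \<open>Continuum Glauber dynamics\<close>

text \<open>In \<^typ>\<open>ennreal\<close> we have \<open>\<infinity> - \<infinity> = \<infinity>\<close>. Hence no births occur at a configuration of infinite
  energy, where the difference of energies has no other meaning.\<close>

definition birth_rate ::
  "real \<Rightarrow> ('a \<Rightarrow> 'a \<Rightarrow> ennreal) \<Rightarrow> 'a set \<Rightarrow> 'a \<Rightarrow> real" where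
  "birth_rate lam \<phi> \<eta> x = lam * exp_neg (energy \<phi> (insert x \<eta>) - energy \<phi> \<eta>)"

definition exit_rate ::
  "'a::euclidean_space set \<Rightarrow> real \<Rightarrow> ('a \<Rightarrow> 'a \<Rightarrow> ennreal) \<Rightarrow> 'a set \<Rightarrow> real" where
  "exit_rate \<Lambda> lam \<phi> \<eta> = real (card \<eta>) + (\<integral>x. birth_rate lam \<phi> \<eta> x \<partial>lebesgue_on \<Lambda>)"

text \<open>The dynamics is the pure jump Markov process that stays at \<open>\<eta>\<close> for an exponential time with
  parameter \<^term>\<open>exit_rate \<Lambda> lam \<phi> \<eta>\<close> and then jumps, with probabilities proportional to the rates,
  to \<open>\<eta> - {x}\<close> (rate \<open>1\<close> for each \<open>x \<in> \<eta>\<close>) or to \<open>insert x \<eta>\<close> (rate density \<open>birth_rate lam \<phi> \<eta> x\<close>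
  on \<open>\<Lambda>\<close>). \<open>glauber_jumps \<Lambda> lam \<phi> A n t \<eta>\<close> is the probability that, started from \<open>\<eta>\<close>, it makes
  exactly \<open>n\<close> jumps up to time \<open>t \<ge> 0\<close> and is in \<open>A\<close> at time \<open>t\<close>; the recursion conditions on the
  time \<open>s\<close> and the target of the first jump. The number of points born up to time \<open>t\<close> is dominated
  by a Poisson variable with mean \<open>lam * |\<Lambda>| * t\<close>, so the process does not explode and summing
  over \<open>n\<close> gives the full law at time \<open>t\<close>.\<close>

primrec glauber_jumps ::
  "'a::euclidean_space set \<Rightarrow> real \<Rightarrow> ('a \<Rightarrow> 'a \<Rightarrow> ennreal) \<Rightarrow> 'a set set \<Rightarrow>
     nat \<Rightarrow> real \<Rightarrow> 'a set \<Rightarrow> ennreal" where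
  "glauber_jumps \<Lambda> lam \<phi> A 0 = (\<lambda>t \<eta>.
     ennreal (exp (- exit_rate \<Lambda> lam \<phi> \<eta> * t)) * indicator A \<eta>)"
| "glauber_jumps \<Lambda> lam \<phi> A (Suc n) = (\<lambda>t \<eta>.
     \<integral>\<^sup>+s\<in>{0..t}. ennreal (exp (- exit_rate \<Lambda> lam \<phi> \<eta> * s)) *
       ((\<Sum>x\<in>\<eta>. glauber_jumps \<Lambda> lam \<phi> A n (t - s) (\<eta> - {x})) +
        (\<integral>\<^sup>+x. ennreal (birth_rate lam \<phi> \<eta> x) *
           glauber_jumps \<Lambda> lam \<phi> A n (t - s) (insert x \<eta>) \<partial>lebesgue_on \<Lambda>)) \<partial>lborel)"

definition glauber_law ::
  "'a::euclidean_space set \<Rightarrow> real \<Rightarrow> ('a \<Rightarrow> 'a \<Rightarrow> ennreal) \<Rightarrow> 'a set \<Rightarrow> real \<Rightarrow> 'a set measure" where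
  "glauber_law \<Lambda> lam \<phi> S t = measure_of (space (conf_space \<Lambda>)) (sets (conf_space \<Lambda>))
     (\<lambda>A. \<Sum>n. glauber_jumps \<Lambda> lam \<phi> A n t S)"

section \<open>Total variation distance\<close>

definition tv_dist :: "'b measure \<Rightarrow> 'b measure \<Rightarrow> real" where
  "tv_dist M N = (SUP A\<in>sets M. \<bar>measure M A - measure N A\<bar>)"

end

(* Two estimates are combined. (1) From any S, the law at time t, restricted to the event that all
   points of S have died, is dominated by e^{lam |Lambda|} mu: a point born at x while (at least) R is
   present appears with rate at most lam e^{-phi(x, R)}, and each pair of points alive at time t was
   charged for its interaction when the younger one was born. Restriction is avoided by exhibiting an
   explicit supersolution of the backward equation, in which the points of S only contribute the
   union bound |S| e^{-t} for their survival. (2) By the GNZ equation mu is reversible, so the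
   Poincare inequality gives Var(P_t f) <= e^{-2 gamma t} Var(f). Applying (1) at time log(2|S|/eps)
   to P_s 1_A, split by AM-GM into its mean, a constant and a multiple of its squared deviation, gives
   the upper bound for P(X_t in A) - mu(A); the lower bound follows by passing to complements, since
   the dynamics does not explode. *)
theory Submission
  imports Defs
begin

section \<open>Measurability on the configuration space\<close>

text \<open>As long as a point of S survives, the configuration lies in a \<mu>-null set, so the L2
  decay from the Poincare inequality gives nothing before S has died out; hence the waiting time
  \<open>ln (2 * real (card S) / \<epsilon>)\<close>. Afterwards the density bound exp (lam vol)
  costs only half of its exponent: a mean square deviation v contributes sqrt (exp (lam vol) v) once
  the AM-GM parameter is optimised, which explains the 2 under \<open>lam * vol\<close>. The factor
  exp (lam vol) bounds the partition function: the supersolution yields the unnormalised Gibbs sum.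
  No path space is built. The law is a series over the number of jumps, that is, the minimal
  solution of the backward equation, and so it lies below every supersolution. Which points of S
  survive can be read off the state as \<eta> \<inter> S, because a birth hits S with probability 0.
  Inductions on the number of jumps leave an error \<open>late n\<close>, the probability of at
  least n jumps, which vanishes by non-explosion. Hard cores allow infinite energies, so detailed
  balance is written with products of weights and rates, never with quotients.\<close>

lemma space_conf_space [simp]: "space (conf_space \<Lambda>) = conf_sets \<Lambda>"
  unfolding conf_space_def by (intro space_measure_of) auto

lemma sets_conf_space: "sets (conf_space \<Lambda>) =
    sigma_sets (conf_sets \<Lambda>) {{\<eta> \<in> conf_sets \<Lambda>. card (\<eta> \<inter> B) = n} | B n. B \<in> sets borel}"
  unfolding conf_space_def by (intro sets_measure_of) auto

lemma conf_setsD: "\<eta> \<in> conf_sets \<Lambda> \<Longrightarrow> finite \<eta>" "\<eta> \<in> conf_sets \<Lambda> \<Longrightarrow> \<eta> \<subseteq> \<Lambda>"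
  by (auto simp: conf_sets_def)

lemma conf_sets_insert [simp]: "\<eta> \<in> conf_sets \<Lambda> \<Longrightarrow> x \<in> \<Lambda> \<Longrightarrow> insert x \<eta> \<in> conf_sets \<Lambda>"
  by (auto simp: conf_sets_def)

lemma conf_sets_remove [simp]: "\<eta> \<in> conf_sets \<Lambda> \<Longrightarrow> \<eta> - B \<in> conf_sets \<Lambda>"
  by (auto simp: conf_sets_def)

lemma conf_sets_empty [simp]: "{} \<in> conf_sets \<Lambda>"
  by (auto simp: conf_sets_def)

lemma measurable_card_Int [measurable (raw)]:
  assumes "h \<in> M \<rightarrow>\<^sub>M conf_space \<Lambda>" "B \<in> sets borel"
  shows "(\<lambda>\<omega>. card (h \<omega> \<inter> B)) \<in> M \<rightarrow>\<^sub>M count_space UNIV"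
proof -
  have "(\<lambda>\<eta>. card (\<eta> \<inter> B)) \<in> conf_space \<Lambda> \<rightarrow>\<^sub>M count_space UNIV"
  proof (rule measurableI)
    fix N :: "nat set" assume "N \<in> sets (count_space UNIV)"
    have "{\<eta> \<in> conf_sets \<Lambda>. card (\<eta> \<inter> B) = n} \<in> sets (conf_space \<Lambda>)" for n
      unfolding sets_conf_space using assms(2) by (intro sigma_sets.Basic) auto
    then have "(\<Union>n\<in>N. {\<eta> \<in> conf_sets \<Lambda>. card (\<eta> \<inter> B) = n}) \<in> sets (conf_space \<Lambda>)"
      by (intro sets.countable_UN') auto
    also have "(\<Union>n\<in>N. {\<eta> \<in> conf_sets \<Lambda>. card (\<eta> \<inter> B) = n}) =
        (\<lambda>\<eta>. card (\<eta> \<inter> B)) -` N \<inter> space (conf_space \<Lambda>)" by auto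
    finally show "(\<lambda>\<eta>. card (\<eta> \<inter> B)) -` N \<inter> space (conf_space \<Lambda>) \<in> sets (conf_space \<Lambda>)" .
  qed auto
  from measurable_compose[OF assms(1) this] show ?thesis .
qed

lemma measurable_card_conf [measurable (raw)]:
  assumes "h \<in> M \<rightarrow>\<^sub>M conf_space \<Lambda>"
  shows "(\<lambda>\<omega>. card (h \<omega>)) \<in> M \<rightarrow>\<^sub>M count_space UNIV"
  using measurable_card_Int[OF assms, of UNIV] by simp

lemma measurable_conf_spaceI:
  assumes "\<And>\<omega>. \<omega> \<in> space M \<Longrightarrow> h \<omega> \<in> conf_sets \<Lambda>"
    and "\<And>B. B \<in> sets borel \<Longrightarrow> (\<lambda>\<omega>. card (h \<omega> \<inter> B)) \<in> M \<rightarrow>\<^sub>M count_space UNIV"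
  shows "h \<in> M \<rightarrow>\<^sub>M conf_space \<Lambda>"
  unfolding conf_space_def
proof (rule measurable_measure_of)
  fix Y assume "Y \<in> {{\<eta> \<in> conf_sets \<Lambda>. card (\<eta> \<inter> B) = n} | B n. B \<in> sets borel}"
  then obtain B n where Y: "Y = {\<eta> \<in> conf_sets \<Lambda>. card (\<eta> \<inter> B) = n}" and B: "B \<in> sets borel"
    by auto
  have "h -` Y \<inter> space M = (\<lambda>\<omega>. card (h \<omega> \<inter> B)) -` {n} \<inter> space M"
    using assms(1) Y by auto
  then show "h -` Y \<inter> space M \<in> sets M"
    using measurable_sets[OF assms(2)[OF B], of "{n}"] by simp
qed (use assms(1) in auto)

text \<open>Single points carry the Borel sigma-algebra, not the Lebesgue one, because
  configurations are observed through counts in Borel sets only; the count in a Lebesgue set need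
  not be measurable. Maps into \<open>lebesgue_on \<Lambda>\<close> remain measurable into this
  coarser space.\<close>

definition points :: "'a::euclidean_space set \<Rightarrow> 'a measure" where
  "points \<Lambda> = restrict_space borel \<Lambda>"

lemma space_points [simp]: "space (points \<Lambda>) = \<Lambda>"
  by (simp add: points_def space_restrict_space)

lemma measurable_points_borel: "(\<lambda>x. x) \<in> points \<Lambda> \<rightarrow>\<^sub>M borel"
  unfolding points_def by (intro measurable_restrict_space1) simp

lemma measurable_points_compose:
  "h \<in> M \<rightarrow>\<^sub>M points \<Lambda> \<Longrightarrow> h \<in> M \<rightarrow>\<^sub>M borel"
  using measurable_compose[OF _ measurable_points_borel] by blast

lemma measurable_lebesgue_on_points:
  "(\<lambda>x. x) \<in> lebesgue_on \<Lambda> \<rightarrow>\<^sub>M points \<Lambda>"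
proof (rule measurableI)
  fix A assume "A \<in> sets (points \<Lambda>)"
  then obtain B where "B \<in> sets borel" "A = \<Lambda> \<inter> B"
    unfolding points_def by (auto simp: sets_restrict_space)
  then show "(\<lambda>x. x) -` A \<inter> space (lebesgue_on \<Lambda>) \<in> sets (lebesgue_on \<Lambda>)"
    by (auto simp: sets_restrict_space space_restrict_space image_iff intro!: bexI[of _ B])
qed (auto simp: space_restrict_space)

text \<open>A sum over a random finite set reduces to counting: for the indicator of a rectangle it
  is a count times an indicator, a pi-lambda argument extends this to measurable sets, and monotone
  limits extend it to functions. Energies, the jump operator and the sums in the GNZ equation all
  get their measurability from here.\<close>

lemma borel_measurable_sum_conf:
  fixes g :: "'a::euclidean_space \<times> 'b \<Rightarrow> ennreal"
  assumes g: "g \<in> borel_measurable (points \<Lambda> \<Otimes>\<^sub>M M)"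
    and h: "h \<in> M \<rightarrow>\<^sub>M conf_space \<Lambda>"
  shows "(\<lambda>\<omega>. \<Sum>x\<in>h \<omega>. g (x, \<omega>)) \<in> borel_measurable M"
proof -
  note [measurable] = h
  have hc: "h \<omega> \<in> conf_sets \<Lambda>" if "\<omega> \<in> space M" for \<omega>
    using measurable_space[OF h that] by simp
  have ind: "(\<lambda>\<omega>. \<Sum>x\<in>h \<omega>. indicator Q (x, \<omega>) :: ennreal) \<in> borel_measurable M"
    if "Q \<in> sets (points \<Lambda> \<Otimes>\<^sub>M M)" for Q
  proof -
    let ?G = "{a \<times> c | a c. a \<in> sets (points \<Lambda>) \<and> c \<in> sets M}"
    have "?G \<subseteq> Pow (\<Lambda> \<times> space M)"
      using pair_measure_closed[of "points \<Lambda>" M] by simp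
    moreover have "Q \<in> sigma_sets (\<Lambda> \<times> space M) ?G"
      using that unfolding sets_pair_measure by simp
    ultimately show ?thesis
    proof (induction rule: sigma_sets_induct_disjoint[OF Int_stable_pair_measure_generator, consumes 2,
        case_names basic empty compl union])
      case (basic Q)
      then obtain a c where Q: "Q = a \<times> c" "a \<in> sets (points \<Lambda>)" and c[measurable]: "c \<in> sets M"
        by auto
      then obtain B where B[measurable]: "B \<in> sets borel" and a: "a = \<Lambda> \<inter> B"
        unfolding points_def by (auto simp: sets_restrict_space)
      \<comment> \<open>The configuration lies in \<Lambda>, so the trace \<open>a\<close> may be
        replaced by the Borel set \<open>B\<close>, whose count is measurable.\<close>
      have "(\<Sum>x\<in>h \<omega>. indicator Q (x, \<omega>)) = (of_nat (card (h \<omega> \<inter> B)) * indicator c \<omega> :: ennreal)"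
        if "\<omega> \<in> space M" for \<omega>
      proof -
        have "(\<Sum>x\<in>h \<omega>. indicator Q (x, \<omega>)) = (\<Sum>x\<in>h \<omega>. indicator B x * indicator c \<omega> :: ennreal)"
          using conf_setsD(2)[OF hc[OF that]] by (intro sum.cong) (auto simp: Q a indicator_def)
        also have "\<dots> = (\<Sum>x\<in>h \<omega>. indicator B x) * indicator c \<omega>"
          by (simp add: sum_distrib_right)
        also have "(\<Sum>x\<in>h \<omega>. indicator B x :: ennreal) = (\<Sum>x\<in>h \<omega> \<inter> B. 1)"
          using conf_setsD(1)[OF hc[OF that]] by (intro sum.mono_neutral_cong_right) auto
        finally show ?thesis by simp
      qed
      then show "(\<lambda>\<omega>. \<Sum>x\<in>h \<omega>. indicator Q (x, \<omega>) :: ennreal) \<in> borel_measurable M"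
        by (subst measurable_cong) (auto intro!: borel_measurable_times_ennreal)
    next
      case empty
      show ?case by simp
    next
      case (compl Q)
      note IH = compl.IH
      have "(\<Sum>x\<in>h \<omega>. indicator (\<Lambda> \<times> space M - Q) (x, \<omega>) :: ennreal)
          = of_nat (card (h \<omega>)) - (\<Sum>x\<in>h \<omega>. indicator Q (x, \<omega>))" if "\<omega> \<in> space M" for \<omega>
      proof -
        have "(\<Sum>x\<in>h \<omega>. indicator (\<Lambda> \<times> space M - Q) (x, \<omega>) :: ennreal)
            + (\<Sum>x\<in>h \<omega>. indicator Q (x, \<omega>)) = (\<Sum>x\<in>h \<omega>. 1)"
          unfolding sum.distrib[symmetric] using conf_setsD(2)[OF hc[OF that]] that
          by (intro sum.cong) (auto simp: indicator_def)
        \<comment> \<open>Cancellation in \<open>ennreal\<close> requires a finite subtrahend;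
          finiteness of configurations supplies it.\<close>
        moreover have "(\<Sum>x\<in>h \<omega>. indicator Q (x, \<omega>) :: ennreal) \<noteq> top"
          using conf_setsD(1)[OF hc[OF that]] by (simp add: indicator_def)
        ultimately show ?thesis
          by (metis ennreal_add_diff_cancel_right sum_constant mult.right_neutral)
      qed
      then show "(\<lambda>\<omega>. \<Sum>x\<in>h \<omega>. indicator (\<Lambda> \<times> space M - Q) (x, \<omega>) :: ennreal) \<in> borel_measurable M"
        using IH by (simp cong: measurable_cong_simp)
    next
      case (union Q)
      note dis = union.hyps(1) and IH = union.IH
      have "(\<Sum>x\<in>h \<omega>. indicator (\<Union>i. Q i) (x, \<omega>) :: ennreal)
          = (\<Sum>i. \<Sum>x\<in>h \<omega>. indicator (Q i) (x, \<omega>))" for \<omega>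
        by (subst suminf_sum) (auto simp: suminf_indicator[OF dis])
      then show "(\<lambda>\<omega>. \<Sum>x\<in>h \<omega>. indicator (\<Union>i. Q i) (x, \<omega>) :: ennreal) \<in> borel_measurable M"
        using IH by simp
    qed
  qed
  from g show ?thesis
  proof (induction rule: borel_measurable_induct)
    case (cong f g)
    have "(\<Sum>x\<in>h \<omega>. f (x, \<omega>)) = (\<Sum>x\<in>h \<omega>. g (x, \<omega>))" if "\<omega> \<in> space M" for \<omega>
      using conf_setsD(2)[OF hc[OF that]] that
      by (intro sum.cong cong(3)) (auto simp: space_pair_measure)
    then show ?case using cong(4) by (subst measurable_cong) auto
  next
    case (set A) then show ?case by (rule ind)
  next
    case (mult f c)
    then show ?case by (simp add: sum_distrib_left[symmetric])
  next
    case (add f g)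
    then show ?case by (simp add: sum.distrib)
  next
    case (seq U)
    have "(\<Sum>x\<in>h \<omega>. (SUP i. U i) (x, \<omega>)) = (SUP i. \<Sum>x\<in>h \<omega>. U i (x, \<omega>))" for \<omega>
      using seq(3) by (subst ennreal_SUP_sum) (auto simp: incseq_def le_fun_def image_image)
    then show ?case using seq.IH by (auto simp: image_image intro!: borel_measurable_SUP)
  qed
qed

text \<open>A finite set is closed, so a point outside it has a basic open neighbourhood containing
  none of its points. With a countable basis, non-membership becomes a countable union of counting
  events.\<close>

lemma measurable_mem_conf [measurable (raw)]:
  fixes f :: "'b \<Rightarrow> 'a::euclidean_space"
  assumes "f \<in> M \<rightarrow>\<^sub>M points \<Lambda>" "h \<in> M \<rightarrow>\<^sub>M conf_space \<Lambda>"
  shows "Measurable.pred M (\<lambda>\<omega>. f \<omega> \<in> h \<omega>)"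
proof -
  note [measurable] = assms
  obtain \<B> :: "'a set set" where \<B>: "countable \<B>" "topological_basis \<B>"
    using ex_countable_basis by blast
  have fin: "finite (h \<omega>)" if "\<omega> \<in> space M" for \<omega>
    using measurable_space[OF assms(2) that] conf_setsD by auto
  have eq: "f \<omega> \<in> h \<omega> \<longleftrightarrow> \<not> (\<exists>U\<in>\<B>. f \<omega> \<in> U \<and> card (h \<omega> \<inter> U) = 0)" if "\<omega> \<in> space M" for \<omega>
  proof
    assume "f \<omega> \<in> h \<omega>" then show "\<not> (\<exists>U\<in>\<B>. f \<omega> \<in> U \<and> card (h \<omega> \<inter> U) = 0)"
      using fin[OF that] by (auto simp: card_eq_0_iff)
  next
    assume *: "\<not> (\<exists>U\<in>\<B>. f \<omega> \<in> U \<and> card (h \<omega> \<inter> U) = 0)"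
    show "f \<omega> \<in> h \<omega>"
    proof (rule ccontr)
      assume "f \<omega> \<notin> h \<omega>"
      moreover have "open (- h \<omega>)" using fin[OF that] by (simp add: finite_imp_closed open_Compl)
      ultimately obtain U where "U \<in> \<B>" "f \<omega> \<in> U" "U \<subseteq> - h \<omega>"
        using topological_basisE[OF \<B>(2), of "- h \<omega>" "f \<omega>"] by auto
      then show False using * by (auto simp: card_eq_0_iff)
    qed
  qed
  have [measurable]: "f \<in> borel_measurable M" by (rule measurable_points_compose[OF assms(1)])
  have "Measurable.pred M (\<lambda>\<omega>. f \<omega> \<in> U \<and> card (h \<omega> \<inter> U) = 0)" if "U \<in> \<B>" for U
  proof -
    have [measurable]: "U \<in> sets borel" using \<B>(2) that by (simp add: topological_basis_open)
    show ?thesis by measurable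
  qed
  then have "Measurable.pred M (\<lambda>\<omega>. \<exists>U\<in>\<B>. f \<omega> \<in> U \<and> card (h \<omega> \<inter> U) = 0)"
    unfolding pred_def by (intro sets.sets_Collect_countable_Ex'[OF _ \<B>(1)])
  then have "Measurable.pred M (\<lambda>\<omega>. \<not> (\<exists>U\<in>\<B>. f \<omega> \<in> U \<and> card (h \<omega> \<inter> U) = 0))" by measurable
  then show ?thesis by (subst measurable_cong[OF eq]) auto
qed

lemma measurable_insert_conf [measurable (raw)]:
  fixes f :: "'b \<Rightarrow> 'a::euclidean_space"
  assumes "f \<in> M \<rightarrow>\<^sub>M points \<Lambda>" "h \<in> M \<rightarrow>\<^sub>M conf_space \<Lambda>"
  shows "(\<lambda>\<omega>. insert (f \<omega>) (h \<omega>)) \<in> M \<rightarrow>\<^sub>M conf_space \<Lambda>"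
proof (rule measurable_conf_spaceI)
  note [measurable] = assms
  have [measurable]: "f \<in> borel_measurable M" by (rule measurable_points_compose[OF assms(1)])
  have mem: "f \<omega> \<in> \<Lambda>" "h \<omega> \<in> conf_sets \<Lambda>" if "\<omega> \<in> space M" for \<omega>
    using measurable_space[OF assms(1) that] measurable_space[OF assms(2) that] by auto
  then show "insert (f \<omega>) (h \<omega>) \<in> conf_sets \<Lambda>" if "\<omega> \<in> space M" for \<omega> using that by auto
  fix B :: "'a set" assume [measurable]: "B \<in> sets borel"
  have "card (insert (f \<omega>) (h \<omega>) \<inter> B) = card (h \<omega> \<inter> B) + (if f \<omega> \<in> B \<and> \<not> f \<omega> \<in> h \<omega> then 1 else 0)"
    if "\<omega> \<in> space M" for \<omega>
    using conf_setsD(1)[OF mem(2)[OF that]] by (auto simp: Int_insert_left insert_absorb card_insert_if)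
  then show "(\<lambda>\<omega>. card (insert (f \<omega>) (h \<omega>) \<inter> B)) \<in> M \<rightarrow>\<^sub>M count_space UNIV"
    by (subst measurable_cong) auto
qed

lemma measurable_remove_conf [measurable (raw)]:
  fixes f :: "'b \<Rightarrow> 'a::euclidean_space"
  assumes "f \<in> M \<rightarrow>\<^sub>M points \<Lambda>" "h \<in> M \<rightarrow>\<^sub>M conf_space \<Lambda>"
  shows "(\<lambda>\<omega>. h \<omega> - {f \<omega>}) \<in> M \<rightarrow>\<^sub>M conf_space \<Lambda>"
proof (rule measurable_conf_spaceI)
  note [measurable] = assms
  have [measurable]: "f \<in> borel_measurable M" by (rule measurable_points_compose[OF assms(1)])
  have mem: "h \<omega> \<in> conf_sets \<Lambda>" if "\<omega> \<in> space M" for \<omega>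
    using measurable_space[OF assms(2) that] by auto
  then show "h \<omega> - {f \<omega>} \<in> conf_sets \<Lambda>" if "\<omega> \<in> space M" for \<omega> using that by auto
  fix B :: "'a set" assume [measurable]: "B \<in> sets borel"
  have "card ((h \<omega> - {f \<omega>}) \<inter> B) = card (h \<omega> \<inter> B) - (if f \<omega> \<in> B \<and> f \<omega> \<in> h \<omega> then 1 else 0)"
    if "\<omega> \<in> space M" for \<omega>
  proof -
    have "(h \<omega> - {f \<omega>}) \<inter> B = h \<omega> \<inter> B - {f \<omega>}" by auto
    then show ?thesis using conf_setsD(1)[OF mem[OF that]] by (simp add: card_Diff_singleton_if)
  qed
  then show "(\<lambda>\<omega>. card ((h \<omega> - {f \<omega>}) \<inter> B)) \<in> M \<rightarrow>\<^sub>M count_space UNIV"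
    by (subst measurable_cong) auto
qed

section \<open>Energies, birth rates and the jump operator\<close>

lemma exp_neg_bounds: "0 \<le> exp_neg u" "exp_neg u \<le> 1"
  by (auto simp: exp_neg_def)

lemma exp_neg_0 [simp]: "exp_neg 0 = 1" and exp_neg_top [simp]: "exp_neg top = 0"
  by (auto simp: exp_neg_def)

lemma exp_neg_add: "exp_neg (u + v) = exp_neg u * exp_neg v"
  by (cases u; cases v) (auto simp: exp_neg_def exp_add[symmetric] simp flip: ennreal_plus)

lemma exp_neg_antimono: "u \<le> v \<Longrightarrow> exp_neg v \<le> exp_neg u"
  by (cases u; cases v) (auto simp: exp_neg_def top_unique)

lemma borel_measurable_exp_neg [measurable]: "exp_neg \<in> borel_measurable borel"
  unfolding exp_neg_def[abs_def] by measurable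

lemma energy_empty [simp]: "energy \<phi> {} = 0"
  by (simp add: energy_def)

text \<open>Every new pair occurs twice among the ordered pairs, which the division by 2 undoes. The
  identity is one of sums in \<open>ennreal\<close>, so it covers hard cores.\<close>

lemma energy_insert:
  assumes sym: "\<And>x y. \<phi> x y = \<phi> y x" and fin: "finite \<eta>" and x: "x \<notin> \<eta>"
  shows "energy \<phi> (insert x \<eta>) = energy \<phi> \<eta> + (\<Sum>y\<in>\<eta>. \<phi> x y)"
proof -
  have "(\<Sum>z\<in>\<eta>. \<Sum>y\<in>insert x \<eta> - {z}. \<phi> z y) = (\<Sum>z\<in>\<eta>. \<phi> x z + (\<Sum>y\<in>\<eta> - {z}. \<phi> z y))"
  proof (rule sum.cong)
    fix z assume z: "z \<in> \<eta>"
    then have "insert x \<eta> - {z} = insert x (\<eta> - {z})" using x by auto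
    then show "(\<Sum>y\<in>insert x \<eta> - {z}. \<phi> z y) = \<phi> x z + (\<Sum>y\<in>\<eta> - {z}. \<phi> z y)"
      using fin x sym by simp
  qed simp
  then have "energy \<phi> (insert x \<eta>) =
      ((\<Sum>y\<in>\<eta>. \<phi> x y) * 2 + (\<Sum>z\<in>\<eta>. \<Sum>y\<in>\<eta> - {z}. \<phi> z y)) / 2"
    unfolding energy_def using fin x by (simp add: sum.distrib mult_2_right add_ac)
  also have "\<dots> = (\<Sum>y\<in>\<eta>. \<phi> x y) + energy \<phi> \<eta>"
    unfolding energy_def by (simp add: add_divide_distrib_ennreal ennreal_mult_divide_eq)
  finally show ?thesis by (simp add: add.commute)
qed

text \<open>The inner sum is treated on pairs (x, \<omega>), with x as a parameter, so that the
  summation lemma can be applied a second time to the outer sum.\<close>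

lemma borel_measurable_energy [measurable (raw)]:
  fixes \<phi> :: "'a::euclidean_space \<Rightarrow> 'a \<Rightarrow> ennreal"
  assumes [measurable]: "case_prod \<phi> \<in> borel_measurable (borel \<Otimes>\<^sub>M borel)"
    and h[measurable]: "h \<in> M \<rightarrow>\<^sub>M conf_space \<Lambda>"
  shows "(\<lambda>\<omega>. energy \<phi> (h \<omega>)) \<in> borel_measurable M"
proof -
  note [measurable] = measurable_points_borel
  have "(\<lambda>p. \<Sum>y\<in>h (snd p) - {fst p}. (\<lambda>(y, p). \<phi> (fst p) y) (y, p))
      \<in> borel_measurable (points \<Lambda> \<Otimes>\<^sub>M M)"
    by (rule borel_measurable_sum_conf) measurable
  then have "(\<lambda>\<omega>. \<Sum>x\<in>h \<omega>. (\<lambda>p. \<Sum>y\<in>h (snd p) - {fst p}. \<phi> (fst p) y) (x, \<omega>)) \<in> borel_measurable M"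
    by (intro borel_measurable_sum_conf[OF _ h]) simp
  then show ?thesis unfolding energy_def by simp
qed

section \<open>Birth rates, repulsion and detailed balance\<close>

locale glauber =
  fixes \<Lambda> :: "'a::euclidean_space set" and lam :: real and \<phi> :: "'a \<Rightarrow> 'a \<Rightarrow> ennreal"
  assumes bounded_domain: "bounded \<Lambda>" and domain_sets: "\<Lambda> \<in> sets lebesgue"
    and potential: "repulsive_finite_range \<phi>" and lam_nonneg: "0 \<le> lam"
begin

abbreviation C :: "'a set measure" where "C \<equiv> conf_space \<Lambda>"
abbreviation L :: "'a measure" where "L \<equiv> lebesgue_on \<Lambda>"
abbreviation b :: "'a set \<Rightarrow> 'a \<Rightarrow> real" where "b \<equiv> birth_rate lam \<phi>"
abbreviation r :: "'a set \<Rightarrow> real" where "r \<equiv> exit_rate \<Lambda> lam \<phi>"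
abbreviation vol :: real where "vol \<equiv> measure lebesgue \<Lambda>"

lemma \<phi>_sym: "\<phi> x y = \<phi> y x"
  using potential by (auto simp: repulsive_finite_range_def)

lemma \<phi>_measurable [measurable]: "case_prod \<phi> \<in> borel_measurable (borel \<Otimes>\<^sub>M borel)"
  using potential by (auto simp: repulsive_finite_range_def)

lemma space_L [simp]: "space L = \<Lambda>"
  by (simp add: space_restrict_space)

lemma emeasure_domain: "emeasure lebesgue \<Lambda> = ennreal vol"
  using bounded_set_imp_lmeasurable[OF bounded_domain domain_sets]
  by (simp add: emeasure_eq_measure2)

lemma emeasure_L_space: "emeasure L \<Lambda> = ennreal vol"
  using domain_sets by (simp add: emeasure_restrict_space emeasure_domain)

sublocale finite_measure L
  by standard (simp add: emeasure_L_space)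

lemma measurable_L_points [measurable (raw)]:
  "f \<in> M \<rightarrow>\<^sub>M L \<Longrightarrow> f \<in> M \<rightarrow>\<^sub>M points \<Lambda>"
  using measurable_compose[OF _ measurable_lebesgue_on_points] by blast

text \<open>Births almost surely avoid any prescribed finite set, so identities involving
  \<open>insert x \<eta>\<close> need to be checked only for new points x. Applied to S, this keeps
  newborn points apart from initial ones.\<close>

lemma AE_not_in_finite: "finite F \<Longrightarrow> AE x in L. x \<notin> F"
  using domain_sets finite_imp_null_set_lborel[of F]
  by (subst AE_restrict_space_iff)
    (auto intro!: AE_I'[of F] simp: null_sets_completionI)

lemma b_nonneg: "0 \<le> b \<eta> x" and b_le: "b \<eta> x \<le> lam"
  using lam_nonneg exp_neg_bounds by (auto simp: birth_rate_def mult_left_le)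

lemma b_measurable [measurable (raw)]:
  assumes [measurable]: "f \<in> M \<rightarrow>\<^sub>M points \<Lambda>" "h \<in> M \<rightarrow>\<^sub>M C"
  shows "(\<lambda>\<omega>. b (h \<omega>) (f \<omega>)) \<in> borel_measurable M"
  unfolding birth_rate_def by measurable

text \<open>Adding a point keeps the energy infinite, and \<open>top - top = top\<close> is sent to
  0 by \<open>exp_neg\<close>.\<close>

lemma b_eq_0: "energy \<phi> \<eta> = top \<Longrightarrow> finite \<eta> \<Longrightarrow> x \<notin> \<eta> \<Longrightarrow> b \<eta> x = 0"
  by (simp add: birth_rate_def energy_insert[OF \<phi>_sym])

lemma b_eq: "energy \<phi> \<eta> \<noteq> top \<Longrightarrow> finite \<eta> \<Longrightarrow> x \<notin> \<eta> \<Longrightarrow> b \<eta> x = lam * exp_neg (\<Sum>y\<in>\<eta>. \<phi> x y)"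
  by (simp add: birth_rate_def energy_insert[OF \<phi>_sym] less_top)

lemma energy_mono: 
  assumes "finite \<eta>" "R \<subseteq> \<eta>" shows "energy \<phi> R \<le> energy \<phi> \<eta>"
proof -
  have "finite R" using assms finite_subset by blast
  have "(\<Sum>x\<in>R. \<Sum>y\<in>R - {x}. \<phi> x y) \<le> (\<Sum>x\<in>\<eta>. \<Sum>y\<in>\<eta> - {x}. \<phi> x y)"
    using assms by (intro sum_mono2 order_trans[OF sum_mono sum_mono2]) auto
  then show ?thesis unfolding energy_def by (rule divide_right_mono_ennreal)
qed

text \<open>This is where repulsion enters: interactions are nonnegative, so additional points can
  only lower the birth rate. An infinite energy of \<eta> makes its rate 0; otherwise R also has
  finite energy and the explicit formula compares the two.\<close>

lemma b_antimono: 
  assumes "finite \<eta>" "R \<subseteq> \<eta>" "x \<notin> \<eta>" shows "b \<eta> x \<le> b R x"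
proof (cases "energy \<phi> \<eta> = top")
  case True then show ?thesis using assms b_nonneg by (simp add: b_eq_0)
next
  case False
  then have "energy \<phi> R \<noteq> top" using energy_mono[OF assms(1,2)] by (auto simp: top_unique)
  moreover have "finite R" using assms finite_subset by blast
  ultimately have "b R x = lam * exp_neg (\<Sum>y\<in>R. \<phi> x y)" using assms(2,3) by (intro b_eq) auto
  moreover have "(\<Sum>y\<in>R. \<phi> x y) \<le> (\<Sum>y\<in>\<eta>. \<phi> x y)" using assms by (intro sum_mono2) auto
  ultimately show ?thesis using False assms lam_nonneg
    by (simp add: b_eq exp_neg_antimono mult_left_mono)
qed

text \<open>Detailed balance between \<eta> and \<open>insert x \<eta>\<close>. In product form it
  survives hard cores, since both sides vanish when \<eta> has infinite energy.\<close>

lemma exp_neg_energy_insert: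
  assumes "finite \<eta>" "x \<notin> \<eta>"
  shows "lam * exp_neg (energy \<phi> (insert x \<eta>)) = exp_neg (energy \<phi> \<eta>) * b \<eta> x"
  using assms by (cases "energy \<phi> \<eta> = top")
    (simp_all add: energy_insert[OF \<phi>_sym] b_eq exp_neg_add)

text \<open>Both sides collect the same three interactions: x with \<eta>, y with \<eta>, and x with
  y. The order in which two points are born is therefore irrelevant, which is the symmetry behind
  the GNZ equation.\<close>

lemma b_swap:
  assumes "finite \<eta>" "x \<notin> \<eta>" "y \<notin> \<eta>" "x \<noteq> y"
  shows "b \<eta> y * b (insert y \<eta>) x = b \<eta> x * b (insert x \<eta>) y"
proof (cases "energy \<phi> \<eta> = top")
  case True then show ?thesis using assms by (simp add: b_eq_0)
next
  case False
  have *: "b \<eta> y * b (insert y \<eta>) x =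
      lam * lam * exp_neg (\<Sum>z\<in>\<eta>. \<phi> y z) * exp_neg (\<phi> x y) * exp_neg (\<Sum>z\<in>\<eta>. \<phi> x z)"
    if "x \<notin> \<eta>" "y \<notin> \<eta>" "x \<noteq> y" for x y
  proof (cases "energy \<phi> (insert y \<eta>) = top")
    \<comment> \<open>The second rate is now 0 by convention, and the formula persists because the
      rate of the first birth is already 0.\<close>
    case True
    then have "(\<Sum>z\<in>\<eta>. \<phi> y z) = top" using False that assms(1) by (simp add: energy_insert[OF \<phi>_sym])
    then have "exp_neg (\<Sum>z\<in>\<eta>. \<phi> y z) = 0" by (simp only: exp_neg_top)
    then show ?thesis using False that assms(1) by (simp add: b_eq)
  next
    case fin: False
    then show ?thesis using False that assms(1) by (simp add: b_eq exp_neg_add)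
  qed
  show ?thesis using *[of x y] *[of y x] assms \<phi>_sym[of x y] by simp
qed

definition birth_op :: "('a set \<Rightarrow> ennreal) \<Rightarrow> 'a set \<Rightarrow> ennreal" where
  "birth_op g \<eta> = (\<integral>\<^sup>+x. ennreal (b \<eta> x) * g (insert x \<eta>) \<partial>L)"

text \<open>The off-diagonal part of the generator, which is \<open>jump_op\<close> minus
  multiplication by the exit rate.\<close>

definition jump_op :: "('a set \<Rightarrow> ennreal) \<Rightarrow> 'a set \<Rightarrow> ennreal" where
  "jump_op g \<eta> = (\<Sum>x\<in>\<eta>. g (\<eta> - {x})) + birth_op g \<eta>"

definition first_jump :: "(real \<Rightarrow> 'a set \<Rightarrow> ennreal) \<Rightarrow> real \<Rightarrow> 'a set \<Rightarrow> ennreal" where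
  "first_jump g t \<eta> = (\<integral>\<^sup>+s\<in>{0..t}. ennreal (exp (- r \<eta> * s)) * jump_op (g (t - s)) \<eta> \<partial>lborel)"

text \<open>The recursion of \<open>glauber_jumps\<close> with an arbitrary function in place of an
  indicator: the semigroup property applies the dynamics to an already evolved function.\<close>

primrec jumps :: "('a set \<Rightarrow> ennreal) \<Rightarrow> nat \<Rightarrow> real \<Rightarrow> 'a set \<Rightarrow> ennreal" where
  "jumps f 0 = (\<lambda>t \<eta>. ennreal (exp (- r \<eta> * t)) * f \<eta>)"
| "jumps f (Suc n) = first_jump (jumps f n)"

lemma glauber_jumps_eq: "glauber_jumps \<Lambda> lam \<phi> A n = jumps (indicator A) n"
  by (induction n) (simp_all add: fun_eq_iff first_jump_def jump_op_def birth_op_def)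

lemma birth_op_measurable [measurable (raw)]:
  assumes [measurable]: "(\<lambda>p. g (fst p) (snd p)) \<in> borel_measurable (M \<Otimes>\<^sub>M C)" "h \<in> M \<rightarrow>\<^sub>M C"
  shows "(\<lambda>\<omega>. birth_op (g \<omega>) (h \<omega>)) \<in> borel_measurable M"
proof -
  have "(\<lambda>p. (fst p, insert (snd p) (h (fst p)))) \<in> M \<Otimes>\<^sub>M L \<rightarrow>\<^sub>M M \<Otimes>\<^sub>M C" by measurable
  from measurable_compose[OF this assms(1)]
  have [measurable]: "(\<lambda>p. g (fst p) (insert (snd p) (h (fst p)))) \<in> borel_measurable (M \<Otimes>\<^sub>M L)" by simp
  show ?thesis unfolding birth_op_def
    by (rule borel_measurable_nn_integral) (simp add: case_prod_beta', measurable)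
qed

lemma jump_op_measurable [measurable (raw)]:
  assumes [measurable]: "(\<lambda>p. g (fst p) (snd p)) \<in> borel_measurable (M \<Otimes>\<^sub>M C)" "h \<in> M \<rightarrow>\<^sub>M C"
  shows "(\<lambda>\<omega>. jump_op (g \<omega>) (h \<omega>)) \<in> borel_measurable M"
proof -
  have "(\<lambda>p. (snd p, h (snd p) - {fst p})) \<in> points \<Lambda> \<Otimes>\<^sub>M M \<rightarrow>\<^sub>M M \<Otimes>\<^sub>M C" by measurable
  from measurable_compose[OF this assms(1)]
  have "(\<lambda>p. g (snd p) (h (snd p) - {fst p})) \<in> borel_measurable (points \<Lambda> \<Otimes>\<^sub>M M)" by simp
  from borel_measurable_sum_conf[OF this assms(2)]
  have [measurable]: "(\<lambda>\<omega>. \<Sum>x\<in>h \<omega>. g \<omega> (h \<omega> - {x})) \<in> borel_measurable M" by simp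
  show ?thesis unfolding jump_op_def by measurable
qed

lemma birth_op_1: "birth_op (\<lambda>_. 1) \<eta> = ennreal (\<integral>x. b \<eta> x \<partial>L)" if "\<eta> \<in> conf_sets \<Lambda>"
proof -
  have [measurable]: "(\<lambda>x. \<eta>) \<in> L \<rightarrow>\<^sub>M C" using that by simp
  have "integrable L (b \<eta>)"
    using b_nonneg b_le by (intro integrable_const_bound[where B = lam]) auto
  then show ?thesis unfolding birth_op_def using b_nonneg by (simp add: nn_integral_eq_integral)
qed

lemma r_eq: "\<eta> \<in> conf_sets \<Lambda> \<Longrightarrow> ennreal (r \<eta>) = jump_op (\<lambda>_. 1) \<eta>"
  by (simp add: exit_rate_def jump_op_def birth_op_1 b_nonneg integral_nonneg_AE
      ennreal_of_nat_eq_real_of_nat flip: ennreal_plus)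

lemma r_nonneg: "0 \<le> r \<eta>"
  by (simp add: exit_rate_def b_nonneg integral_nonneg_AE)

lemma birth_op_1_le: "birth_op (\<lambda>_. 1) \<eta> \<le> ennreal (lam * vol)"
proof -
  have "birth_op (\<lambda>_. 1) \<eta> \<le> (\<integral>\<^sup>+x. ennreal lam \<partial>L)"
    unfolding birth_op_def by (intro nn_integral_mono) (auto intro!: ennreal_leI b_le)
  then show ?thesis by (simp add: emeasure_L_space ennreal_mult lam_nonneg)
qed

lemma r_measurable [measurable (raw)]:
  assumes [measurable]: "h \<in> M \<rightarrow>\<^sub>M C" shows "(\<lambda>\<omega>. r (h \<omega>)) \<in> borel_measurable M"
proof -
  have [measurable]: "(\<lambda>\<omega>. \<integral>x. b (h \<omega>) x \<partial>L) \<in> borel_measurable M"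
    by (rule borel_measurable_lebesgue_integral) (simp add: case_prod_beta', measurable)
  show ?thesis unfolding exit_rate_def by measurable
qed

lemma first_jump_measurable [measurable (raw)]:
  assumes g: "(\<lambda>p. g (fst p) (snd p)) \<in> borel_measurable (borel \<Otimes>\<^sub>M C)"
    and [measurable]: "k \<in> borel_measurable M" "h \<in> M \<rightarrow>\<^sub>M C"
  shows "(\<lambda>\<omega>. first_jump g (k \<omega>) (h \<omega>)) \<in> borel_measurable M"
proof -
  have "(\<lambda>p. (k (fst (fst p)) - snd (fst p), snd p)) \<in> (M \<Otimes>\<^sub>M borel) \<Otimes>\<^sub>M C \<rightarrow>\<^sub>M borel \<Otimes>\<^sub>M C"
    by measurable
  from measurable_compose[OF this g]
  have "(\<lambda>p. g (k (fst (fst p)) - snd (fst p)) (snd p)) \<in> borel_measurable ((M \<Otimes>\<^sub>M borel) \<Otimes>\<^sub>M C)"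
    by simp
  then have [measurable]: "(\<lambda>p. jump_op (g (k (fst p) - snd p)) (h (fst p))) \<in> borel_measurable (M \<Otimes>\<^sub>M borel)"
    by (rule jump_op_measurable) measurable
  have [measurable]: "(\<lambda>p. indicator {0..k (fst p)} (snd p) :: ennreal) \<in> borel_measurable (M \<Otimes>\<^sub>M borel)"
    unfolding indicator_def atLeastAtMost_iff by measurable
  show ?thesis unfolding first_jump_def
    by (rule lborel.borel_measurable_nn_integral) (simp add: case_prod_beta', measurable)
qed

lemma jumps_measurable:
  assumes [measurable]: "f \<in> borel_measurable C"
  shows "(\<lambda>p. jumps f n (fst p) (snd p)) \<in> borel_measurable (borel \<Otimes>\<^sub>M C)"
proof (induction n)
  case (Suc n)
  note [measurable] = Suc
  show ?case unfolding jumps.simps by measurable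
qed simp

end

section \<open>The law of the dynamics: non-explosion and semigroup property\<close>

lemma ennreal_suminf_swap:
  fixes f :: "nat \<Rightarrow> nat \<Rightarrow> ennreal"
  shows "(\<Sum>i. \<Sum>j. f i j) = (\<Sum>j. \<Sum>i. f i j)"
proof -
  have "(\<Sum>i. \<Sum>j. f i j) = (\<integral>\<^sup>+i. (\<Sum>j. f i j) \<partial>count_space UNIV)"
    by (simp add: nn_integral_count_space_nat)
  also have "\<dots> = (\<Sum>j. \<integral>\<^sup>+i. f i j \<partial>count_space UNIV)" by (rule nn_integral_suminf) simp
  finally show ?thesis by (simp add: nn_integral_count_space_nat)
qed

text \<open>Variation of constants: in s, the integrand is the derivative of - exp (- c s) V (t -
  s). With c the exit rate and s the time of the first jump, this translates between differential
  and integral forms of the backward equation.\<close>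

lemma nn_integral_exp_derivative:
  fixes c t :: real
  assumes t: "0 \<le> t"
    and [measurable]: "V \<in> borel_measurable borel" "V' \<in> borel_measurable borel"
    and V: "\<And>\<sigma>. (V has_real_derivative V' \<sigma>) (at \<sigma>)" "\<And>\<sigma>. 0 \<le> \<sigma> \<Longrightarrow> 0 \<le> V \<sigma>"
    and nn: "\<And>\<sigma>. 0 \<le> \<sigma> \<Longrightarrow> \<sigma> \<le> t \<Longrightarrow> 0 \<le> V' \<sigma> + c * V \<sigma>"
  shows "ennreal (exp (- c * t) * V 0) +
    (\<integral>\<^sup>+s\<in>{0..t}. ennreal (exp (- c * s) * (V' (t - s) + c * V (t - s))) \<partial>lborel) = ennreal (V t)"
proof -
  have "(\<integral>\<^sup>+s\<in>{0..t}. ennreal (exp (- c * s) * (V' (t - s) + c * V (t - s))) \<partial>lborel)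
      = ennreal (- exp (- c * t) * V (t - t) - - exp (- c * 0) * V (t - 0))"
  proof (rule nn_integral_FTC_Icc)
    fix s assume "s \<in> {0..t}" then have s: "0 \<le> s" "s \<le> t" by auto
    show "((\<lambda>s. - exp (- c * s) * V (t - s)) has_real_derivative
        exp (- c * s) * (V' (t - s) + c * V (t - s))) (at s)"
      by (auto intro!: derivative_eq_intros DERIV_chain2[OF V(1)] simp: algebra_simps)
    show "0 \<le> exp (- c * s) * (V' (t - s) + c * V (t - s))" using nn[of "t - s"] s by simp
  next
    show "(\<lambda>s. exp (- c * s) * (V' (t - s) + c * V (t - s))) \<in> borel_measurable borel" by measurable
  qed (rule t)
  \<comment> \<open>Without this, \<open>ennreal\<close> could truncate the difference produced by
    the fundamental theorem. It follows because exp (c s) V s is nondecreasing.\<close>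
  moreover have "exp (- c * t) * V 0 \<le> V t"
  proof -
    have "(\<lambda>s. exp (c * s) * V s) 0 \<le> (\<lambda>s. exp (c * s) * V s) t"
    proof (rule DERIV_nonneg_imp_nondecreasing[OF t])
      fix s assume "0 \<le> s" "s \<le> t"
      then have "0 \<le> exp (c * s) * (V' s + c * V s)" using nn[of s] by simp
      moreover have "((\<lambda>s. exp (c * s) * V s) has_real_derivative exp (c * s) * (V' s + c * V s)) (at s)"
        by (auto intro!: derivative_eq_intros V(1) simp: algebra_simps)
      ultimately show "\<exists>y. ((\<lambda>s. exp (c * s) * V s) has_real_derivative y) (at s) \<and> 0 \<le> y"
        by blast
    qed
    then show ?thesis by (simp add: exp_minus field_simps)
  qed
  ultimately show ?thesis using V(2)[of 0] V(2)[OF t] by (simp flip: ennreal_plus)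
qed

context glauber begin

section \<open>Monotonicity and linearity of the jump operators\<close>

lemma birth_op_mono:
  "(\<And>\<eta>. \<eta> \<in> conf_sets \<Lambda> \<Longrightarrow> f \<eta> \<le> g \<eta>) \<Longrightarrow> \<eta> \<in> conf_sets \<Lambda> \<Longrightarrow> birth_op f \<eta> \<le> birth_op g \<eta>"
  unfolding birth_op_def by (intro nn_integral_mono mult_left_mono) auto

lemma jump_op_mono:
  "(\<And>\<eta>. \<eta> \<in> conf_sets \<Lambda> \<Longrightarrow> f \<eta> \<le> g \<eta>) \<Longrightarrow> \<eta> \<in> conf_sets \<Lambda> \<Longrightarrow> jump_op f \<eta> \<le> jump_op g \<eta>"
  unfolding jump_op_def by (intro add_mono sum_mono birth_op_mono) auto

lemma first_jump_mono:
  assumes "\<And>s \<eta>. 0 \<le> s \<Longrightarrow> s \<le> t \<Longrightarrow> \<eta> \<in> conf_sets \<Lambda> \<Longrightarrow> f s \<eta> \<le> g s \<eta>" "\<eta> \<in> conf_sets \<Lambda>"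
  shows "first_jump f t \<eta> \<le> first_jump g t \<eta>"
  unfolding first_jump_def using assms
  by (intro nn_integral_mono) (auto simp: indicator_def intro!: mult_left_mono jump_op_mono)

lemma first_jump_cong:
  assumes "\<And>s \<eta>. 0 \<le> s \<Longrightarrow> s \<le> t \<Longrightarrow> \<eta> \<in> conf_sets \<Lambda> \<Longrightarrow> f s \<eta> = g s \<eta>" "\<eta> \<in> conf_sets \<Lambda>"
  shows "first_jump f t \<eta> = first_jump g t \<eta>"
  using assms by (intro antisym first_jump_mono) auto

lemma const_conf_measurable: "\<eta> \<in> conf_sets \<Lambda> \<Longrightarrow> (\<lambda>_. \<eta>) \<in> M \<rightarrow>\<^sub>M C"
  by simp

lemma measurable_insert_L:
  assumes "\<eta> \<in> conf_sets \<Lambda>" "f \<in> borel_measurable C"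
  shows "(\<lambda>x. f (insert x \<eta>)) \<in> borel_measurable L"
proof -
  note [measurable] = const_conf_measurable[OF assms(1)]
  have "(\<lambda>x. insert x \<eta>) \<in> L \<rightarrow>\<^sub>M C" by measurable
  from measurable_compose[OF this assms(2)] show ?thesis .
qed

lemma b_measurable_L: "\<eta> \<in> conf_sets \<Lambda> \<Longrightarrow> b \<eta> \<in> borel_measurable L"
  using b_measurable[of "\<lambda>x. x" L "\<lambda>_. \<eta>"] measurable_lebesgue_on_points[of \<Lambda>] by simp

lemma measurable_section:
  assumes "(\<lambda>p. g (fst p) (snd p)) \<in> borel_measurable (borel \<Otimes>\<^sub>M C)"
  shows "g (t::real) \<in> borel_measurable C"
proof -
  have "(\<lambda>\<eta>. (t, \<eta>)) \<in> C \<rightarrow>\<^sub>M borel \<Otimes>\<^sub>M C" by measurable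
  from measurable_compose[OF this assms] show ?thesis by simp
qed

lemma jump_op_measurable_time:
  assumes g: "(\<lambda>p. g (fst p) (snd p)) \<in> borel_measurable (borel \<Otimes>\<^sub>M C)" and "\<eta> \<in> conf_sets \<Lambda>"
    and "k \<in> borel_measurable M"
  shows "(\<lambda>s. jump_op (g (k s :: real)) \<eta>) \<in> borel_measurable M"
proof -
  note [measurable] = assms(3)
  have "(\<lambda>p. (k (fst p), snd p)) \<in> M \<Otimes>\<^sub>M C \<rightarrow>\<^sub>M borel \<Otimes>\<^sub>M C" by measurable
  from measurable_compose[OF this g]
  show ?thesis by (intro jump_op_measurable const_conf_measurable[OF assms(2)]) simp
qed

lemma birth_op_add:
  assumes "f \<in> borel_measurable C" "g \<in> borel_measurable C" "\<eta> \<in> conf_sets \<Lambda>"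
  shows "birth_op (\<lambda>\<eta>. f \<eta> + g \<eta>) \<eta> = birth_op f \<eta> + birth_op g \<eta>"
  unfolding birth_op_def using measurable_insert_L[OF assms(3)] assms b_measurable_L[OF assms(3)]
  by (simp add: distrib_left nn_integral_add)

lemma birth_op_cmult:
  assumes "f \<in> borel_measurable C" "\<eta> \<in> conf_sets \<Lambda>"
  shows "birth_op (\<lambda>\<eta>. c * f \<eta>) \<eta> = c * birth_op f \<eta>"
  unfolding birth_op_def using measurable_insert_L[OF assms(2)] assms b_measurable_L[OF assms(2)]
  by (simp add: mult.left_commute nn_integral_cmult)

lemma birth_op_suminf:
  assumes "\<And>i. f i \<in> borel_measurable C" "\<eta> \<in> conf_sets \<Lambda>"
  shows "birth_op (\<lambda>\<eta>. \<Sum>i. f i \<eta>) \<eta> = (\<Sum>i. birth_op (f i) \<eta>)"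
  unfolding birth_op_def using measurable_insert_L[OF assms(2)] assms b_measurable_L[OF assms(2)]
  by (simp add: nn_integral_suminf flip: ennreal_suminf_cmult)

lemma jump_op_add:
  assumes "f \<in> borel_measurable C" "g \<in> borel_measurable C" "\<eta> \<in> conf_sets \<Lambda>"
  shows "jump_op (\<lambda>\<eta>. f \<eta> + g \<eta>) \<eta> = jump_op f \<eta> + jump_op g \<eta>"
  unfolding jump_op_def using assms by (simp add: birth_op_add sum.distrib add_ac)

lemma jump_op_cmult:
  assumes "f \<in> borel_measurable C" "\<eta> \<in> conf_sets \<Lambda>"
  shows "jump_op (\<lambda>\<eta>. c * f \<eta>) \<eta> = c * jump_op f \<eta>"
  unfolding jump_op_def using assms by (simp add: birth_op_cmult sum_distrib_left distrib_left)

lemma jump_op_suminf: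
  assumes "\<And>i. f i \<in> borel_measurable C" "\<eta> \<in> conf_sets \<Lambda>"
  shows "jump_op (\<lambda>\<eta>. \<Sum>i. f i \<eta>) \<eta> = (\<Sum>i. jump_op (f i) \<eta>)"
  unfolding jump_op_def using assms by (simp add: birth_op_suminf suminf_sum[symmetric] suminf_add)

lemma first_jump_add:
  assumes "(\<lambda>p. f (fst p) (snd p)) \<in> borel_measurable (borel \<Otimes>\<^sub>M C)"
    "(\<lambda>p. g (fst p) (snd p)) \<in> borel_measurable (borel \<Otimes>\<^sub>M C)" "\<eta> \<in> conf_sets \<Lambda>"
  shows "first_jump (\<lambda>t \<eta>. f t \<eta> + g t \<eta>) t \<eta> = first_jump f t \<eta> + first_jump g t \<eta>"
proof -
  have [measurable]: "(\<lambda>s. jump_op (f (t - s)) \<eta>) \<in> borel_measurable lborel"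
    "(\<lambda>s. jump_op (g (t - s)) \<eta>) \<in> borel_measurable lborel"
    using assms by (auto intro!: jump_op_measurable_time)
  show ?thesis unfolding first_jump_def
    using assms by (simp add: jump_op_add measurable_section distrib_left distrib_right nn_integral_add)
qed

lemma first_jump_cmult:
  assumes "(\<lambda>p. f (fst p) (snd p)) \<in> borel_measurable (borel \<Otimes>\<^sub>M C)" "\<eta> \<in> conf_sets \<Lambda>"
  shows "first_jump (\<lambda>t \<eta>. c * f t \<eta>) t \<eta> = c * first_jump f t \<eta>"
proof -
  have [measurable]: "(\<lambda>s. jump_op (f (t - s)) \<eta>) \<in> borel_measurable lborel"
    using assms by (auto intro!: jump_op_measurable_time)
  show ?thesis unfolding first_jump_def
    using assms by (subst nn_integral_cmult[symmetric])
      (simp_all add: jump_op_cmult measurable_section mult_ac)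
qed

lemma first_jump_suminf:
  assumes "\<And>i. (\<lambda>p. f i (fst p) (snd p)) \<in> borel_measurable (borel \<Otimes>\<^sub>M C)" "\<eta> \<in> conf_sets \<Lambda>"
  shows "first_jump (\<lambda>t \<eta>. \<Sum>i. f i t \<eta>) t \<eta> = (\<Sum>i. first_jump (f i) t \<eta>)"
proof -
  have [measurable]: "(\<lambda>s. jump_op (f i (t - s)) \<eta>) \<in> borel_measurable lborel" for i
    using assms by (auto intro!: jump_op_measurable_time)
  show ?thesis unfolding first_jump_def
    using assms by (subst nn_integral_suminf[symmetric])
      (simp_all add: jump_op_suminf measurable_section)
qed

lemma jumps_suminf:
  assumes "\<And>i. f i \<in> borel_measurable C" "\<eta> \<in> conf_sets \<Lambda>"
  shows "jumps (\<lambda>\<eta>. \<Sum>i. f i \<eta>) n t \<eta> = (\<Sum>i. jumps (f i) n t \<eta>)"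
  using assms(2)
proof (induction n arbitrary: t \<eta>)
  case (Suc n)
  have "jumps (\<lambda>\<eta>. \<Sum>i. f i \<eta>) (Suc n) t \<eta> = first_jump (\<lambda>t \<eta>. \<Sum>i. jumps (f i) n t \<eta>) t \<eta>"
    unfolding jumps.simps using Suc by (intro first_jump_cong) auto
  then show ?case using assms(1) Suc.prems by (simp add: first_jump_suminf jumps_measurable)
qed simp

text \<open>For fixed t this is the semigroup P_t f, the expectation of f at time t as a function of
  the starting configuration.\<close>

definition law :: "('a set \<Rightarrow> ennreal) \<Rightarrow> real \<Rightarrow> 'a set \<Rightarrow> ennreal" where
  "law f t \<eta> = (\<Sum>n. jumps f n t \<eta>)"

lemma law_measurable [measurable]:
  assumes "f \<in> borel_measurable C"
  shows "(\<lambda>p. law f (fst p) (snd p)) \<in> borel_measurable (borel \<Otimes>\<^sub>M C)"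
  unfolding law_def using jumps_measurable[OF assms] by measurable

text \<open>The series becomes the value of \<open>measure_of\<close> only once it is known to be
  countably additive; otherwise \<open>measure_of\<close> would produce the zero measure.\<close>

lemma emeasure_glauber_law:
  assumes S: "S \<in> conf_sets \<Lambda>" and A: "A \<in> sets C"
  shows "emeasure (glauber_law \<Lambda> lam \<phi> S t) A = law (indicator A) t S"
proof -
  have 0: "jumps (\<lambda>_. 0) n t S = 0" for n t S
    by (induction n arbitrary: t S) (simp_all add: first_jump_def jump_op_def birth_op_def)
  show ?thesis unfolding glauber_law_def glauber_jumps_eq law_def
  proof (rule emeasure_measure_of_sigma)
    show "sigma_algebra (space C) (sets C)" by (rule sets.sigma_algebra_axioms)
    show "positive (sets C) (\<lambda>A. \<Sum>n. jumps (indicator A) n t S)"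
      using 0 by (simp add: positive_def indicator_def[abs_def])
    show "countably_additive (sets C) (\<lambda>A. \<Sum>n. jumps (indicator A) n t S)"
    proof (rule countably_additiveI)
      fix A :: "nat \<Rightarrow> 'a set set" assume A: "range A \<subseteq> sets C" "disjoint_family A"
      have "(\<Sum>i. \<Sum>n. jumps (indicator (A i)) n t S) = (\<Sum>n. jumps (\<lambda>\<eta>. \<Sum>i. indicator (A i) \<eta>) n t S)"
        using A S by (subst ennreal_suminf_swap) (auto simp: jumps_suminf)
      also have "(\<lambda>\<eta>. \<Sum>i. indicator (A i) \<eta> :: ennreal) = indicator (\<Union>i. A i)"
        using A by (simp add: fun_eq_iff suminf_indicator)
      finally show "(\<Sum>i. \<Sum>n. jumps (indicator (A i)) n t S) = (\<Sum>n. jumps (indicator (\<Union>i. A i)) n t S)" .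
    qed
  qed (rule A)
qed

text \<open>Supersolutions are found in differential form, V' \<ge> jump_op g - r V, while
  \<open>law\<close> obeys an integral equation; this is the passage between them at a fixed
  configuration. The sign condition on V' + r V keeps \<open>ennreal\<close> from truncating the
  integrand.\<close>

lemma first_jump_le_of_derivative:
  assumes \<eta>: "\<eta> \<in> conf_sets \<Lambda>" and t: "0 \<le> t"
    and m: "V \<in> borel_measurable borel" "V' \<in> borel_measurable borel"
    and V: "\<And>\<sigma>. (V has_real_derivative V' \<sigma>) (at \<sigma>)" "\<And>\<sigma>. 0 \<le> \<sigma> \<Longrightarrow> 0 \<le> V \<sigma>"
    and nn: "\<And>\<sigma>. 0 \<le> \<sigma> \<Longrightarrow> \<sigma> \<le> t \<Longrightarrow> 0 \<le> V' \<sigma> + r \<eta> * V \<sigma>"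
    and le: "\<And>\<sigma>. 0 \<le> \<sigma> \<Longrightarrow> \<sigma> \<le> t \<Longrightarrow> jump_op (g \<sigma>) \<eta> \<le> ennreal (V' \<sigma> + r \<eta> * V \<sigma>)"
  shows "ennreal (exp (- r \<eta> * t) * V 0) + first_jump g t \<eta> \<le> ennreal (V t)"
proof -
  have "first_jump g t \<eta> \<le>
      (\<integral>\<^sup>+s\<in>{0..t}. ennreal (exp (- r \<eta> * s) * (V' (t - s) + r \<eta> * V (t - s))) \<partial>lborel)"
    unfolding first_jump_def using le
    by (intro nn_integral_mono) (auto simp: indicator_def ennreal_mult nn intro!: mult_left_mono)
  then have "ennreal (exp (- r \<eta> * t) * V 0) + first_jump g t \<eta> \<le> ennreal (exp (- r \<eta> * t) * V 0) +
      (\<integral>\<^sup>+s\<in>{0..t}. ennreal (exp (- r \<eta> * s) * (V' (t - s) + r \<eta> * V (t - s))) \<partial>lborel)"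
    by (rule add_left_mono)
  also have "\<dots> = ennreal (V t)" by (rule nn_integral_exp_derivative[OF t m V nn])
  finally show ?thesis .
qed

section \<open>Counting jumps and non-explosion\<close>

lemma first_jump_1: 
  assumes "\<eta> \<in> conf_sets \<Lambda>" "0 \<le> t"
  shows "ennreal (exp (- r \<eta> * t)) + first_jump (\<lambda>_ _. 1) t \<eta> = 1"
proof -
  have "first_jump (\<lambda>_ _. 1) t \<eta> = (\<integral>\<^sup>+s\<in>{0..t}. ennreal (exp (- r \<eta> * s) * (0 + r \<eta> * 1)) \<partial>lborel)"
    unfolding first_jump_def using assms(1) by (simp add: r_eq[symmetric] ennreal_mult r_nonneg)
  then show ?thesis
    using nn_integral_exp_derivative[of t "\<lambda>_. 1" "\<lambda>_. 0" "r \<eta>"] assms r_nonneg by simp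
qed

text \<open>The probability of at least n jumps up to time t: after the n-th jump everything is
  allowed, whence the value 1 at n = 0.\<close>

primrec late :: "nat \<Rightarrow> real \<Rightarrow> 'a set \<Rightarrow> ennreal" where
  "late 0 = (\<lambda>t \<eta>. 1)"
| "late (Suc n) = first_jump (late n)"

lemma late_measurable: "(\<lambda>p. late n (fst p) (snd p)) \<in> borel_measurable (borel \<Otimes>\<^sub>M C)"
proof (induction n)
  case (Suc n)
  note [measurable] = Suc
  show ?case unfolding late.simps by measurable
qed simp

text \<open>Markov's inequality for the number of jumps. Every death removes either an initial point
  or one born earlier, so there are at most card \<eta> plus twice the number of births, and the
  mean number of births is at most lam vol t. The proof carries this bound through the first-jump
  recursion as a supersolution.\<close>

lemma late_le:
  assumes "\<eta> \<in> conf_sets \<Lambda>" "0 \<le> t"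
  shows "late n t \<eta> \<le> 1" "of_nat n * late n t \<eta> \<le> ennreal (real (card \<eta>) + 2 * lam * vol * t)"
proof -
  have late1: "late n t \<eta> \<le> 1" if "\<eta> \<in> conf_sets \<Lambda>" "0 \<le> t" for n t \<eta> using that
  proof (induction n arbitrary: t \<eta>)
    case (Suc n)
    have "first_jump (late n) t \<eta> \<le> first_jump (\<lambda>_ _. 1) t \<eta>"
      using Suc by (intro first_jump_mono) auto
    also have "\<dots> \<le> 1" using first_jump_1[OF Suc.prems] by (metis add.commute le_iff_add)
    finally show ?case by simp
  qed simp
  then show "late n t \<eta> \<le> 1" using assms by simp
  show "of_nat n * late n t \<eta> \<le> ennreal (real (card \<eta>) + 2 * lam * vol * t)"
    using assms
  proof (induction n arbitrary: t \<eta>)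
    case (Suc n)
    let ?V = "\<lambda>t \<eta>. real (card \<eta>) + 2 * lam * vol * t"
    note \<eta> = Suc.prems(1)
    have fin: "finite \<eta>" using conf_setsD[OF \<eta>] by simp
    \<comment> \<open>The factor n + 1 splits into n for the jumps after the first one and 1 for the
      first jump itself.\<close>
    have "of_nat (Suc n) * late (Suc n) t \<eta> =
        first_jump (\<lambda>t \<eta>. of_nat n * late n t \<eta> + late n t \<eta>) t \<eta>"
      using \<eta> late_measurable
      by (simp add: first_jump_add first_jump_cmult distrib_right add.commute)
    also have "\<dots> \<le> first_jump (\<lambda>t \<eta>. ennreal (?V t \<eta>) + 1) t \<eta>"
      using Suc late1 by (intro first_jump_mono add_mono) auto
    also have "\<dots> \<le> ennreal (exp (- r \<eta> * t) * ?V 0 \<eta>) + \<dots>" by (simp add: add_increasing)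
    also have "\<dots> \<le> ennreal (?V t \<eta>)"
    proof (rule first_jump_le_of_derivative[OF \<eta> Suc.prems(2)])
      show "((\<lambda>t. ?V t \<eta>) has_real_derivative 2 * lam * vol) (at \<sigma>)" for \<sigma>
        by (auto intro!: derivative_eq_intros)
      fix \<sigma> :: real assume \<sigma>: "0 \<le> \<sigma>" "\<sigma> \<le> t"
      then have c: "0 \<le> 2 * lam * vol * \<sigma>" using lam_nonneg by simp
      then show "0 \<le> 2 * lam * vol + r \<eta> * ?V \<sigma> \<eta>" using r_nonneg lam_nonneg by simp
      let ?B = "\<integral>x. b \<eta> x \<partial>L"
      have B: "0 \<le> ?B" "?B \<le> lam * vol"
        using birth_op_1_le[of \<eta>] birth_op_1[OF \<eta>] lam_nonneg
        by (auto simp: b_nonneg integral_nonneg_AE)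
      \<comment> \<open>A death costs one jump and lowers the number of points by one, so the two
        changes cancel.\<close>
      have "(\<Sum>x\<in>\<eta>. ennreal (?V \<sigma> (\<eta> - {x})) + 1)
          = (\<Sum>x\<in>\<eta>. ennreal (real (card \<eta>) + 2 * lam * vol * \<sigma>))"
      proof (rule sum.cong)
        fix x assume "x \<in> \<eta>"
        then have "real (card \<eta>) = real (card (\<eta> - {x})) + 1"
          using card.remove[OF fin \<open>x \<in> \<eta>\<close>] by linarith
        then show "ennreal (?V \<sigma> (\<eta> - {x})) + 1 = ennreal (?V \<sigma> \<eta>)"
          using c by (simp add: add_ac flip: ennreal_1 ennreal_plus)
      qed simp
      also have "\<dots> = ennreal (real (card \<eta>) * (real (card \<eta>) + 2 * lam * vol * \<sigma>))"
        using c by (simp add: ennreal_mult ennreal_of_nat_eq_real_of_nat)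
      finally have 1: "(\<Sum>x\<in>\<eta>. ennreal (?V \<sigma> (\<eta> - {x})) + 1) = \<dots>" .
      \<comment> \<open>A birth costs one jump and raises the number of points by one; the total of
        2 per birth is paid by the slope \<open>2 * lam * vol\<close>.\<close>
      have "birth_op (\<lambda>\<eta>. ennreal (?V \<sigma> \<eta>) + 1) \<eta> \<le> (\<integral>\<^sup>+x. ennreal (?V \<sigma> \<eta> + 2) * ennreal (b \<eta> x) \<partial>L)"
        unfolding birth_op_def
      proof (rule nn_integral_mono)
        fix x
        have "real (card (insert x \<eta>)) \<le> real (card \<eta>) + 1"
          using fin by (simp add: card_insert_if)
        then have "ennreal (?V \<sigma> (insert x \<eta>)) + 1 \<le> ennreal (?V \<sigma> \<eta> + 2)"
          using c by (auto simp flip: ennreal_1 ennreal_plus intro!: ennreal_leI)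
        then show "ennreal (b \<eta> x) * (ennreal (?V \<sigma> (insert x \<eta>)) + 1)
            \<le> ennreal (?V \<sigma> \<eta> + 2) * ennreal (b \<eta> x)"
          by (subst mult.commute) (rule mult_right_mono, auto)
      qed
      also have "\<dots> = ennreal ((?V \<sigma> \<eta> + 2) * ?B)"
        using b_measurable_L[OF \<eta>] birth_op_1[OF \<eta>] B(1) c
        by (simp add: nn_integral_cmult birth_op_def ennreal_mult)
      finally have 2: "birth_op (\<lambda>\<eta>. ennreal (?V \<sigma> \<eta>) + 1) \<eta> \<le> \<dots>" .
      have "jump_op (\<lambda>\<eta>. ennreal (?V \<sigma> \<eta>) + 1) \<eta> \<le>
          ennreal (real (card \<eta>) * (real (card \<eta>) + 2 * lam * vol * \<sigma>)) + ennreal ((?V \<sigma> \<eta> + 2) * ?B)"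
        unfolding jump_op_def 1 by (rule add_left_mono[OF 2])
      also have "\<dots> = ennreal (real (card \<eta>) * (real (card \<eta>) + 2 * lam * vol * \<sigma>) + (?V \<sigma> \<eta> + 2) * ?B)"
        using c B(1) by (subst ennreal_plus) auto
      also have "\<dots> \<le> ennreal (2 * lam * vol + r \<eta> * ?V \<sigma> \<eta>)"
        using B(2) by (intro ennreal_leI) (simp add: exit_rate_def algebra_simps)
      finally show "jump_op (\<lambda>\<eta>. ennreal (?V \<sigma> \<eta>) + 1) \<eta> \<le> ennreal (2 * lam * vol + r \<eta> * ?V \<sigma> \<eta>)" .
    qed (use lam_nonneg in auto)
    finally show ?case .
  qed simp
qed

text \<open>Non-explosion in usable form: \<open>late n\<close> is at most a constant over n, so an
  inequality that holds up to this error for every n holds exactly.\<close>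

lemma le_add_late_imp_le:
  assumes \<eta>: "\<eta> \<in> conf_sets \<Lambda>" and t: "0 \<le> t" and *: "\<And>n. x \<le> y + late n t \<eta>"
  shows "x \<le> y"
proof (rule ennreal_le_epsilon)
  fix e :: real assume e: "0 < e"
  let ?c = "real (card \<eta>) + 2 * lam * vol * t"
  have c: "0 \<le> ?c" using t lam_nonneg by simp
  obtain n where n: "?c / e < real n" using reals_Archimedean2 by blast
  then have n0: "0 < real n" using c e by (meson divide_nonneg_pos le_less_trans)
  obtain l where l: "late n t \<eta> = ennreal l" "0 \<le> l"
    using late_le(1)[OF \<eta> t, of n] by (cases "late n t \<eta>") (auto simp: top_unique)
  have "ennreal (real n * l) \<le> ennreal ?c"
    using late_le(2)[OF \<eta> t, of n] l by (simp add: ennreal_mult ennreal_of_nat_eq_real_of_nat)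
  then have "real n * l \<le> ?c" using c by (simp add: ennreal_le_iff)
  also have "\<dots> < real n * e" using n e by (simp add: field_simps)
  finally have "l \<le> e" using n0 by simp
  then have "late n t \<eta> \<le> ennreal e" using l by (simp add: ennreal_leI)
  then show "x \<le> y + ennreal e" using *[of n] by (meson add_left_mono order_trans)
qed

text \<open>The contribution of paths with fewer than n jumps. Its supremum over n is
  \<open>law f\<close>, and it supports induction on the number of jumps.\<close>

definition part :: "('a set \<Rightarrow> ennreal) \<Rightarrow> nat \<Rightarrow> real \<Rightarrow> 'a set \<Rightarrow> ennreal" where
  "part f n t \<eta> = (\<Sum>k<n. jumps f k t \<eta>)"

lemma part_measurable:
  "f \<in> borel_measurable C \<Longrightarrow> (\<lambda>p. part f n (fst p) (snd p)) \<in> borel_measurable (borel \<Otimes>\<^sub>M C)"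
  unfolding part_def using jumps_measurable by measurable

lemma part_0 [simp]: "part f 0 t \<eta> = 0"
  by (simp add: part_def)

lemma part_Suc:
  assumes "f \<in> borel_measurable C" "\<eta> \<in> conf_sets \<Lambda>"
  shows "part f (Suc n) t \<eta> = jumps f 0 t \<eta> + first_jump (part f n) t \<eta>"
proof (induction n)
  case 0
  have "part f 0 = (\<lambda>_ _. 0)" by (simp add: fun_eq_iff)
  then have "first_jump (part f 0) t \<eta> = 0"
    by (simp add: first_jump_def jump_op_def birth_op_def)
  moreover have "part f (Suc 0) t \<eta> = jumps f 0 t \<eta>" by (simp add: part_def)
  ultimately show ?case by (simp only: add_0_right)
next
  case (Suc n)
  have "part f (Suc n) = (\<lambda>t \<eta>. part f n t \<eta> + jumps f n t \<eta>)"
    by (simp add: part_def fun_eq_iff)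
  then have "first_jump (part f (Suc n)) t \<eta> = first_jump (\<lambda>t \<eta>. part f n t \<eta> + jumps f n t \<eta>) t \<eta>"
    by simp
  also have "\<dots> = first_jump (part f n) t \<eta> + jumps f (Suc n) t \<eta>"
    using assms by (simp add: first_jump_add part_measurable jumps_measurable)
  finally have fj: "first_jump (part f (Suc n)) t \<eta> = first_jump (part f n) t \<eta> + jumps f (Suc n) t \<eta>" .
  have "part f (Suc (Suc n)) t \<eta> = part f (Suc n) t \<eta> + jumps f (Suc n) t \<eta>"
    by (simp add: part_def)
  then show ?case by (simp only: Suc fj add.assoc)
qed

lemma part_le_law: "part f n t \<eta> \<le> law f t \<eta>"
  unfolding part_def law_def by (rule sum_le_suminf) auto

lemma law_leI: "(\<And>n. part f n t \<eta> \<le> c) \<Longrightarrow> law f t \<eta> \<le> c"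
  unfolding part_def law_def by (rule suminf_le_const) auto

section \<open>The backward equation, its supersolutions and the semigroup inequality\<close>

lemma law_eq:
  assumes "f \<in> borel_measurable C" "\<eta> \<in> conf_sets \<Lambda>"
  shows "law f t \<eta> = jumps f 0 t \<eta> + first_jump (law f) t \<eta>"
proof -
  have "law f t \<eta> = (\<Sum>n. jumps f (Suc n) t \<eta>) + jumps f 0 t \<eta>"
    unfolding law_def using suminf_offset[of "\<lambda>n. jumps f n t \<eta>" 1] by (simp add: add.commute)
  moreover have "first_jump (law f) t \<eta> = (\<Sum>n. first_jump (jumps f n) t \<eta>)"
    using first_jump_suminf[of "jumps f" \<eta> t] assms jumps_measurable by (simp add: law_def[abs_def])
  ultimately show ?thesis by (simp add: add.commute)
qed

text \<open>The truncations \<open>part f n\<close> are the Picard iterates started from 0, and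
  \<open>first_jump\<close> is monotone, so they never leave the region below V. In other words,
  \<open>law f\<close> is the minimal nonnegative solution.\<close>

lemma law_le_supersolution:
  assumes f: "f \<in> borel_measurable C"
    and V: "\<And>t \<eta>. 0 \<le> t \<Longrightarrow> \<eta> \<in> conf_sets \<Lambda> \<Longrightarrow> jumps f 0 t \<eta> + first_jump V t \<eta> \<le> V t \<eta>"
    and "0 \<le> t" "\<eta> \<in> conf_sets \<Lambda>"
  shows "law f t \<eta> \<le> V t \<eta>"
proof (rule law_leI)
  fix n show "part f n t \<eta> \<le> V t \<eta>" using assms(3,4)
  proof (induction n arbitrary: t \<eta>)
    case (Suc n)
    have "part f (Suc n) t \<eta> = jumps f 0 t \<eta> + first_jump (part f n) t \<eta>"
      using f Suc.prems by (simp add: part_Suc)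
    also have "\<dots> \<le> jumps f 0 t \<eta> + first_jump V t \<eta>"
      using Suc by (intro add_left_mono first_jump_mono) auto
    also have "\<dots> \<le> V t \<eta>" using V Suc.prems by blast
    finally show ?case .
  qed simp
qed

lemma law_le_1:
  assumes "f \<in> borel_measurable C" "\<And>\<eta>. \<eta> \<in> conf_sets \<Lambda> \<Longrightarrow> f \<eta> \<le> 1" "0 \<le> t" "\<eta> \<in> conf_sets \<Lambda>"
  shows "law f t \<eta> \<le> 1"
proof (rule law_le_supersolution[OF assms(1) _ assms(3,4)])
  fix t :: real and \<eta> assume *: "0 \<le> t" "\<eta> \<in> conf_sets \<Lambda>"
  have "jumps f 0 t \<eta> \<le> ennreal (exp (- r \<eta> * t)) * 1"
    unfolding jumps.simps using assms(2)[OF *(2)] by (intro mult_left_mono) auto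
  then show "jumps f 0 t \<eta> + first_jump (\<lambda>_ _. 1) t \<eta> \<le> 1"
    using first_jump_1[OF *(2,1)] by (metis add_right_mono mult.right_neutral)
qed

text \<open>Fewer than n jumps and at least n jumps are complementary events whose probabilities
  obey the same first-jump recursion.\<close>

lemma part_add_late:
  assumes "\<eta> \<in> conf_sets \<Lambda>" "0 \<le> t"
  shows "part (\<lambda>_. 1) n t \<eta> + late n t \<eta> = 1"
  using assms
proof (induction n arbitrary: t \<eta>)
  case (Suc n)
  have "part (\<lambda>_. 1) (Suc n) t \<eta> + late (Suc n) t \<eta> =
      jumps (\<lambda>_. 1) 0 t \<eta> + first_jump (\<lambda>t \<eta>. part (\<lambda>_. 1) n t \<eta> + late n t \<eta>) t \<eta>"
    using Suc.prems by (simp add: part_Suc first_jump_add part_measurable late_measurable add_ac)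
  also have "first_jump (\<lambda>t \<eta>. part (\<lambda>_. 1) n t \<eta> + late n t \<eta>) t \<eta> = first_jump (\<lambda>_ _. 1) t \<eta>"
    using Suc by (intro first_jump_cong) auto
  finally show ?case using first_jump_1[OF Suc.prems] by simp
qed simp

lemma law_1:
  assumes "\<eta> \<in> conf_sets \<Lambda>" "0 \<le> t" shows "law (\<lambda>_. 1) t \<eta> = 1"
proof (rule antisym)
  show "law (\<lambda>_. 1) t \<eta> \<le> 1" using assms by (intro law_le_1) auto
  show "1 \<le> law (\<lambda>_. 1) t \<eta>"
  proof (rule le_add_late_imp_le[OF assms])
    fix n
    have "part (\<lambda>_. 1) n t \<eta> + late n t \<eta> \<le> law (\<lambda>_. 1) t \<eta> + late n t \<eta>"
      by (intro add_right_mono part_le_law)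
    then show "1 \<le> law (\<lambda>_. 1) t \<eta> + late n t \<eta>" by (simp only: part_add_late[OF assms])
  qed
qed

text \<open>The first jump of a path of length t1 + t falls either into [0, t] or into the remaining
  t1 units of time; in the second case the exponential waiting time has no memory and contributes
  the factor exp (- r t).\<close>

lemma first_jump_shift:
  assumes g: "(\<lambda>p. g (fst p) (snd p)) \<in> borel_measurable (borel \<Otimes>\<^sub>M C)"
    and \<eta>: "\<eta> \<in> conf_sets \<Lambda>" and t: "0 \<le> t1" "0 \<le> t"
  shows "first_jump g (t1 + t) \<eta> =
    ennreal (exp (- r \<eta> * t)) * first_jump g t1 \<eta> + first_jump (\<lambda>t. g (t1 + t)) t \<eta>"
proof -
  let ?h = "\<lambda>s. ennreal (exp (- r \<eta> * s)) * jump_op (g (t1 + t - s)) \<eta>"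
  have [measurable]: "(\<lambda>s. jump_op (g (k s)) \<eta>) \<in> borel_measurable borel"
    if "k \<in> borel_measurable borel" for k
    using jump_op_measurable_time[OF g \<eta>, of k borel] that by simp
  have "first_jump g (t1 + t) \<eta> = (\<integral>\<^sup>+s. ?h s * indicator {0..t} s + ?h s * indicator {t<..t1 + t} s \<partial>lborel)"
    unfolding first_jump_def using t by (intro nn_integral_cong) (auto simp: indicator_def)
  also have "\<dots> = (\<integral>\<^sup>+s\<in>{0..t}. ?h s \<partial>lborel) + (\<integral>\<^sup>+s\<in>{t<..t1 + t}. ?h s \<partial>lborel)"
    by (intro nn_integral_add) measurable
  also have "(\<integral>\<^sup>+s\<in>{0..t}. ?h s \<partial>lborel) = first_jump (\<lambda>t. g (t1 + t)) t \<eta>"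
    unfolding first_jump_def by (simp add: algebra_simps)
  also have "(\<integral>\<^sup>+s\<in>{t<..t1 + t}. ?h s \<partial>lborel)
      = (\<integral>\<^sup>+s. ?h (t + 1 * s) * indicator {t<..t1 + t} (t + 1 * s) \<partial>lborel)"
    by (subst nn_integral_real_affine[where c = 1 and t = t]) auto
  also have "\<dots> = (\<integral>\<^sup>+s. ennreal (exp (- r \<eta> * t)) *
      (ennreal (exp (- r \<eta> * s)) * jump_op (g (t1 - s)) \<eta> * indicator {0..t1} s) \<partial>lborel)"
  proof (rule nn_integral_cong_AE)
    \<comment> \<open>After the translation the two intervals differ only at the point s =
      0.\<close>
    show "AE s in lborel. ?h (t + 1 * s) * indicator {t<..t1 + t} (t + 1 * s) =
        ennreal (exp (- r \<eta> * t)) *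
        (ennreal (exp (- r \<eta> * s)) * jump_op (g (t1 - s)) \<eta> * indicator {0..t1} s)"
      using AE_lborel_singleton[of 0]
    proof eventually_elim
      case (elim s)
      have "ennreal (exp (- r \<eta> * (t + s))) = ennreal (exp (- r \<eta> * t)) * ennreal (exp (- r \<eta> * s))"
        by (simp add: algebra_simps flip: ennreal_mult' exp_add)
      then show ?case using elim by (auto simp: indicator_def mult.assoc)
    qed
  qed
  also have "\<dots> = ennreal (exp (- r \<eta> * t)) * first_jump g t1 \<eta>"
    unfolding first_jump_def by (subst nn_integral_cmult) auto
  finally show ?thesis by (simp add: add.commute)
qed

text \<open>The direction of the Chapman-Kolmogorov equation that an upper bound on P_{t1 + t} f
  needs. The induction is on the number n of jumps made during the first t units of time; paths with
  more jumps are charged to \<open>late n\<close>, which is legitimate since \<open>law f\<close> is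
  at most 1, and this charge vanishes as n grows.\<close>

lemma law_semigroup_le:
  assumes f: "f \<in> borel_measurable C" "\<And>\<eta>. \<eta> \<in> conf_sets \<Lambda> \<Longrightarrow> f \<eta> \<le> 1"
    and t: "0 \<le> t1" "0 \<le> t" and \<eta>: "\<eta> \<in> conf_sets \<Lambda>"
  shows "law f (t1 + t) \<eta> \<le> law (law f t1) t \<eta>"
proof -
  have lm: "law f t1 \<in> borel_measurable C" by (rule measurable_section[OF law_measurable[OF f(1)]])
  have "law f (t1 + t) \<eta> \<le> part (law f t1) n t \<eta> + late n t \<eta>" for n using \<eta> t(2)
  proof (induction n arbitrary: t \<eta>)
    case 0
    then show ?case using law_le_1[OF f, of "t1 + t" \<eta>] t(1) by simp
  next
    case (Suc n)
    have e: "ennreal (exp (- r \<eta> * (t1 + t))) = ennreal (exp (- r \<eta> * t)) * ennreal (exp (- r \<eta> * t1))"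
      by (simp add: algebra_simps flip: ennreal_mult' exp_add)
    \<comment> \<open>Without a jump before t the state is still \<eta>; the remaining time t1 then
      contributes a complete \<open>law f t1\<close>, reassembled from its own backward
      equation.\<close>
    have "law f (t1 + t) \<eta> = jumps (law f t1) 0 t \<eta> + first_jump (\<lambda>t. law f (t1 + t)) t \<eta>"
      using Suc.prems t(1) f(1) e
      by (simp add: law_eq[of f] first_jump_shift law_measurable distrib_left add_ac mult_ac)
    also have "\<dots> \<le> jumps (law f t1) 0 t \<eta> +
        first_jump (\<lambda>t \<eta>. part (law f t1) n t \<eta> + late n t \<eta>) t \<eta>"
      using Suc by (intro add_left_mono first_jump_mono) auto
    also have "\<dots> = part (law f t1) (Suc n) t \<eta> + late (Suc n) t \<eta>"
      using Suc.prems lm by (simp add: part_Suc first_jump_add part_measurable late_measurable add_ac)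
    finally show ?case .
  qed
  from order_trans[OF this add_right_mono[OF part_le_law]] show ?thesis
    by (rule le_add_late_imp_le[OF \<eta> t(2)])
qed

end

section \<open>A supersolution dominating the dynamics\<close>

text \<open>The expectation of g over an independent thinning of \<zeta> in which every point is
  kept with probability \<theta>.\<close>

definition thin :: "real \<Rightarrow> ('b set \<Rightarrow> real) \<Rightarrow> 'b set \<Rightarrow> real" where
  "thin \<theta> g \<zeta> = (\<Sum>R\<in>Pow \<zeta>. \<theta> ^ card R * (1 - \<theta>) ^ card (\<zeta> - R) * g R)"

lemma thin_empty [simp]: "thin \<theta> g {} = g {}"
  by (simp add: thin_def)

text \<open>Conditioning on whether x is kept.\<close>

lemma thin_insert:
  assumes "finite \<zeta>" "x \<notin> \<zeta>"
  shows "thin \<theta> g (insert x \<zeta>) = \<theta> * thin \<theta> (\<lambda>R. g (insert x R)) \<zeta> + (1 - \<theta>) * thin \<theta> g \<zeta>"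
proof -
  let ?w = "\<lambda>R. \<theta> ^ card R * (1 - \<theta>) ^ card (insert x \<zeta> - R) * g R"
  have "thin \<theta> g (insert x \<zeta>) = sum ?w (Pow \<zeta>) + sum ?w (insert x ` Pow \<zeta>)"
    unfolding thin_def Pow_insert using assms by (intro sum.union_disjoint) auto
  also have "sum ?w (insert x ` Pow \<zeta>) = (\<Sum>R\<in>Pow \<zeta>. ?w (insert x R))"
    using assms by (intro sum.reindex_cong[of "insert x"]) (auto simp: inj_on_def)
  also have "\<dots> = \<theta> * thin \<theta> (\<lambda>R. g (insert x R)) \<zeta>"
    unfolding thin_def sum_distrib_left
  proof (rule sum.cong)
    fix R assume "R \<in> Pow \<zeta>"
    then have "finite R" "x \<notin> R" "insert x \<zeta> - insert x R = \<zeta> - R"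
      using assms finite_subset by auto
    then show "?w (insert x R) = \<theta> * (\<theta> ^ card R * (1 - \<theta>) ^ card (\<zeta> - R) * g (insert x R))" by simp
  qed simp
  also have "sum ?w (Pow \<zeta>) = (1 - \<theta>) * thin \<theta> g \<zeta>"
    unfolding thin_def sum_distrib_left
  proof (rule sum.cong)
    fix R assume "R \<in> Pow \<zeta>"
    then have "insert x \<zeta> - R = insert x (\<zeta> - R)" using assms by auto
    then show "?w R = (1 - \<theta>) * (\<theta> ^ card R * (1 - \<theta>) ^ card (\<zeta> - R) * g R)" using assms by simp
  qed simp
  finally show ?thesis by simp
qed

lemma thin_nonneg:
  assumes "0 \<le> \<theta>" "\<theta> \<le> 1" "\<And>R. R \<subseteq> \<zeta> \<Longrightarrow> 0 \<le> g R" shows "0 \<le> thin \<theta> g \<zeta>"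
  unfolding thin_def using assms by (intro sum_nonneg mult_nonneg_nonneg) auto

lemma thin_1: "finite \<zeta> \<Longrightarrow> thin 1 g \<zeta> = g \<zeta>"
  by (induction \<zeta> arbitrary: g rule: finite_induct) (simp_all add: thin_insert)

text \<open>With \<theta> = exp (- t), thinning is the semigroup of the pure death process at rate
  1, so its derivative is the sum over y of T (\<zeta> - {y}) - T \<zeta>, plus the explicit time
  dependence of G. Induction on \<zeta> conditions on the fate of one point.\<close>

lemma thin_has_derivative:
  assumes "finite \<zeta>" "\<And>R. R \<subseteq> \<zeta> \<Longrightarrow> ((\<lambda>t. G t R) has_real_derivative G' R) (at t)"
  shows "((\<lambda>t. thin (exp (- t)) (G t) \<zeta>) has_real_derivative
    (\<Sum>y\<in>\<zeta>. thin (exp (- t)) (G t) (\<zeta> - {y})) - real (card \<zeta>) * thin (exp (- t)) (G t) \<zeta>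
      + thin (exp (- t)) G' \<zeta>) (at t)"
  using assms
proof (induction \<zeta> arbitrary: G G' rule: finite_induct)
  case empty
  then show ?case by simp
next
  case (insert x \<zeta>)
  let ?T = "thin (exp (- t))"
  define A where "A \<zeta> = ?T (\<lambda>R. G t (insert x R)) \<zeta>" for \<zeta>
  define B where "B \<zeta> = ?T (G t) \<zeta>" for \<zeta>
  have dA: "((\<lambda>t. thin (exp (- t)) (\<lambda>R. G t (insert x R)) \<zeta>) has_real_derivative
      (\<Sum>y\<in>\<zeta>. A (\<zeta> - {y})) - real (card \<zeta>) * A \<zeta> + ?T (\<lambda>R. G' (insert x R)) \<zeta>) (at t)"
    unfolding A_def by (rule insert.IH, rule insert.prems) blast
  have dB: "((\<lambda>t. thin (exp (- t)) (G t) \<zeta>) has_real_derivative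
      (\<Sum>y\<in>\<zeta>. B (\<zeta> - {y})) - real (card \<zeta>) * B \<zeta> + ?T G' \<zeta>) (at t)"
    unfolding B_def by (rule insert.IH, rule insert.prems) blast
  have "(\<Sum>y\<in>\<zeta>. ?T (G t) (insert x \<zeta> - {y})) =
      exp (- t) * (\<Sum>y\<in>\<zeta>. A (\<zeta> - {y})) + (1 - exp (- t)) * (\<Sum>y\<in>\<zeta>. B (\<zeta> - {y}))"
    unfolding sum_distrib_left sum.distrib[symmetric]
  proof (rule sum.cong)
    fix y assume "y \<in> \<zeta>"
    then have "insert x \<zeta> - {y} = insert x (\<zeta> - {y})" using insert.hyps by auto
    then show "?T (G t) (insert x \<zeta> - {y}) = exp (- t) * A (\<zeta> - {y}) + (1 - exp (- t)) * B (\<zeta> - {y})"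
      using insert.hyps by (simp add: thin_insert A_def B_def)
  qed simp
  \<comment> \<open>The term y = x minus the full value equals exp (- t) (B \<zeta> - A \<zeta>),
    which is the derivative of the mixing weight in \<open>thin_insert\<close>.\<close>
  moreover have "?T (G t) (insert x \<zeta> - {x}) = B \<zeta>" using insert.hyps by (simp add: B_def)
  moreover have "?T (G t) (insert x \<zeta>) = exp (- t) * A \<zeta> + (1 - exp (- t)) * B \<zeta>"
    using insert.hyps by (simp add: thin_insert A_def B_def)
  ultimately show ?case
    using insert.hyps unfolding thin_insert[OF insert.hyps]
    by (auto intro!: derivative_eq_intros dA dB simp: A_def[symmetric] B_def[symmetric] algebra_simps)
qed

context glauber begin

section \<open>The exponential of the birth operator\<close>

lemma birth_iterate_measurable:
  assumes "g \<in> borel_measurable C" shows "(birth_op ^^ n) g \<in> borel_measurable C"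
proof (induction n)
  case (Suc n)
  have "(\<lambda>p. (birth_op ^^ n) g (snd p)) \<in> borel_measurable (C \<Otimes>\<^sub>M C)" using Suc by measurable
  then show ?case using birth_op_measurable[of "\<lambda>_. (birth_op ^^ n) g" C "\<lambda>\<eta>. \<eta>"] by simp
qed (simp add: assms)

lemma birth_op_measurable_C: "g \<in> borel_measurable C \<Longrightarrow> birth_op g \<in> borel_measurable C"
  using birth_iterate_measurable[of g 1] by simp

lemma birth_op_le:
  assumes g: "\<And>\<eta>. \<eta> \<in> conf_sets \<Lambda> \<Longrightarrow> g \<eta> \<le> ennreal c" and "0 \<le> c" "\<eta> \<in> conf_sets \<Lambda>"
  shows "birth_op g \<eta> \<le> ennreal (c * (lam * vol))"
proof -
  have "birth_op g \<eta> \<le> birth_op (\<lambda>\<eta>. ennreal c * 1) \<eta>"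
    using assms by (intro birth_op_mono) auto
  also have "\<dots> = ennreal c * birth_op (\<lambda>_. 1) \<eta>" using assms by (subst birth_op_cmult) auto
  also have "\<dots> \<le> ennreal c * ennreal (lam * vol)" by (intro mult_left_mono birth_op_1_le) auto
  finally show ?thesis using assms lam_nonneg by (simp add: ennreal_mult)
qed

lemma birth_iterate_le:
  assumes g: "\<And>\<eta>. \<eta> \<in> conf_sets \<Lambda> \<Longrightarrow> g \<eta> \<le> ennreal c" and "0 \<le> c" "\<eta> \<in> conf_sets \<Lambda>"
  shows "(birth_op ^^ n) g \<eta> \<le> ennreal (c * (lam * vol) ^ n)"
  using assms(3)
proof (induction n arbitrary: \<eta>)
  case (Suc n)
  then show ?case
    using birth_op_le[OF Suc.IH, where \<eta> = \<eta>] assms(2) lam_nonneg by (simp add: mult_ac)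
qed (simp add: g)

text \<open>The power series exp (a birth_op) g at \<eta>, real-valued so that it can be
  differentiated in a. At a = 1 and \<eta> = {} it becomes the unnormalised Gibbs sum of g.\<close>

definition birth_exp :: "('a set \<Rightarrow> ennreal) \<Rightarrow> real \<Rightarrow> 'a set \<Rightarrow> real" where
  "birth_exp g a \<eta> = (\<Sum>n. enn2real ((birth_op ^^ n) g \<eta>) / fact n * a ^ n)"

lemma birth_exp_summable:
  assumes g: "\<And>\<eta>. \<eta> \<in> conf_sets \<Lambda> \<Longrightarrow> g \<eta> \<le> ennreal c" and c: "0 \<le> c" and \<eta>: "\<eta> \<in> conf_sets \<Lambda>"
  shows "summable (\<lambda>n. enn2real ((birth_op ^^ n) g \<eta>) / fact n * a ^ n)"
proof (rule summable_comparison_test')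
  show "summable (\<lambda>n. c * ((lam * vol * \<bar>a\<bar>) ^ n / fact n))"
    using summable_exp[of "lam * vol * \<bar>a\<bar>"] by (intro summable_mult) (simp add: field_simps)
  fix n :: nat
  have "enn2real ((birth_op ^^ n) g \<eta>) \<le> c * (lam * vol) ^ n"
    using birth_iterate_le[OF assms, where n = n] c lam_nonneg by (intro enn2real_leI) auto
  then have "enn2real ((birth_op ^^ n) g \<eta>) / fact n * \<bar>a\<bar> ^ n \<le> c * (lam * vol) ^ n / fact n * \<bar>a\<bar> ^ n"
    by (intro mult_right_mono divide_right_mono) auto
  then show "norm (enn2real ((birth_op ^^ n) g \<eta>) / fact n * a ^ n) \<le> c * ((lam * vol * \<bar>a\<bar>) ^ n / fact n)"
    by (simp add: abs_mult power_abs power_mult_distrib mult_ac)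
qed

text \<open>Termwise differentiation: n / fact n turns into 1 / fact (n - 1), and the surplus
  application of \<open>birth_op\<close> is moved next to g.\<close>

lemma birth_exp_has_derivative:
  assumes g: "\<And>\<eta>. \<eta> \<in> conf_sets \<Lambda> \<Longrightarrow> g \<eta> \<le> ennreal c" and c: "0 \<le> c" and \<eta>: "\<eta> \<in> conf_sets \<Lambda>"
  shows "((\<lambda>a. birth_exp g a \<eta>) has_real_derivative birth_exp (birth_op g) a \<eta>) (at a)"
proof -
  let ?c = "\<lambda>n. enn2real ((birth_op ^^ n) g \<eta>) / fact n"
  have "((\<lambda>a. \<Sum>n. ?c n * a ^ n) has_real_derivative (\<Sum>n. diffs ?c n * a ^ n)) (at a)"
    using birth_exp_summable[OF assms, where a = "1 + \<bar>a\<bar>"]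
    by (rule termdiffs_strong) (auto simp: abs_if)
  moreover have "diffs ?c = (\<lambda>n. enn2real ((birth_op ^^ n) (birth_op g) \<eta>) / fact n)"
    by (simp add: diffs_def fun_eq_iff funpow_swap1)
  ultimately show ?thesis by (simp add: birth_exp_def[abs_def])
qed

lemma birth_exp_nonneg:
  assumes g: "\<And>\<eta>. \<eta> \<in> conf_sets \<Lambda> \<Longrightarrow> g \<eta> \<le> ennreal c" and c: "0 \<le> c" and \<eta>: "\<eta> \<in> conf_sets \<Lambda>"
    and a: "0 \<le> a"
  shows "0 \<le> birth_exp g a \<eta>"
  unfolding birth_exp_def using birth_exp_summable[OF g c \<eta>] a by (intro suminf_nonneg) auto

lemma ennreal_birth_exp:
  assumes g: "\<And>\<eta>. \<eta> \<in> conf_sets \<Lambda> \<Longrightarrow> g \<eta> \<le> ennreal c" and c: "0 \<le> c" and \<eta>: "\<eta> \<in> conf_sets \<Lambda>"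
    and a: "0 \<le> a"
  shows "ennreal (birth_exp g a \<eta>) = (\<Sum>n. ennreal (a ^ n / fact n) * (birth_op ^^ n) g \<eta>)"
proof -
  have "ennreal (birth_exp g a \<eta>) = (\<Sum>n. ennreal (enn2real ((birth_op ^^ n) g \<eta>) / fact n * a ^ n))"
    unfolding birth_exp_def using a by (intro suminf_ennreal2[symmetric] birth_exp_summable[OF g c \<eta>]) auto
  also have "\<dots> = (\<Sum>n. ennreal (a ^ n / fact n) * (birth_op ^^ n) g \<eta>)"
  proof (rule suminf_cong)
    fix n
    have "(birth_op ^^ n) g \<eta> < top"
      using birth_iterate_le[OF g c \<eta>, where n = n] by (meson ennreal_less_top le_less_trans)
    then have "ennreal (enn2real ((birth_op ^^ n) g \<eta>)) = (birth_op ^^ n) g \<eta>" by simp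
    moreover have "ennreal (enn2real ((birth_op ^^ n) g \<eta>) / fact n * a ^ n) =
        ennreal (a ^ n / fact n) * ennreal (enn2real ((birth_op ^^ n) g \<eta>))"
      using a by (simp add: mult.commute flip: ennreal_mult)
    ultimately show "ennreal (enn2real ((birth_op ^^ n) g \<eta>) / fact n * a ^ n) =
        ennreal (a ^ n / fact n) * (birth_op ^^ n) g \<eta>" by simp
  qed
  finally show ?thesis .
qed

text \<open>Monotone convergence lets \<open>birth_op\<close> act on every term of the nonnegative
  series, and it commutes with its own iterates.\<close>

lemma birth_op_birth_exp:
  assumes m: "g \<in> borel_measurable C"
    and g: "\<And>\<eta>. \<eta> \<in> conf_sets \<Lambda> \<Longrightarrow> g \<eta> \<le> ennreal c" and c: "0 \<le> c" and \<eta>: "\<eta> \<in> conf_sets \<Lambda>"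
    and a: "0 \<le> a"
  shows "birth_op (\<lambda>\<eta>. ennreal (birth_exp g a \<eta>)) \<eta> = ennreal (birth_exp (birth_op g) a \<eta>)"
proof -
  have "birth_op (\<lambda>\<eta>. ennreal (birth_exp g a \<eta>)) \<eta> =
      birth_op (\<lambda>\<eta>. \<Sum>n. ennreal (a ^ n / fact n) * (birth_op ^^ n) g \<eta>) \<eta>"
    using ennreal_birth_exp[OF g c _ a] \<eta> by (intro antisym birth_op_mono) auto
  also have "\<dots> = (\<Sum>n. ennreal (a ^ n / fact n) * birth_op ((birth_op ^^ n) g) \<eta>)"
    using \<eta> birth_iterate_measurable[OF m] by (simp add: birth_op_suminf birth_op_cmult)
  also have "\<dots> = ennreal (birth_exp (birth_op g) a \<eta>)"
    using birth_op_le[OF g c] c lam_nonneg \<eta> a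
    by (subst ennreal_birth_exp[where c = "c * (lam * vol)"]) (auto simp: funpow_swap1)
  finally show ?thesis .
qed

lemma birth_exp_measurable:
  assumes m: "g \<in> borel_measurable C"
  shows "birth_exp g a \<in> borel_measurable C"
  unfolding birth_exp_def[abs_def] using birth_iterate_measurable[OF m] by measurable

lemma birth_exp_borel:
  assumes g: "\<And>\<eta>. \<eta> \<in> conf_sets \<Lambda> \<Longrightarrow> g \<eta> \<le> ennreal c" and c: "0 \<le> c" and \<eta>: "\<eta> \<in> conf_sets \<Lambda>"
    and [measurable]: "k \<in> borel_measurable borel"
  shows "(\<lambda>t. birth_exp g (k t) \<eta>) \<in> borel_measurable borel"
proof -
  have "continuous_on UNIV (\<lambda>a. birth_exp g a \<eta>)"
    using DERIV_isCont[OF birth_exp_has_derivative[OF g c \<eta>]] by (simp add: continuous_at_imp_continuous_on)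
  then have "(\<lambda>a. birth_exp g a \<eta>) \<in> borel_measurable borel" by (rule borel_measurable_continuous_onI)
  from measurable_compose[OF assms(4) this] show ?thesis .
qed

text \<open>Survival of the points of \<open>S\<close> is charged by the first summand. In the last summand every other
  point of \<open>\<eta>\<close> survives with probability \<open>exp (- t)\<close>, independently, and the points \<open>y\<close> that are born
  and still alive at time \<open>t\<close> carry only their interaction with each other and with the survivors;
  ignoring the repulsion by the points that have died gives an upper bound.\<close>
definition dominating :: "('a set \<Rightarrow> ennreal) \<Rightarrow> 'a set \<Rightarrow> real \<Rightarrow> real \<Rightarrow> 'a set \<Rightarrow> real" where
  "dominating g S c t \<eta> = real (card (\<eta> \<inter> S)) * exp (- t) + c
     + thin (exp (- t)) (birth_exp g (1 - exp (- t))) (\<eta> - S)"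

text \<open>The right side is the time derivative of \<open>dominating\<close> plus r times
  \<open>dominating\<close>, so this is its backward differential inequality. Deaths in S give the
  derivative of the union bound, and the other deaths give the derivative of the thinning. A newborn
  point that dies before t leaves T unchanged; one that survives is charged at the rate it would
  have in the presence of the surviving set R alone, which reproduces \<open>birth_op\<close> inside
  the thinning.\<close>

lemma jump_op_dominating_le:
  assumes m: "g \<in> borel_measurable C"
    and g: "\<And>\<eta>. \<eta> \<in> conf_sets \<Lambda> \<Longrightarrow> g \<eta> \<le> ennreal K" and K: "0 \<le> K" and c: "0 \<le> c"
    and S: "finite S" and \<eta>: "\<eta> \<in> conf_sets \<Lambda>" and t: "0 \<le> t"
  defines "\<theta> \<equiv> exp (- t)"
  defines "T \<equiv> thin \<theta> (birth_exp g (1 - \<theta>))"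
  shows "jump_op (\<lambda>\<eta>. ennreal (dominating g S c t \<eta>)) \<eta> \<le>
    ennreal (- real (card (\<eta> \<inter> S)) * \<theta> + ((\<Sum>y\<in>\<eta> - S. T (\<eta> - S - {y})) - real (card (\<eta> - S)) * T (\<eta> - S)
       + thin \<theta> (\<lambda>R. \<theta> * birth_exp (birth_op g) (1 - \<theta>) R) (\<eta> - S)) + r \<eta> * dominating g S c t \<eta>)"
proof -
  have fin: "finite \<eta>" using conf_setsD[OF \<eta>] by simp
  have \<theta>: "0 \<le> \<theta>" "\<theta> \<le> 1" "0 \<le> 1 - \<theta>" using t by (auto simp: \<theta>_def)
  define \<zeta> where "\<zeta> = \<eta> - S"
  define k where "k = card (\<eta> \<inter> S)"
  define B where "B = (\<integral>x. b \<eta> x \<partial>L)"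
  define E where "E = birth_exp g (1 - \<theta>)"
  define E' where "E' = birth_exp (birth_op g) (1 - \<theta>)"
  have sub: "R \<in> conf_sets \<Lambda>" if "R \<subseteq> \<eta>" for R
    using \<eta> that finite_subset by (auto simp: conf_sets_def)
  have E: "0 \<le> E \<zeta>" if "\<zeta> \<in> conf_sets \<Lambda>" for \<zeta>
    unfolding E_def using that \<theta> by (intro birth_exp_nonneg[OF g K]) auto
  have E': "0 \<le> E' \<zeta>" if "\<zeta> \<in> conf_sets \<Lambda>" for \<zeta>
    unfolding E'_def using that \<theta> K lam_nonneg
    by (intro birth_exp_nonneg[where c = "K * (lam * vol)"] birth_op_le[OF g]) auto
  have T: "0 \<le> T \<zeta>" if "\<zeta> \<subseteq> \<eta>" for \<zeta>
    unfolding T_def using that E \<theta> sub by (intro thin_nonneg) (auto simp: E_def)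
  have B: "0 \<le> B" "birth_op (\<lambda>_. 1) \<eta> = ennreal B"
    using birth_op_1[OF \<eta>] by (auto simp: B_def b_nonneg integral_nonneg_AE)
  have V: "dominating g S c t \<xi> = real (card (\<xi> \<inter> S)) * \<theta> + c + T (\<xi> - S)" for \<xi>
    by (simp add: dominating_def \<theta>_def T_def)
  have card: "card \<eta> = k + card \<zeta>"
    unfolding k_def \<zeta>_def using card_Int_Diff[OF fin] by simp
  have "(\<Sum>x\<in>\<eta>. ennreal (dominating g S c t (\<eta> - {x}))) = ennreal (\<Sum>x\<in>\<eta>. dominating g S c t (\<eta> - {x}))"
    using c \<theta> by (intro sum_ennreal) (auto simp: V intro!: add_nonneg_nonneg T)
  also have "(\<Sum>x\<in>\<eta>. dominating g S c t (\<eta> - {x})) =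
      (\<Sum>x\<in>\<eta> \<inter> S. dominating g S c t (\<eta> - {x})) + (\<Sum>x\<in>\<zeta>. dominating g S c t (\<eta> - {x}))"
    unfolding \<zeta>_def using fin by (subst sum.union_disjoint[symmetric]) (auto intro!: sum.cong)
  also have "(\<Sum>x\<in>\<eta> \<inter> S. dominating g S c t (\<eta> - {x})) = (\<Sum>x\<in>\<eta> \<inter> S. (real k - 1) * \<theta> + c + T \<zeta>)"
  proof (rule sum.cong)
    fix x assume x: "x \<in> \<eta> \<inter> S"
    have "(\<eta> - {x}) \<inter> S = \<eta> \<inter> S - {x}" "\<eta> - {x} - S = \<zeta>" using x by (auto simp: \<zeta>_def)
    moreover have "real k = real (card (\<eta> \<inter> S - {x})) + 1"
      using card.remove[OF _ x] fin unfolding k_def by simp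
    ultimately show "dominating g S c t (\<eta> - {x}) = (real k - 1) * \<theta> + c + T \<zeta>" by (simp add: V)
  qed simp
  also have "\<dots> = real k * ((real k - 1) * \<theta> + c + T \<zeta>)" by (simp add: k_def)
  also have "(\<Sum>x\<in>\<zeta>. dominating g S c t (\<eta> - {x})) = (\<Sum>x\<in>\<zeta>. real k * \<theta> + c + T (\<zeta> - {x}))"
  proof (rule sum.cong)
    fix x assume x: "x \<in> \<zeta>"
    then have "(\<eta> - {x}) \<inter> S = \<eta> \<inter> S" "\<eta> - {x} - S = \<zeta> - {x}" by (auto simp: \<zeta>_def)
    then show "dominating g S c t (\<eta> - {x}) = real k * \<theta> + c + T (\<zeta> - {x})" by (simp add: V k_def)
  qed simp
  also have "\<dots> = real (card \<zeta>) * (real k * \<theta> + c) + (\<Sum>x\<in>\<zeta>. T (\<zeta> - {x}))"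
    by (simp add: sum.distrib)
  finally have deaths: "(\<Sum>x\<in>\<eta>. ennreal (dominating g S c t (\<eta> - {x}))) =
      ennreal (real k * ((real k - 1) * \<theta> + c + T \<zeta>)
        + (real (card \<zeta>) * (real k * \<theta> + c) + (\<Sum>x\<in>\<zeta>. T (\<zeta> - {x}))))" .
  define D where "D = real k * \<theta> + c + (1 - \<theta>) * T \<zeta>"
  have \<zeta>: "\<zeta> \<subseteq> \<eta>" by (auto simp: \<zeta>_def)
  have D: "0 \<le> D" using \<theta> c T[OF \<zeta>] by (simp add: D_def)
  \<comment> \<open>The probability that R is what survives of \<zeta>, times the probability
    \<theta> that the newborn point survives; \<open>D\<close> above gathers the part of the value
    after a birth that does not see the newborn point.\<close>
  define w where "w R = \<theta> * (\<theta> ^ card R * (1 - \<theta>) ^ card (\<zeta> - R))" for R :: "'a set"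
  have w: "0 \<le> w R" for R using \<theta> by (simp add: w_def)
  have "birth_op (\<lambda>\<eta>. ennreal (dominating g S c t \<eta>)) \<eta> \<le>
      (\<integral>\<^sup>+x. ennreal D * ennreal (b \<eta> x) + (\<Sum>R\<in>Pow \<zeta>. ennreal (w R) * (ennreal (b R x) * ennreal (E (insert x R)))) \<partial>L)"
    unfolding birth_op_def
  proof (rule nn_integral_mono_AE)
    \<comment> \<open>Avoiding S ensures that a newborn point is counted in \<eta> - S and is never
      mistaken for a survivor of S.\<close>
    have "AE x in L. x \<notin> \<eta> \<union> S" using fin S by (intro AE_not_in_finite) auto
    moreover have "AE x in L. x \<in> \<Lambda>" using AE_space[of L] by simp
    ultimately show "AE x in L. ennreal (b \<eta> x) * ennreal (dominating g S c t (insert x \<eta>)) \<le>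
       ennreal D * ennreal (b \<eta> x) + (\<Sum>R\<in>Pow \<zeta>. ennreal (w R) * (ennreal (b R x) * ennreal (E (insert x R))))"
    proof eventually_elim
      case (elim x)
      then have x: "x \<notin> \<eta>" "x \<notin> \<zeta>" "insert x \<eta> - S = insert x \<zeta>" "insert x \<eta> \<inter> S = \<eta> \<inter> S"
        by (auto simp: \<zeta>_def)
      have fz: "finite \<zeta>" using fin by (simp add: \<zeta>_def)
      have ER: "0 \<le> E (insert x R)" if "R \<subseteq> \<zeta>" for R
        using that \<zeta> elim by (intro E conf_sets_insert sub) auto
      have "dominating g S c t (insert x \<eta>) = D + \<theta> * thin \<theta> (\<lambda>R. E (insert x R)) \<zeta>"
        using x fz by (simp add: V T_def thin_insert D_def k_def E_def)
      then have "b \<eta> x * dominating g S c t (insert x \<eta>) = D * b \<eta> x + (\<Sum>R\<in>Pow \<zeta>. w R * (b \<eta> x * E (insert x R)))"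
        by (simp add: thin_def w_def sum_distrib_left algebra_simps)
      \<comment> \<open>The repulsion from \<eta> - R is dropped: these are points of S and points
        that the thinning removes.\<close>
      also have "\<dots> \<le> D * b \<eta> x + (\<Sum>R\<in>Pow \<zeta>. w R * (b R x * E (insert x R)))"
        using w ER x fin \<zeta> by (intro add_left_mono sum_mono mult_left_mono mult_right_mono b_antimono) auto
      finally have "ennreal (b \<eta> x * dominating g S c t (insert x \<eta>)) \<le> ennreal \<dots>" by (rule ennreal_leI)
      also have "\<dots> = ennreal D * ennreal (b \<eta> x) + (\<Sum>R\<in>Pow \<zeta>. ennreal (w R) * (ennreal (b R x) * ennreal (E (insert x R))))"
      proof -
        have "(\<Sum>R\<in>Pow \<zeta>. ennreal (w R) * (ennreal (b R x) * ennreal (E (insert x R))))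
            = (\<Sum>R\<in>Pow \<zeta>. ennreal (w R * (b R x * E (insert x R))))"
          using w b_nonneg ER by (intro sum.cong) (auto simp: ennreal_mult)
        also have "\<dots> = ennreal (\<Sum>R\<in>Pow \<zeta>. w R * (b R x * E (insert x R)))"
          using w b_nonneg ER by (intro sum_ennreal) auto
        finally show ?thesis
          using D b_nonneg w ER by (subst ennreal_plus) (auto simp: ennreal_mult intro!: sum_nonneg)
      qed
      finally show ?case using b_nonneg by (simp add: ennreal_mult')
    qed
  qed
  also have "\<dots> = ennreal D * ennreal B + (\<Sum>R\<in>Pow \<zeta>. ennreal (w R) * birth_op (\<lambda>\<eta>. ennreal (E \<eta>)) R)"
  proof -
    have [measurable]: "b R \<in> borel_measurable L" "(\<lambda>x. E (insert x R)) \<in> borel_measurable L" if "R \<subseteq> \<eta>" for R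
    proof -
      show "b R \<in> borel_measurable L" by (rule b_measurable_L[OF sub[OF that]])
      show "(\<lambda>x. E (insert x R)) \<in> borel_measurable L"
        unfolding E_def by (rule measurable_insert_L[OF sub[OF that] birth_exp_measurable[OF m]])
    qed
    have 1: "(\<lambda>x. \<Sum>R\<in>Pow \<zeta>. ennreal (w R) * (ennreal (b R x) * ennreal (E (insert x R)))) \<in> borel_measurable L"
      using \<zeta> by (intro borel_measurable_sum) auto
    have "(\<integral>\<^sup>+x. ennreal D * ennreal (b \<eta> x) \<partial>L) = ennreal D * ennreal B"
      using B(2) by (subst nn_integral_cmult) (auto simp: birth_op_def)
    moreover have "(\<integral>\<^sup>+x. (\<Sum>R\<in>Pow \<zeta>. ennreal (w R) * (ennreal (b R x) * ennreal (E (insert x R)))) \<partial>L)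
      = (\<Sum>R\<in>Pow \<zeta>. ennreal (w R) * birth_op (\<lambda>\<eta>. ennreal (E \<eta>)) R)"
      using \<zeta> by (subst nn_integral_sum) (auto intro!: sum.cong nn_integral_cmult simp: birth_op_def)
    ultimately show ?thesis using 1 by (subst nn_integral_add) auto
  qed
  also have "(\<Sum>R\<in>Pow \<zeta>. ennreal (w R) * birth_op (\<lambda>\<eta>. ennreal (E \<eta>)) R) =
      (\<Sum>R\<in>Pow \<zeta>. ennreal (w R * E' R))"
  proof (rule sum.cong)
    fix R assume "R \<in> Pow \<zeta>"
    then have "R \<in> conf_sets \<Lambda>" using \<zeta> sub by auto
    then show "ennreal (w R) * birth_op (\<lambda>\<eta>. ennreal (E \<eta>)) R = ennreal (w R * E' R)"
      using birth_op_birth_exp[OF m g K _ \<theta>(3)] E' w by (simp add: E_def E'_def ennreal_mult)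
  qed simp
  also have "\<dots> = ennreal (\<Sum>R\<in>Pow \<zeta>. w R * E' R)"
    using w E' sub \<zeta> by (intro sum_ennreal) auto
  also have "(\<Sum>R\<in>Pow \<zeta>. w R * E' R) = thin \<theta> (\<lambda>R. \<theta> * E' R) \<zeta>"
    by (simp add: thin_def w_def mult_ac)
  also have "ennreal D * ennreal B + ennreal (thin \<theta> (\<lambda>R. \<theta> * E' R) \<zeta>) =
      ennreal (D * B + thin \<theta> (\<lambda>R. \<theta> * E' R) \<zeta>)"
    using D B \<theta> E' \<zeta> sub by (simp add: ennreal_mult ennreal_plus thin_nonneg)
  finally have births: "birth_op (\<lambda>\<eta>. ennreal (dominating g S c t \<eta>)) \<eta> \<le>
    ennreal (D * B + thin \<theta> (\<lambda>R. \<theta> * E' R) \<zeta>)" .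
  have "jump_op (\<lambda>\<eta>. ennreal (dominating g S c t \<eta>)) \<eta> \<le>
     ennreal (real k * ((real k - 1) * \<theta> + c + T \<zeta>)
        + (real (card \<zeta>) * (real k * \<theta> + c) + (\<Sum>x\<in>\<zeta>. T (\<zeta> - {x}))))
     + ennreal (D * B + thin \<theta> (\<lambda>R. \<theta> * E' R) \<zeta>)"
    unfolding jump_op_def deaths by (rule add_left_mono[OF births])
  also have "\<dots> = ennreal (real k * ((real k - 1) * \<theta> + c + T \<zeta>)
        + (real (card \<zeta>) * (real k * \<theta> + c) + (\<Sum>x\<in>\<zeta>. T (\<zeta> - {x})))
     + (D * B + thin \<theta> (\<lambda>R. \<theta> * E' R) \<zeta>))"
  proof (rule ennreal_plus[symmetric])
    \<comment> \<open>For k = 0 the inner difference is negative, but its prefactor is 0.\<close>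
    have "0 \<le> real k * ((real k - 1) * \<theta> + c + T \<zeta>)"
      using \<theta> c T[OF \<zeta>] by (cases k) auto
    moreover have "0 \<le> real (card \<zeta>) * (real k * \<theta> + c)" using \<theta> c by simp
    moreover have "0 \<le> (\<Sum>x\<in>\<zeta>. T (\<zeta> - {x}))" using \<zeta> by (intro sum_nonneg T) auto
    ultimately show "0 \<le> real k * ((real k - 1) * \<theta> + c + T \<zeta>)
        + (real (card \<zeta>) * (real k * \<theta> + c) + (\<Sum>x\<in>\<zeta>. T (\<zeta> - {x})))"
      by linarith
    show "0 \<le> D * B + thin \<theta> (\<lambda>R. \<theta> * E' R) \<zeta>"
      using D B \<theta> E' \<zeta> sub by (intro add_nonneg_nonneg thin_nonneg) auto
  qed
  also have "\<dots> \<le> ennreal (- real k * \<theta> + ((\<Sum>y\<in>\<zeta>. T (\<zeta> - {y})) - real (card \<zeta>) * T \<zeta>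
       + thin \<theta> (\<lambda>R. \<theta> * E' R) \<zeta>) + r \<eta> * dominating g S c t \<eta>)"
  proof (rule ennreal_leI)
    have "r \<eta> * dominating g S c t \<eta> = (real k + real (card \<zeta>) + B) * (real k * \<theta> + c + T \<zeta>)"
      using card by (simp add: V exit_rate_def B_def k_def[symmetric] \<zeta>_def[symmetric])
    \<comment> \<open>This term is the whole slack. For \<phi> = 0 it would be used up by the
      normalisation exp (- (1 - \<theta>) lam vol), which the series \<open>birth_exp\<close> does
      not carry.\<close>
    moreover have "0 \<le> B * \<theta> * T \<zeta>" using B \<theta> T[OF \<zeta>] by simp
    ultimately show "real k * ((real k - 1) * \<theta> + c + T \<zeta>)
        + (real (card \<zeta>) * (real k * \<theta> + c) + (\<Sum>x\<in>\<zeta>. T (\<zeta> - {x})))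
        + (D * B + thin \<theta> (\<lambda>R. \<theta> * E' R) \<zeta>)
      \<le> - real k * \<theta> + ((\<Sum>y\<in>\<zeta>. T (\<zeta> - {y})) - real (card \<zeta>) * T \<zeta>
         + thin \<theta> (\<lambda>R. \<theta> * E' R) \<zeta>) + r \<eta> * dominating g S c t \<eta>"
      unfolding D_def by (simp add: algebra_simps)
  qed
  finally show ?thesis unfolding k_def \<zeta>_def E'_def .
qed

text \<open>At time 0 either some point of S is present, and the count already dominates f \<le> 1,
  or the thinning with \<theta> = 1 and the series with a = 0 return g itself. Splitting f into c
  and g matters because a constant passes through the dynamics unchanged, whereas g will be charged
  the partition function.\<close>

lemma law_le_dominating:
  assumes f: "f \<in> borel_measurable C" "\<And>\<eta>. \<eta> \<in> conf_sets \<Lambda> \<Longrightarrow> f \<eta> \<le> 1"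
    and m: "g \<in> borel_measurable C"
    and g: "\<And>\<eta>. \<eta> \<in> conf_sets \<Lambda> \<Longrightarrow> g \<eta> \<le> ennreal K" and K: "0 \<le> K" and c: "0 \<le> c"
    and fg: "\<And>\<eta>. \<eta> \<in> conf_sets \<Lambda> \<Longrightarrow> f \<eta> \<le> ennreal c + g \<eta>"
    and S: "finite S" and \<eta>: "\<eta> \<in> conf_sets \<Lambda>" and t: "0 \<le> t"
  shows "law f t \<eta> \<le> ennreal (dominating g S c t \<eta>)"
proof (rule law_le_supersolution[OF f(1) _ t \<eta>])
  fix t :: real and \<eta> assume t: "0 \<le> t" and \<eta>: "\<eta> \<in> conf_sets \<Lambda>"
  define T where "T t = thin (exp (- t)) (birth_exp g (1 - exp (- t)))" for t
  define V' where "V' t = - real (card (\<eta> \<inter> S)) * exp (- t) + ((\<Sum>y\<in>\<eta> - S. T t (\<eta> - S - {y}))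
      - real (card (\<eta> - S)) * T t (\<eta> - S)
      + thin (exp (- t)) (\<lambda>R. exp (- t) * birth_exp (birth_op g) (1 - exp (- t)) R) (\<eta> - S))" for t
  have fin: "finite \<eta>" using conf_setsD[OF \<eta>] by simp
  have sub: "R \<in> conf_sets \<Lambda>" if "R \<subseteq> \<eta>" for R
    using \<eta> that finite_subset by (auto simp: conf_sets_def)
  have g': "birth_op g \<eta> \<le> ennreal (K * (lam * vol))" if "\<eta> \<in> conf_sets \<Lambda>" for \<eta>
    using birth_op_le[OF g K that] .
  have K': "0 \<le> K * (lam * vol)" using K lam_nonneg by simp
  have Tm: "(\<lambda>t. T t R) \<in> borel_measurable borel" if "R \<subseteq> \<eta>" for R
    unfolding T_def thin_def using that sub
    by (intro borel_measurable_sum borel_measurable_times birth_exp_borel[OF g K]) auto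
  have T'm: "(\<lambda>t. thin (exp (- t)) (\<lambda>R. exp (- t) * birth_exp (birth_op g) (1 - exp (- t)) R) (\<eta> - S))
      \<in> borel_measurable borel"
    unfolding thin_def using sub
    by (intro borel_measurable_sum borel_measurable_times birth_exp_borel[OF g' K']) auto
  have nonneg: "0 \<le> dominating g S c t \<eta>" if "0 \<le> t" for t
    unfolding dominating_def using that c sub
    by (intro add_nonneg_nonneg thin_nonneg birth_exp_nonneg[OF g K]) auto
  have Tnn: "0 \<le> T t R" if "0 \<le> t" "R \<subseteq> \<eta>" for t R
    unfolding T_def using that sub by (intro thin_nonneg birth_exp_nonneg[OF g K]) auto
  have "f \<eta> \<le> ennreal (dominating g S c 0 \<eta>)"
  proof (cases "\<eta> \<inter> S = {}")
    case True
    moreover have "birth_exp g 0 \<eta> = enn2real (g \<eta>)" unfolding birth_exp_def powser_zero by simp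
    ultimately have "dominating g S c 0 \<eta> = c + enn2real (g \<eta>)"
      using fin by (simp add: dominating_def thin_1 Diff_triv)
    moreover have "g \<eta> < top" using g[OF \<eta>] by (meson ennreal_less_top le_less_trans)
    ultimately show ?thesis using fg[OF \<eta>] c by (simp add: ennreal_plus)
  next
    case False
    then have "1 \<le> real (card (\<eta> \<inter> S))" using fin by (simp add: Suc_le_eq card_gt_0_iff)
    then have "1 \<le> dominating g S c 0 \<eta>"
      using c Tnn[of 0 "\<eta> - S"] by (simp add: dominating_def T_def)
    then show ?thesis using f(2)[OF \<eta>] by (metis ennreal_1 ennreal_leI order_trans)
  qed
  then have "jumps f 0 t \<eta> \<le> ennreal (exp (- r \<eta> * t) * dominating g S c 0 \<eta>)"
    using nonneg[of 0] by (simp add: ennreal_mult mult_left_mono)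
  then have "jumps f 0 t \<eta> + first_jump (\<lambda>t \<eta>. ennreal (dominating g S c t \<eta>)) t \<eta> \<le>
      ennreal (exp (- r \<eta> * t) * dominating g S c 0 \<eta>) +
      first_jump (\<lambda>t \<eta>. ennreal (dominating g S c t \<eta>)) t \<eta>" by (rule add_right_mono)
  also have "\<dots> \<le> ennreal (dominating g S c t \<eta>)"
  proof (rule first_jump_le_of_derivative[where V = "\<lambda>t. dominating g S c t \<eta>" and V' = V', OF \<eta> t])
    show "(\<lambda>t. dominating g S c t \<eta>) \<in> borel_measurable borel"
      using Tm[of "\<eta> - S"] unfolding dominating_def T_def by measurable
    show "V' \<in> borel_measurable borel"
      unfolding V'_def[abs_def] using T'm
      by (intro borel_measurable_add borel_measurable_diff borel_measurable_times borel_measurable_sum)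
        (auto intro!: Tm)
    show "((\<lambda>t. dominating g S c t \<eta>) has_real_derivative V' \<sigma>) (at \<sigma>)" for \<sigma>
    proof -
      have "((\<lambda>t. birth_exp g (1 - exp (- t)) R) has_real_derivative
          exp (- \<sigma>) * birth_exp (birth_op g) (1 - exp (- \<sigma>)) R) (at \<sigma>)" if "R \<subseteq> \<eta> - S" for R
      proof -
        have R: "R \<in> conf_sets \<Lambda>" using that by (intro sub) auto
        have "((\<lambda>t. 1 - exp (- t)) has_real_derivative exp (- \<sigma>)) (at \<sigma>)"
          by (auto intro!: derivative_eq_intros)
        from DERIV_chain2[OF birth_exp_has_derivative[OF g K R] this]
        show ?thesis by (simp add: mult.commute)
      qed
      then have dT: "((\<lambda>t. T t (\<eta> - S)) has_real_derivative ((\<Sum>y\<in>\<eta> - S. T \<sigma> (\<eta> - S - {y}))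
          - real (card (\<eta> - S)) * T \<sigma> (\<eta> - S)
          + thin (exp (- \<sigma>)) (\<lambda>R. exp (- \<sigma>) * birth_exp (birth_op g) (1 - exp (- \<sigma>)) R) (\<eta> - S))) (at \<sigma>)"
        unfolding T_def using fin by (intro thin_has_derivative) auto
      show ?thesis unfolding V'_def dominating_def T_def[symmetric]
        by (auto intro!: derivative_eq_intros dT)
    qed
    fix \<sigma> :: real assume \<sigma>: "0 \<le> \<sigma>"
    then show "0 \<le> dominating g S c \<sigma> \<eta>" by (rule nonneg)
    show "jump_op (\<lambda>\<eta>. ennreal (dominating g S c \<sigma> \<eta>)) \<eta> \<le> ennreal (V' \<sigma> + r \<eta> * dominating g S c \<sigma> \<eta>)"
      using jump_op_dominating_le[OF m g K c S \<eta> \<sigma>] unfolding V'_def T_def .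
    let ?k = "real (card (\<eta> \<inter> S))" and ?z = "real (card (\<eta> - S))" and ?T = "T \<sigma> (\<eta> - S)"
    \<comment> \<open>A natural number is at most its square, so the deaths counted in the exit rate
      absorb the negative term of V'.\<close>
    have k: "?k * exp (- \<sigma>) \<le> ?k * (?k * exp (- \<sigma>))"
      by (cases "card (\<eta> \<inter> S)") (auto simp: mult_right_mono)
    have dec: "r \<eta> = ?k + ?z + (\<integral>x. b \<eta> x \<partial>L)"
      using card_Int_Diff[OF fin, of S] by (simp add: exit_rate_def)
    have d: "dominating g S c \<sigma> \<eta> = ?k * exp (- \<sigma>) + c + ?T" by (simp add: dominating_def T_def)
    have "0 \<le> (\<integral>x. b \<eta> x \<partial>L)" by (simp add: b_nonneg integral_nonneg_AE)
    then have "(?k + ?z) * (?k * exp (- \<sigma>) + c + ?T) \<le> r \<eta> * dominating g S c \<sigma> \<eta>"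
      unfolding dec d[symmetric] using nonneg[OF \<sigma>] by (intro mult_right_mono) auto
    moreover have "?k * exp (- \<sigma>) + ?z * ?T \<le> (?k + ?z) * (?k * exp (- \<sigma>) + c + ?T)"
    proof -
      have "0 \<le> ?k * c" "0 \<le> ?k * ?T" "0 \<le> ?z * (?k * exp (- \<sigma>))" "0 \<le> ?z * c"
        using c Tnn[OF \<sigma>, of "\<eta> - S"] by auto
      moreover have "(?k + ?z) * (?k * exp (- \<sigma>) + c + ?T) = ?k * (?k * exp (- \<sigma>)) + ?k * c + ?k * ?T
          + ?z * (?k * exp (- \<sigma>)) + ?z * c + ?z * ?T" by (simp add: algebra_simps)
      ultimately show ?thesis using k by linarith
    qed
    moreover have "0 \<le> (\<Sum>y\<in>\<eta> - S. T \<sigma> (\<eta> - S - {y}))" by (intro sum_nonneg Tnn[OF \<sigma>]) auto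
    moreover have "0 \<le> thin (exp (- \<sigma>)) (\<lambda>R. exp (- \<sigma>) * birth_exp (birth_op g) (1 - exp (- \<sigma>)) R) (\<eta> - S)"
      using \<sigma> sub by (intro thin_nonneg mult_nonneg_nonneg birth_exp_nonneg[OF g' K']) auto
    ultimately show "0 \<le> V' \<sigma> + r \<eta> * dominating g S c \<sigma> \<eta>" unfolding V'_def by linarith
  qed
  finally show "jumps f 0 t \<eta> + first_jump (\<lambda>t \<eta>. ennreal (dominating g S c t \<eta>)) t \<eta>
    \<le> ennreal (dominating g S c t \<eta>)" .
qed

section \<open>The Gibbs measure and the GNZ equation\<close>

sublocale product_sigma_finite "\<lambda>_. L"
  by standard

section \<open>Poisson integrals, Gibbs weights and the partition function\<close>

lemma measurable_image_conf [measurable]: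
  assumes "finite I" "J \<subseteq> I" "R \<in> conf_sets \<Lambda>"
  shows "(\<lambda>x. R \<union> x ` J) \<in> Pi\<^sub>M I (\<lambda>_. L) \<rightarrow>\<^sub>M C"
proof -
  have "finite J" using assms finite_subset by blast
  then show ?thesis using assms(2)
  proof (induction J rule: finite_induct)
    case empty
    then show ?case using assms(3) by simp
  next
    case (insert j J)
    note [measurable] = insert.IH[OF insert_subset[THEN iffD1, OF insert.prems, THEN conjunct2]]
    have [measurable]: "(\<lambda>x. x j) \<in> Pi\<^sub>M I (\<lambda>_. L) \<rightarrow>\<^sub>M L"
      using insert.prems by (intro measurable_component_singleton) auto
    have "(\<lambda>x. insert (x j) (R \<union> x ` J)) \<in> Pi\<^sub>M I (\<lambda>_. L) \<rightarrow>\<^sub>M C" by measurable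
    then show ?case by simp
  qed
qed

lemma measurable_tuple_conf: "(\<lambda>x. x ` {..<n::nat}) \<in> Pi\<^sub>M {..<n} (\<lambda>_. L) \<rightarrow>\<^sub>M C"
  using measurable_image_conf[of "{..<n}" "{..<n}" "{}"] by simp

lemma measurable_tuple_compose:
  "h \<in> borel_measurable C \<Longrightarrow> (\<lambda>x. h (x ` {..<n::nat})) \<in> borel_measurable (Pi\<^sub>M {..<n} (\<lambda>_. L))"
  by (rule measurable_compose[OF measurable_tuple_conf])

definition poisson_integral :: "('a set \<Rightarrow> ennreal) \<Rightarrow> ennreal" where
  "poisson_integral h = (\<Sum>n. ennreal (exp (- vol) / fact n) *
     (\<integral>\<^sup>+x. h (x ` {..<n}) \<partial>Pi\<^sub>M {..<n} (\<lambda>_. L)))"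

lemma poisson_integral_suminf:
  assumes "\<And>i. h i \<in> borel_measurable C"
  shows "poisson_integral (\<lambda>\<eta>. \<Sum>i. h i \<eta>) = (\<Sum>i. poisson_integral (h i))"
proof -
  have [measurable]: "(\<lambda>x. h i (x ` {..<n})) \<in> borel_measurable (Pi\<^sub>M {..<n} (\<lambda>_. L))" for i and n :: nat
    by (rule measurable_tuple_compose[OF assms])
  show ?thesis unfolding poisson_integral_def
    by (simp add: nn_integral_suminf ennreal_suminf_swap[of "\<lambda>i n. _ n * _ n i"] flip: ennreal_suminf_cmult)
qed

lemma sets_poisson_process [simp, measurable_cong]: "sets (poisson_process \<Lambda>) = sets C"
  and space_poisson_process [simp]: "space (poisson_process \<Lambda>) = conf_sets \<Lambda>"
  unfolding poisson_process_def using sets.sigma_sets_eq[of C] sets.space_closed[of C]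
  by (auto simp: sets_measure_of_conv space_measure_of_conv)

lemma emeasure_poisson_process:
  assumes A: "A \<in> sets C"
  shows "emeasure (poisson_process \<Lambda>) A = poisson_integral (indicator A)"
proof -
  have eq: "(\<Sum>n. ennreal (exp (- vol) / fact n) * emeasure (Pi\<^sub>M {..<n} (\<lambda>_. L))
      {x \<in> space (Pi\<^sub>M {..<n} (\<lambda>_. L)). x ` {..<n} \<in> A}) = poisson_integral (indicator A)"
    if A: "A \<in> sets C" for A
    unfolding poisson_integral_def
  proof (intro suminf_cong arg_cong2[where f = times] refl)
    fix n :: nat
    let ?P = "Pi\<^sub>M {..<n} (\<lambda>_. L)"
    have "{x \<in> space ?P. x ` {..<n} \<in> A} = (\<lambda>x. x ` {..<n}) -` A \<inter> space ?P" by auto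
    then have "{x \<in> space ?P. x ` {..<n} \<in> A} \<in> sets ?P"
      using measurable_sets[OF measurable_tuple_conf A] by simp
    then have "emeasure ?P {x \<in> space ?P. x ` {..<n} \<in> A} =
        (\<integral>\<^sup>+x. indicator {x \<in> space ?P. x ` {..<n} \<in> A} x \<partial>?P)" by simp
    also have "\<dots> = (\<integral>\<^sup>+x. indicator A (x ` {..<n}) \<partial>?P)"
      by (intro nn_integral_cong) (auto simp: indicator_def)
    finally show "emeasure ?P {x \<in> space ?P. x ` {..<n} \<in> A} = \<dots>" .
  qed
  have "emeasure (poisson_process \<Lambda>) A =
      (\<Sum>n. ennreal (exp (- vol) / fact n) * emeasure (Pi\<^sub>M {..<n} (\<lambda>_. L))
      {x \<in> space (Pi\<^sub>M {..<n} (\<lambda>_. L)). x ` {..<n} \<in> A})"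
    unfolding poisson_process_def
  proof (rule emeasure_measure_of_sigma[OF sets.sigma_algebra_axioms _ _ A])
    show "positive (sets C) (\<lambda>A. \<Sum>n. ennreal (exp (- vol) / fact n) * emeasure (Pi\<^sub>M {..<n} (\<lambda>_. L))
      {x \<in> space (Pi\<^sub>M {..<n} (\<lambda>_. L)). x ` {..<n} \<in> A})"
      by (simp add: positive_def)
    show "countably_additive (sets C) (\<lambda>A. \<Sum>n. ennreal (exp (- vol) / fact n) * emeasure (Pi\<^sub>M {..<n} (\<lambda>_. L))
      {x \<in> space (Pi\<^sub>M {..<n} (\<lambda>_. L)). x ` {..<n} \<in> A})"
    proof (rule countably_additiveI)
      fix A :: "nat \<Rightarrow> 'a set set" assume A: "range A \<subseteq> sets C" "disjoint_family A" "(\<Union>i. A i) \<in> sets C"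
      have Ai: "A i \<in> sets C" for i using A(1) by auto
      have "(\<Sum>i. poisson_integral (indicator (A i))) = poisson_integral (\<lambda>\<eta>. \<Sum>i. indicator (A i) \<eta>)"
        using Ai by (subst poisson_integral_suminf) auto
      also have "(\<lambda>\<eta>. \<Sum>i. indicator (A i) \<eta> :: ennreal) = indicator (\<Union>i. A i)"
        using A by (simp add: fun_eq_iff suminf_indicator)
      finally show "(\<Sum>i. \<Sum>n. ennreal (exp (- vol) / fact n) * emeasure (Pi\<^sub>M {..<n} (\<lambda>_. L))
          {x \<in> space (Pi\<^sub>M {..<n} (\<lambda>_. L)). x ` {..<n} \<in> A i}) =
        (\<Sum>n. ennreal (exp (- vol) / fact n) * emeasure (Pi\<^sub>M {..<n} (\<lambda>_. L))
          {x \<in> space (Pi\<^sub>M {..<n} (\<lambda>_. L)). x ` {..<n} \<in> (\<Union>i. A i)})"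
        unfolding eq[OF Ai] eq[OF A(3)] .
    qed
  qed
  then show ?thesis by (simp only: eq[OF A])
qed

lemma nn_integral_poisson_process:
  assumes "h \<in> borel_measurable C"
  shows "(\<integral>\<^sup>+\<eta>. h \<eta> \<partial>poisson_process \<Lambda>) = poisson_integral h"
  using assms
proof (induction rule: borel_measurable_induct)
  case (cong f g)
  have "poisson_integral f = poisson_integral g" unfolding poisson_integral_def
  proof (intro suminf_cong arg_cong2[where f = times] refl nn_integral_cong)
    fix n :: nat and x assume "x \<in> space (Pi\<^sub>M {..<n} (\<lambda>_. L))"
    then have "x ` {..<n} \<in> space C" by (rule measurable_space[OF measurable_tuple_conf])
    then show "f (x ` {..<n}) = g (x ` {..<n})" by (rule cong(3))
  qed
  moreover have "(\<integral>\<^sup>+\<eta>. f \<eta> \<partial>poisson_process \<Lambda>) = (\<integral>\<^sup>+\<eta>. g \<eta> \<partial>poisson_process \<Lambda>)"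
    using cong(3) by (intro nn_integral_cong) simp
  ultimately show ?case using cong(4) by simp
next
  case (set A)
  then show ?case by (simp add: emeasure_poisson_process)
next
  case (mult f c)
  have [measurable]: "(\<lambda>x. f (x ` {..<n})) \<in> borel_measurable (Pi\<^sub>M {..<n} (\<lambda>_. L))" for n :: nat
    by (rule measurable_tuple_compose[OF mult(2)])
  show ?case using mult
    by (simp add: nn_integral_cmult poisson_integral_def mult.left_commute[of _ c])
next
  case (add f g)
  have [measurable]: "(\<lambda>x. f (x ` {..<n})) \<in> borel_measurable (Pi\<^sub>M {..<n} (\<lambda>_. L))"
    "(\<lambda>x. g (x ` {..<n})) \<in> borel_measurable (Pi\<^sub>M {..<n} (\<lambda>_. L))" for n :: nat
    using measurable_tuple_compose[OF add.hyps(1)]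
      measurable_tuple_compose[OF add.hyps(3)] by auto
  show ?case using add
    by (simp add: nn_integral_add poisson_integral_def distrib_left suminf_add)
next
  case (seq U)
  have Um: "(\<lambda>x. U i (x ` {..<n})) \<in> borel_measurable (Pi\<^sub>M {..<n} (\<lambda>_. L))" for n :: nat and i
    by (rule measurable_tuple_compose[OF seq(1)])
  have "(\<integral>\<^sup>+\<eta>. (SUP i. U i) \<eta> \<partial>poisson_process \<Lambda>) = (SUP i. \<integral>\<^sup>+\<eta>. U i \<eta> \<partial>poisson_process \<Lambda>)"
    unfolding SUP_apply using seq(1,3)
    by (intro nn_integral_monotone_convergence_SUP) (auto simp: measurable_def)
  also have "\<dots> = (SUP i. poisson_integral (U i))" using seq.IH by simp
  also have "\<dots> = poisson_integral (\<lambda>\<eta>. SUP i. U i \<eta>)"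
  proof -
    have mono: "incseq (\<lambda>i x. U i (x ` {..<n}))" for n
      using seq(3) by (auto simp: incseq_def le_fun_def)
    have "(\<integral>\<^sup>+x. (SUP i. U i (x ` {..<n})) \<partial>Pi\<^sub>M {..<n} (\<lambda>_. L)) =
        (SUP i. \<integral>\<^sup>+x. U i (x ` {..<n}) \<partial>Pi\<^sub>M {..<n} (\<lambda>_. L))" for n :: nat
      by (rule nn_integral_monotone_convergence_SUP[OF mono Um])
    then have "poisson_integral (\<lambda>\<eta>. SUP i. U i \<eta>) =
        (\<Sum>n. SUP i. ennreal (exp (- vol) / fact n) * (\<integral>\<^sup>+x. U i (x ` {..<n}) \<partial>Pi\<^sub>M {..<n} (\<lambda>_. L)))"
      unfolding poisson_integral_def by (simp add: SUP_mult_left_ennreal)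
    also have "\<dots> = (SUP i. poisson_integral (U i))"
      unfolding poisson_integral_def using seq(3)
      by (intro ennreal_suminf_SUP_eq) (auto simp: incseq_def le_fun_def intro!: mult_left_mono nn_integral_mono)
    finally show ?thesis by simp
  qed
  finally show ?case by (simp add: image_image)
qed

definition add_op :: "('a set \<Rightarrow> ennreal) \<Rightarrow> 'a set \<Rightarrow> ennreal" where
  "add_op h \<eta> = (\<integral>\<^sup>+x. h (insert x \<eta>) \<partial>L)"

lemma add_op_measurable:
  assumes h: "h \<in> borel_measurable C" shows "add_op h \<in> borel_measurable C"
proof -
  have "(\<lambda>p. insert (snd p) (fst p)) \<in> C \<Otimes>\<^sub>M L \<rightarrow>\<^sub>M C" by measurable
  from measurable_compose[OF this h]
  show ?thesis unfolding add_op_def[abs_def]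
    by (intro borel_measurable_nn_integral) (simp add: case_prod_beta')
qed

text \<open>Integrating over one coordinate of the tuple is one application of
  \<open>add_op\<close>; Fubini for finite products peels the coordinates off one by one.\<close>

lemma nn_integral_tuple:
  assumes "finite I" "h \<in> borel_measurable C" "R \<in> conf_sets \<Lambda>"
  shows "(\<integral>\<^sup>+x. h (R \<union> x ` I) \<partial>Pi\<^sub>M I (\<lambda>_. L)) = (add_op ^^ card I) h R"
  using assms(1,2)
proof (induction I arbitrary: h rule: finite_induct)
  case empty
  then show ?case by (simp add: PiM_empty)
next
  case (insert i I)
  have "(\<integral>\<^sup>+x. h (R \<union> x ` insert i I) \<partial>Pi\<^sub>M (insert i I) (\<lambda>_. L)) =
      (\<integral>\<^sup>+x. \<integral>\<^sup>+y. h (R \<union> (x(i := y)) ` insert i I) \<partial>L \<partial>Pi\<^sub>M I (\<lambda>_. L))"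
    using insert.hyps assms(3)
    by (intro product_nn_integral_insert measurable_compose[OF measurable_image_conf insert.prems]) auto
  also have "\<dots> = (\<integral>\<^sup>+x. add_op h (R \<union> x ` I) \<partial>Pi\<^sub>M I (\<lambda>_. L))"
  proof (intro nn_integral_cong)
    fix x
    have "R \<union> (x(i := y)) ` insert i I = insert y (R \<union> x ` I)" for y
      using insert.hyps by auto
    then show "(\<integral>\<^sup>+y. h (R \<union> (x(i := y)) ` insert i I) \<partial>L) = add_op h (R \<union> x ` I)"
      by (simp add: add_op_def)
  qed
  also have "\<dots> = (add_op ^^ card I) (add_op h) R"
    using insert.prems by (intro insert.IH add_op_measurable)
  finally show ?case using insert.hyps by (simp add: funpow_swap1)
qed

abbreviation w :: "'a set \<Rightarrow> ennreal" where "w \<equiv> gibbs_weight lam \<phi>"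

lemma w_measurable [measurable]: "w \<in> borel_measurable C"
proof -
  have [measurable]: "(\<lambda>\<eta>. energy \<phi> \<eta>) \<in> borel_measurable C"
    by (rule borel_measurable_energy[OF \<phi>_measurable, where \<Lambda> = \<Lambda>]) simp
  have [measurable]: "(\<lambda>\<eta>. card \<eta>) \<in> C \<rightarrow>\<^sub>M count_space UNIV" by (rule measurable_card_conf[where \<Lambda> = \<Lambda>]) simp
  show ?thesis unfolding gibbs_weight_def[abs_def] by measurable
qed

lemma w_insert:
  assumes "finite \<eta>" "x \<notin> \<eta>" shows "w (insert x \<eta>) = w \<eta> * ennreal (b \<eta> x)"
proof -
  have "lam ^ card (insert x \<eta>) * exp_neg (energy \<phi> (insert x \<eta>)) =
      lam ^ card \<eta> * exp_neg (energy \<phi> \<eta>) * b \<eta> x"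
    using assms exp_neg_energy_insert[OF assms] by (simp add: mult.assoc mult.left_commute[of lam])
  then show ?thesis using lam_nonneg exp_neg_bounds b_nonneg
    by (simp add: gibbs_weight_def ennreal_mult)
qed

text \<open>Detailed balance pulls the weight out one point at a time: adding a point under Lebesgue
  measure with weight \<open>w\<close> is the same as a birth at rate \<open>b\<close>. Gibbs
  integrals thus become iterates of the very operator that occurs in
  \<open>dominating\<close>.\<close>

lemma add_op_iterate_weight:
  assumes h: "h \<in> borel_measurable C" and "\<eta> \<in> conf_sets \<Lambda>"
  shows "(add_op ^^ n) (\<lambda>\<eta>. w \<eta> * h \<eta>) \<eta> = w \<eta> * (birth_op ^^ n) h \<eta>"
  using assms(2)
proof (induction n arbitrary: \<eta>)
  case (Suc n)
  have "(add_op ^^ Suc n) (\<lambda>\<eta>. w \<eta> * h \<eta>) \<eta> = (\<integral>\<^sup>+x. w (insert x \<eta>) * (birth_op ^^ n) h (insert x \<eta>) \<partial>L)"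
    unfolding funpow.simps comp_def add_op_def[of "(add_op ^^ n) _"]
    using Suc by (intro nn_integral_cong) simp
  also have "\<dots> = (\<integral>\<^sup>+x. w \<eta> * (ennreal (b \<eta> x) * (birth_op ^^ n) h (insert x \<eta>)) \<partial>L)"
    using AE_not_in_finite[OF conf_setsD(1)[OF Suc.prems]] conf_setsD(1)[OF Suc.prems]
    by (intro nn_integral_cong_AE) (auto elim!: eventually_mono simp: w_insert mult.assoc)
  also have "\<dots> = w \<eta> * birth_op ((birth_op ^^ n) h) \<eta>"
    unfolding birth_op_def[of "(birth_op ^^ n) h"]
    using measurable_insert_L[OF Suc.prems birth_iterate_measurable[OF h]] b_measurable_L[OF Suc.prems]
    by (intro nn_integral_cmult) auto
  finally show ?case by simp
qed simp

text \<open>The unnormalised Gibbs expectation, up to the factor exp (- vol) of the Poisson process;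
  its value at the constant 1 is the partition function.\<close>

definition gibbs_sum :: "('a set \<Rightarrow> ennreal) \<Rightarrow> ennreal" where
  "gibbs_sum h = (\<Sum>n. ennreal (1 / fact n) * (birth_op ^^ n) h {})"

lemma poisson_integral_weight:
  assumes h: "h \<in> borel_measurable C"
  shows "(\<integral>\<^sup>+\<eta>. w \<eta> * h \<eta> \<partial>poisson_process \<Lambda>) = ennreal (exp (- vol)) * gibbs_sum h"
proof -
  have wh: "(\<lambda>\<eta>. w \<eta> * h \<eta>) \<in> borel_measurable C" using h by measurable
  have "(\<integral>\<^sup>+x. w (x ` {..<n}) * h (x ` {..<n}) \<partial>Pi\<^sub>M {..<n} (\<lambda>_. L)) = (birth_op ^^ n) h {}" for n :: nat
    using nn_integral_tuple[of "{..<n}" _ "{}", OF _ wh] add_op_iterate_weight[OF h, of "{}" n]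
    by (simp add: gibbs_weight_def)
  then have "(\<integral>\<^sup>+\<eta>. w \<eta> * h \<eta> \<partial>poisson_process \<Lambda>) =
      (\<Sum>n. ennreal (exp (- vol) / fact n) * (birth_op ^^ n) h {})"
    unfolding nn_integral_poisson_process[OF wh] poisson_integral_def by simp
  also have "\<dots> = (\<Sum>n. ennreal (exp (- vol)) * (ennreal (1 / fact n) * (birth_op ^^ n) h {}))"
    by (intro suminf_cong) (simp add: mult.assoc[symmetric] ennreal_mult[symmetric])
  finally show ?thesis by (simp add: gibbs_sum_def)
qed

text \<open>The empty configuration alone contributes 1, and birth rates at most lam bound the n-th
  term by (lam vol)^n / fact n.\<close>

lemma gibbs_sum_1: "1 \<le> gibbs_sum (\<lambda>_. 1)" "gibbs_sum (\<lambda>_. 1) \<le> ennreal (exp (lam * vol))"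
proof -
  have "(\<Sum>n<1. ennreal (1 / fact n) * (birth_op ^^ n) (\<lambda>_. 1) {}) \<le> gibbs_sum (\<lambda>_. 1)"
    unfolding gibbs_sum_def by (rule sum_le_suminf) auto
  then show "1 \<le> gibbs_sum (\<lambda>_. 1)" by simp
  have "(\<lambda>n. (lam * vol) ^ n / fact n) sums exp (lam * vol)"
    using exp_converges[of "lam * vol"] by (simp add: field_simps)
  then have "(\<Sum>n. ennreal ((lam * vol) ^ n / fact n)) = ennreal (exp (lam * vol))"
    using lam_nonneg by (subst suminf_ennreal2) (auto simp: sums_iff)
  moreover have "gibbs_sum (\<lambda>_. 1) \<le> (\<Sum>n. ennreal ((lam * vol) ^ n / fact n))"
    unfolding gibbs_sum_def
  proof (intro suminf_le)
    fix n
    have "ennreal (1 / fact n) * (birth_op ^^ n) (\<lambda>_. 1) {} \<le> ennreal (1 / fact n) * ennreal (1 * (lam * vol) ^ n)"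
      by (intro mult_left_mono birth_iterate_le) auto
    then show "ennreal (1 / fact n) * (birth_op ^^ n) (\<lambda>_. 1) {} \<le> ennreal ((lam * vol) ^ n / fact n)"
      using lam_nonneg by (simp flip: ennreal_mult)
  qed auto
  ultimately show "gibbs_sum (\<lambda>_. 1) \<le> ennreal (exp (lam * vol))" by simp
qed

abbreviation \<mu> :: "'a set measure" where "\<mu> \<equiv> gibbs_measure \<Lambda> lam \<phi>"

lemma sets_\<mu> [simp, measurable_cong]: "sets \<mu> = sets C"
  and space_\<mu> [simp]: "space \<mu> = conf_sets \<Lambda>"
  by (simp_all add: gibbs_measure_def)

lemma nn_integral_\<mu>:
  assumes [measurable]: "h \<in> borel_measurable C"
  shows "(\<integral>\<^sup>+\<eta>. h \<eta> \<partial>\<mu>) = gibbs_sum h / gibbs_sum (\<lambda>_. 1)"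
proof -
  let ?Z = "\<integral>\<^sup>+\<zeta>. w \<zeta> \<partial>poisson_process \<Lambda>"
  have Z: "?Z = ennreal (exp (- vol)) * gibbs_sum (\<lambda>_. 1)"
    using poisson_integral_weight[of "\<lambda>_. 1"] by simp
  have "(\<integral>\<^sup>+\<eta>. h \<eta> \<partial>\<mu>) = (\<integral>\<^sup>+\<eta>. w \<eta> / ?Z * h \<eta> \<partial>poisson_process \<Lambda>)"
    unfolding gibbs_measure_def by (intro nn_integral_density) measurable
  also have "\<dots> = (\<integral>\<^sup>+\<eta>. w \<eta> * h \<eta> / ?Z \<partial>poisson_process \<Lambda>)"
    by (simp add: divide_ennreal_def mult_ac)
  also have "\<dots> = (\<integral>\<^sup>+\<eta>. w \<eta> * h \<eta> \<partial>poisson_process \<Lambda>) / ?Z"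
    by (intro nn_integral_divide) measurable
  also have "\<dots> = (ennreal (exp (- vol)) * gibbs_sum h) / (ennreal (exp (- vol)) * gibbs_sum (\<lambda>_. 1))"
    by (simp add: poisson_integral_weight Z)
  also have "\<dots> = gibbs_sum h / gibbs_sum (\<lambda>_. 1)"
    by (subst (1 2) mult.commute) (rule divide_mult_eq, auto)
  finally show ?thesis .
qed

lemma gibbs_sum_1_finite: "gibbs_sum (\<lambda>_. 1) \<noteq> 0" "gibbs_sum (\<lambda>_. 1) \<noteq> top"
  using gibbs_sum_1 by (auto simp: top_unique)

lemma prob_space_\<mu>: "prob_space \<mu>"
proof
  have "emeasure \<mu> (space \<mu>) = (\<integral>\<^sup>+\<eta>. 1 \<partial>\<mu>)" by simp
  also have "\<dots> = 1" using gibbs_sum_1_finite by (subst nn_integral_\<mu>) (auto simp: less_top)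
  finally show "emeasure \<mu> (space \<mu>) = 1" .
qed

text \<open>The price for passing from the unnormalised sum to \<mu>, and the only place where the
  density constant is incurred.\<close>

lemma gibbs_sum_le:
  assumes "h \<in> borel_measurable C"
  shows "gibbs_sum h \<le> ennreal (exp (lam * vol)) * (\<integral>\<^sup>+\<eta>. h \<eta> \<partial>\<mu>)"
proof -
  have "gibbs_sum h = gibbs_sum (\<lambda>_. 1) * (\<integral>\<^sup>+\<eta>. h \<eta> \<partial>\<mu>)"
    unfolding nn_integral_\<mu>[OF assms] using gibbs_sum_1_finite
    by (simp add: ennreal_times_divide ennreal_mult_divide_eq mult.commute)
  also have "\<dots> \<le> ennreal (exp (lam * vol)) * (\<integral>\<^sup>+\<eta>. h \<eta> \<partial>\<mu>)"
    by (intro mult_right_mono gibbs_sum_1) auto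
  finally show ?thesis .
qed

section \<open>The GNZ equation\<close>

lemma birth_iterate_cong:
  assumes "\<And>\<eta>. \<eta> \<in> conf_sets \<Lambda> \<Longrightarrow> f \<eta> = g \<eta>" "\<eta> \<in> conf_sets \<Lambda>"
  shows "(birth_op ^^ n) f \<eta> = (birth_op ^^ n) g \<eta>"
  using assms(2)
proof (induction n arbitrary: \<eta>)
  case (Suc n)
  then show ?case by (auto intro!: antisym birth_op_mono)
qed (simp add: assms(1))

lemma birth_iterate_add:
  assumes f: "f \<in> borel_measurable C" and g: "g \<in> borel_measurable C" and "\<eta> \<in> conf_sets \<Lambda>"
  shows "(birth_op ^^ n) (\<lambda>\<eta>. f \<eta> + g \<eta>) \<eta> = (birth_op ^^ n) f \<eta> + (birth_op ^^ n) g \<eta>"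
  using assms(3)
proof (induction n arbitrary: \<eta>)
  case (Suc n)
  have "(birth_op ^^ Suc n) (\<lambda>\<eta>. f \<eta> + g \<eta>) \<eta> =
      birth_op (\<lambda>\<eta>. (birth_op ^^ n) f \<eta> + (birth_op ^^ n) g \<eta>) \<eta>"
    using Suc by (auto intro!: antisym birth_op_mono)
  then show ?case using Suc.prems birth_iterate_measurable[OF f] birth_iterate_measurable[OF g]
    by (simp add: birth_op_add)
qed simp

definition marked_sum :: "('a \<Rightarrow> 'a set \<Rightarrow> ennreal) \<Rightarrow> 'a set \<Rightarrow> ennreal" where
  "marked_sum F \<eta> = (\<Sum>x\<in>\<eta>. F x (\<eta> - {x}))"

definition marked_integral :: "('a \<Rightarrow> 'a set \<Rightarrow> ennreal) \<Rightarrow> 'a set \<Rightarrow> ennreal" where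
  "marked_integral F \<eta> = (\<integral>\<^sup>+x. ennreal (b \<eta> x) * F x \<eta> \<partial>L)"

text \<open>The effect of a birth elsewhere on a mark at y: the marked point stays in the
  configuration and influences the rate, while F sees it separately from the rest.\<close>

definition marked_birth :: "('a \<Rightarrow> 'a set \<Rightarrow> ennreal) \<Rightarrow> 'a \<Rightarrow> 'a set \<Rightarrow> ennreal" where
  "marked_birth F y \<zeta> = (\<integral>\<^sup>+x. ennreal (b (insert y \<zeta>) x) * F y (insert x \<zeta>) \<partial>L)"

definition marked :: "('a \<Rightarrow> 'a set \<Rightarrow> ennreal) \<Rightarrow> bool" where
  "marked F \<longleftrightarrow> (\<lambda>p. F (fst p) (snd p)) \<in> borel_measurable (points \<Lambda> \<Otimes>\<^sub>M C)"

lemma markedD: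
  assumes "marked F" "f \<in> M \<rightarrow>\<^sub>M points \<Lambda>" "h \<in> M \<rightarrow>\<^sub>M C"
  shows "(\<lambda>\<omega>. F (f \<omega>) (h \<omega>)) \<in> borel_measurable M"
  using measurable_compose[OF measurable_Pair[OF assms(2,3)] assms(1)[unfolded marked_def]] by simp

lemma marked_sum_measurable:
  assumes "marked F" shows "marked_sum F \<in> borel_measurable C"
proof -
  have "(\<lambda>p. F (fst p) (snd p - {fst p})) \<in> borel_measurable (points \<Lambda> \<Otimes>\<^sub>M C)"
    by (rule markedD[OF assms]) measurable
  from borel_measurable_sum_conf[OF this, of "\<lambda>\<eta>. \<eta>"]
  show ?thesis by (simp add: marked_sum_def[abs_def])
qed

lemma marked_integral_measurable:
  assumes "marked F" shows "marked_integral F \<in> borel_measurable C"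
proof -
  have [measurable]: "(\<lambda>p. F (snd p) (fst p)) \<in> borel_measurable (C \<Otimes>\<^sub>M L)"
    by (rule markedD[OF assms]) measurable
  show ?thesis unfolding marked_integral_def[abs_def]
    by (rule borel_measurable_nn_integral) (simp add: case_prod_beta', measurable)
qed

lemma marked_birth_marked:
  assumes "marked F" shows "marked (marked_birth F)"
proof -
  have [measurable]: "(\<lambda>q. F (fst (fst q)) (insert (snd q) (snd (fst q)))) \<in> borel_measurable ((points \<Lambda> \<Otimes>\<^sub>M C) \<Otimes>\<^sub>M L)"
    by (rule markedD[OF assms]) measurable
  show ?thesis unfolding marked_def marked_birth_def
    by (rule borel_measurable_nn_integral) (simp add: case_prod_beta', measurable)
qed

text \<open>After a birth the marked point is either the newborn one or one of the old ones.\<close>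

lemma birth_op_marked_sum:
  assumes F: "marked F" and \<eta>: "\<eta> \<in> conf_sets \<Lambda>"
  shows "birth_op (marked_sum F) \<eta> = marked_integral F \<eta> + marked_sum (marked_birth F) \<eta>"
proof -
  have fin: "finite \<eta>" using conf_setsD[OF \<eta>] by simp
  note [measurable] = b_measurable_L[OF \<eta>]
  have [measurable]: "(\<lambda>x. F x \<eta>) \<in> borel_measurable L"
    using \<eta> by (intro markedD[OF F]) auto
  have Fy: "(\<lambda>x. F y (insert x (\<eta> - {y}))) \<in> borel_measurable L" if "y \<in> \<eta>" for y
  proof (rule markedD[OF F])
    show "(\<lambda>x. y) \<in> L \<rightarrow>\<^sub>M points \<Lambda>" using conf_setsD(2)[OF \<eta>] that by auto
    have [measurable]: "(\<lambda>x. \<eta> - {y}) \<in> L \<rightarrow>\<^sub>M C" using \<eta> by (intro const_conf_measurable) simp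
    show "(\<lambda>x. insert x (\<eta> - {y})) \<in> L \<rightarrow>\<^sub>M C" by measurable
  qed
  have "birth_op (marked_sum F) \<eta> =
      (\<integral>\<^sup>+x. ennreal (b \<eta> x) * F x \<eta> + (\<Sum>y\<in>\<eta>. ennreal (b \<eta> x) * F y (insert x (\<eta> - {y}))) \<partial>L)"
    unfolding birth_op_def
  proof (rule nn_integral_cong_AE)
    show "AE x in L. ennreal (b \<eta> x) * marked_sum F (insert x \<eta>) =
       ennreal (b \<eta> x) * F x \<eta> + (\<Sum>y\<in>\<eta>. ennreal (b \<eta> x) * F y (insert x (\<eta> - {y})))"
      using AE_not_in_finite[OF fin]
    proof eventually_elim
      case (elim x)
      have "(\<Sum>y\<in>\<eta>. F y (insert x \<eta> - {y})) = (\<Sum>y\<in>\<eta>. F y (insert x (\<eta> - {y})))"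
        using elim by (intro sum.cong) (auto simp: insert_Diff_if)
      then have "marked_sum F (insert x \<eta>) = F x \<eta> + (\<Sum>y\<in>\<eta>. F y (insert x (\<eta> - {y})))"
        using elim fin by (simp add: marked_sum_def)
      then show ?case by (simp add: distrib_left sum_distrib_left)
    qed
  qed
  also have "\<dots> = marked_integral F \<eta> + (\<Sum>y\<in>\<eta>. \<integral>\<^sup>+x. ennreal (b \<eta> x) * F y (insert x (\<eta> - {y})) \<partial>L)"
    unfolding marked_integral_def using Fy
    by (subst nn_integral_add) (auto intro!: borel_measurable_sum simp: nn_integral_sum)
  also have "(\<Sum>y\<in>\<eta>. \<integral>\<^sup>+x. ennreal (b \<eta> x) * F y (insert x (\<eta> - {y})) \<partial>L) = marked_sum (marked_birth F) \<eta>"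
    unfolding marked_sum_def marked_birth_def by (intro sum.cong) (auto simp: insert_absorb)
  finally show ?thesis .
qed

text \<open>Fubini together with \<open>b_swap\<close> exchanges the births of the marked and of the
  unmarked point; coinciding points form a null set.\<close>

lemma marked_integral_marked_birth:
  assumes F: "marked F" and \<eta>: "\<eta> \<in> conf_sets \<Lambda>"
  shows "marked_integral (marked_birth F) \<eta> = birth_op (marked_integral F) \<eta>"
proof -
  have fin: "finite \<eta>" using conf_setsD[OF \<eta>] by simp
  interpret P: pair_sigma_finite L L by standard
  note [measurable] = b_measurable_L[OF \<eta>] const_conf_measurable[OF \<eta>]
  have [measurable]: "(\<lambda>p. F (snd p) (insert (fst p) \<eta>)) \<in> borel_measurable (L \<Otimes>\<^sub>M L)"
    by (rule markedD[OF F]) measurable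
  have Fx: "(\<lambda>x. F y (insert x \<eta>)) \<in> borel_measurable L" "(\<lambda>x. F x (insert y \<eta>)) \<in> borel_measurable L"
    "b (insert y \<eta>) \<in> borel_measurable L" if "y \<in> \<Lambda>" for y
    using that \<eta> by (auto intro!: markedD[OF F] b_measurable_L)
  have "marked_integral (marked_birth F) \<eta> =
      (\<integral>\<^sup>+y. \<integral>\<^sup>+x. ennreal (b \<eta> y) * (ennreal (b (insert y \<eta>) x) * F y (insert x \<eta>)) \<partial>L \<partial>L)"
    unfolding marked_integral_def marked_birth_def
    using Fx by (intro nn_integral_cong nn_integral_cmult[symmetric]) auto
  also have "\<dots> = (\<integral>\<^sup>+x. \<integral>\<^sup>+y. ennreal (b \<eta> y) * (ennreal (b (insert y \<eta>) x) * F y (insert x \<eta>)) \<partial>L \<partial>L)"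
    by (rule P.Fubini') (simp add: case_prod_beta', measurable)
  also have "\<dots> = (\<integral>\<^sup>+x. \<integral>\<^sup>+y. ennreal (b \<eta> x) * (ennreal (b (insert x \<eta>) y) * F y (insert x \<eta>)) \<partial>L \<partial>L)"
  proof (intro nn_integral_cong_AE)
    show "AE x in L. (\<integral>\<^sup>+y. ennreal (b \<eta> y) * (ennreal (b (insert y \<eta>) x) * F y (insert x \<eta>)) \<partial>L) =
        (\<integral>\<^sup>+y. ennreal (b \<eta> x) * (ennreal (b (insert x \<eta>) y) * F y (insert x \<eta>)) \<partial>L)"
      using AE_not_in_finite[OF fin]
    proof eventually_elim
      case (elim x)
      have "AE y in L. y \<notin> insert x \<eta>" using fin by (intro AE_not_in_finite) simp
      then show ?case
      proof (intro nn_integral_cong_AE, eventually_elim)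
        case (elim y)
        have "b \<eta> y * b (insert y \<eta>) x = b \<eta> x * b (insert x \<eta>) y"
          using elim \<open>x \<notin> \<eta>\<close> fin by (intro b_swap) auto
        then show ?case using b_nonneg by (simp add: mult.assoc[symmetric] flip: ennreal_mult)
      qed
    qed
  qed
  also have "\<dots> = birth_op (marked_integral F) \<eta>"
    unfolding marked_integral_def birth_op_def
    using Fx by (intro nn_integral_cong nn_integral_cmult) auto
  finally show ?thesis .
qed

text \<open>Starting from the empty configuration, any one of the n + 1 births may produce the
  marked point. Births commute, so all choices contribute equally, with the marked one moved to the
  end.\<close>

lemma birth_iterate_marked_sum:
  "marked F \<Longrightarrow> (birth_op ^^ Suc n) (marked_sum F) {} = of_nat (Suc n) * (birth_op ^^ n) (marked_integral F) {}"
proof (induction n arbitrary: F)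
  case 0
  then show ?case by (simp add: birth_op_marked_sum) (simp add: marked_sum_def)
next
  case (Suc n)
  have "(birth_op ^^ Suc (Suc n)) (marked_sum F) {} = (birth_op ^^ Suc n) (birth_op (marked_sum F)) {}"
    by (simp only: funpow_Suc_right comp_def)
  also have "\<dots> = (birth_op ^^ Suc n) (\<lambda>\<eta>. marked_integral F \<eta> + marked_sum (marked_birth F) \<eta>) {}"
    using Suc.prems by (intro birth_iterate_cong birth_op_marked_sum) auto
  also have "\<dots> = (birth_op ^^ Suc n) (marked_integral F) {} + (birth_op ^^ Suc n) (marked_sum (marked_birth F)) {}"
    using Suc.prems
    by (intro birth_iterate_add marked_integral_measurable marked_sum_measurable marked_birth_marked) auto
  also have "(birth_op ^^ Suc n) (marked_sum (marked_birth F)) {} =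
      of_nat (Suc n) * (birth_op ^^ n) (marked_integral (marked_birth F)) {}"
    by (rule Suc.IH[OF marked_birth_marked[OF Suc.prems]])
  also have "(birth_op ^^ n) (marked_integral (marked_birth F)) {} = (birth_op ^^ n) (birth_op (marked_integral F)) {}"
    using Suc.prems by (intro birth_iterate_cong marked_integral_marked_birth) auto
  also have "\<dots> = (birth_op ^^ Suc n) (marked_integral F) {}"
    by (simp only: funpow_Suc_right comp_def)
  finally show ?case by (simp add: distrib_right)
qed

lemma GNZ_equation:
  assumes F: "marked F"
  shows "(\<integral>\<^sup>+\<eta>. marked_sum F \<eta> \<partial>\<mu>) = (\<integral>\<^sup>+\<eta>. marked_integral F \<eta> \<partial>\<mu>)"
proof -
  have "gibbs_sum (marked_sum F) = (\<Sum>n. ennreal (1 / fact (Suc n)) * (birth_op ^^ Suc n) (marked_sum F) {})"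
    unfolding gibbs_sum_def
    using suminf_offset[of "\<lambda>n. ennreal (1 / fact n) * (birth_op ^^ n) (marked_sum F) {}" 1]
    by (simp add: marked_sum_def[of F "{}"] del: funpow.simps fact_Suc)
  also have "\<dots> = gibbs_sum (marked_integral F)"
    unfolding gibbs_sum_def
  proof (intro suminf_cong)
    fix n :: nat
    \<comment> \<open>The number of choices for the marked point lowers the factorial and realigns
      the two series.\<close>
    have "ennreal (1 / fact (Suc n)) * of_nat (Suc n) = ennreal (1 / fact n)"
      by (simp add: ennreal_of_nat_eq_real_of_nat field_simps flip: ennreal_mult' del: of_nat_Suc)
    then show "ennreal (1 / fact (Suc n)) * (birth_op ^^ Suc n) (marked_sum F) {} =
        ennreal (1 / fact n) * (birth_op ^^ n) (marked_integral F) {}"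
      unfolding birth_iterate_marked_sum[OF F] by (simp only: mult.assoc[symmetric])
  qed
  finally show ?thesis
    using F by (simp add: nn_integral_\<mu> marked_sum_measurable marked_integral_measurable)
qed

end

section \<open>Decay of the variance\<close>

text \<open>The mean value inequality bounds all difference quotients by W, so dominated convergence
  applies. Derivatives are taken within the interval, which makes them one-sided at its
  ends.\<close>

lemma has_real_derivative_integral:
  fixes h h' :: "real \<Rightarrow> 'b \<Rightarrow> real"
  assumes der: "\<And>t \<eta>. t \<in> {a..b} \<Longrightarrow> \<eta> \<in> space M \<Longrightarrow>
      ((\<lambda>t. h t \<eta>) has_real_derivative h' t \<eta>) (at t within {a..b})"
    and int: "\<And>t. t \<in> {a..b} \<Longrightarrow> integrable M (h t)"
    and meas: "\<And>t. t \<in> {a..b} \<Longrightarrow> h' t \<in> borel_measurable M"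
    and bound: "\<And>t \<eta>. t \<in> {a..b} \<Longrightarrow> \<eta> \<in> space M \<Longrightarrow> \<bar>h' t \<eta>\<bar> \<le> W \<eta>"
    and W: "integrable M W" and t: "t \<in> {a..b}"
  shows "((\<lambda>t. \<integral>\<eta>. h t \<eta> \<partial>M) has_real_derivative (\<integral>\<eta>. h' t \<eta> \<partial>M)) (at t within {a..b})"
  unfolding has_field_derivative_iff tendsto_at_iff_sequentially
proof (intro allI impI)
  fix X assume X: "\<forall>i. X i \<in> {a..b} - {t}" "X \<longlonglongrightarrow> t"
  let ?q = "\<lambda>i \<eta>. (h (X i) \<eta> - h t \<eta>) / (X i - t)"
  have lim: "(\<lambda>i. \<integral>\<eta>. ?q i \<eta> \<partial>M) \<longlonglongrightarrow> (\<integral>\<eta>. h' t \<eta> \<partial>M)"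
  proof (rule integral_dominated_convergence[where w = W])
    show "?q i \<in> borel_measurable M" for i
      using int X(1) t by (auto intro!: borel_measurable_divide borel_measurable_diff
          borel_measurable_integrable)
    show "AE \<eta> in M. (\<lambda>i. ?q i \<eta>) \<longlonglongrightarrow> h' t \<eta>"
    proof (rule AE_I2)
      fix \<eta> assume "\<eta> \<in> space M"
      from der[OF t this] X show "(\<lambda>i. ?q i \<eta>) \<longlonglongrightarrow> h' t \<eta>"
        unfolding has_field_derivative_iff tendsto_at_iff_sequentially by (auto simp: comp_def)
    qed
    show "AE \<eta> in M. norm (?q i \<eta>) \<le> W \<eta>" for i
    proof (rule AE_I2)
      fix \<eta> assume \<eta>: "\<eta> \<in> space M"
      have "norm (h (X i) \<eta> - h t \<eta>) \<le> W \<eta> * norm (X i - t)"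
        using der[OF _ \<eta>] bound[OF _ \<eta>] X(1) t
        by (intro field_differentiable_bound[where S = "{a..b}"]) auto
      moreover have "0 < norm (X i - t)" using X(1) by auto
      ultimately show "norm (?q i \<eta>) \<le> W \<eta>" by (simp add: norm_divide divide_le_eq)
    qed
  qed (use meas[OF t] W in auto)
  have quot: "(\<integral>\<eta>. ?q i \<eta> \<partial>M) = ((\<integral>\<eta>. h (X i) \<eta> \<partial>M) - (\<integral>\<eta>. h t \<eta> \<partial>M)) / (X i - t)" for i
    using int X(1) t by simp
  show "((\<lambda>y. ((\<integral>\<eta>. h y \<eta> \<partial>M) - (\<integral>\<eta>. h t \<eta> \<partial>M)) / (y - t)) \<circ> X) \<longlonglongrightarrow> (\<integral>\<eta>. h' t \<eta> \<partial>M)"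
    using lim unfolding quot by (simp only: comp_def)
qed

context glauber begin

text \<open>With F = 1 the GNZ equation equates the mean number of points with the mean total birth
  rate. The exit rate is unbounded, and its integrability provides the majorant for differentiating
  under \<mu>.\<close>

lemma r_nn_integral: "(\<integral>\<^sup>+\<eta>. ennreal (r \<eta>) \<partial>\<mu>) \<le> ennreal (2 * (lam * vol))"
proof -
  interpret P: prob_space \<mu> by (rule prob_space_\<mu>)
  have B: "(\<integral>\<^sup>+\<eta>. birth_op (\<lambda>_. 1) \<eta> \<partial>\<mu>) \<le> ennreal (lam * vol)"
  proof -
    have "(\<integral>\<^sup>+\<eta>. birth_op (\<lambda>_. 1) \<eta> \<partial>\<mu>) \<le> (\<integral>\<^sup>+\<eta>. ennreal (lam * vol) \<partial>\<mu>)"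
      by (intro nn_integral_mono birth_op_1_le)
    then show ?thesis by (simp add: P.emeasure_space_1[simplified])
  qed
  have m: "marked (\<lambda>_ _. 1)" by (simp add: marked_def)
  have "(\<integral>\<^sup>+\<eta>. ennreal (r \<eta>) \<partial>\<mu>) = (\<integral>\<^sup>+\<eta>. marked_sum (\<lambda>_ _. 1) \<eta> + birth_op (\<lambda>_. 1) \<eta> \<partial>\<mu>)"
    by (intro nn_integral_cong) (simp add: r_eq jump_op_def marked_sum_def)
  also have "\<dots> = (\<integral>\<^sup>+\<eta>. marked_sum (\<lambda>_ _. 1) \<eta> \<partial>\<mu>) + (\<integral>\<^sup>+\<eta>. birth_op (\<lambda>_. 1) \<eta> \<partial>\<mu>)"
    using marked_sum_measurable[OF m] birth_op_measurable_C[of "\<lambda>_. 1"]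
    by (intro nn_integral_add) (auto cong: measurable_cong_sets)
  also have "(\<integral>\<^sup>+\<eta>. marked_sum (\<lambda>_ _. 1) \<eta> \<partial>\<mu>) = (\<integral>\<^sup>+\<eta>. birth_op (\<lambda>_. 1) \<eta> \<partial>\<mu>)"
    unfolding GNZ_equation[OF m] unfolding marked_integral_def[abs_def] birth_op_def by simp
  also have "\<dots> + \<dots> \<le> ennreal (lam * vol) + ennreal (lam * vol)" by (intro add_mono B)
  finally show ?thesis using lam_nonneg by (simp flip: ennreal_plus)
qed

lemma r_integrable: "integrable \<mu> r"
proof (rule integrableI_nonneg)
  have "r \<in> borel_measurable C" by (rule r_measurable[where h = "\<lambda>\<eta>. \<eta>"]) simp
  then show "r \<in> borel_measurable \<mu>" by (simp cong: measurable_cong_sets)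
  show "(\<integral>\<^sup>+\<eta>. ennreal (r \<eta>) \<partial>\<mu>) < \<infinity>"
    using le_less_trans[OF r_nn_integral ennreal_less_top] by simp
qed (simp add: r_nonneg)

text \<open>GNZ turns the births into deaths. The resulting sum is symmetric in v and g, so this is
  reversibility, stated for nonnegative functions to keep integrability out of it.\<close>

lemma nn_integral_mult_jump_op:
  assumes v: "v \<in> borel_measurable C" and g: "g \<in> borel_measurable C"
  shows "(\<integral>\<^sup>+\<eta>. v \<eta> * jump_op g \<eta> \<partial>\<mu>) =
    (\<integral>\<^sup>+\<eta>. (\<Sum>x\<in>\<eta>. v \<eta> * g (\<eta> - {x}) + v (\<eta> - {x}) * g \<eta>) \<partial>\<mu>)"
proof -
  define F where "F x \<eta> = v (insert x \<eta>) * g \<eta>" for x \<eta>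
  define G where "G x \<eta> = v \<eta> * g (insert x \<eta>)" for x \<eta>
  have ins: "(\<lambda>p. insert (fst p) (snd p)) \<in> points \<Lambda> \<Otimes>\<^sub>M C \<rightarrow>\<^sub>M C" by measurable
  have snd: "snd \<in> points \<Lambda> \<Otimes>\<^sub>M C \<rightarrow>\<^sub>M C" by measurable
  have F: "marked F" and G: "marked G"
    unfolding marked_def F_def G_def
    using measurable_compose[OF ins v] measurable_compose[OF ins g]
      measurable_compose[OF snd v] measurable_compose[OF snd g]
    by (auto intro!: borel_measurable_times_ennreal)
  have b': "birth_op g \<in> borel_measurable C" by (rule birth_op_measurable_C[OF g])
  have "(\<integral>\<^sup>+\<eta>. v \<eta> * jump_op g \<eta> \<partial>\<mu>) = (\<integral>\<^sup>+\<eta>. marked_sum F \<eta> + marked_integral G \<eta> \<partial>\<mu>)"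
  proof (intro nn_integral_cong)
    fix \<eta> assume "\<eta> \<in> space \<mu>"
    then have \<eta>: "\<eta> \<in> conf_sets \<Lambda>" by simp
    have "marked_sum F \<eta> = v \<eta> * (\<Sum>x\<in>\<eta>. g (\<eta> - {x}))"
      unfolding marked_sum_def sum_distrib_left by (intro sum.cong) (auto simp: F_def insert_absorb)
    moreover have "marked_integral G \<eta> = v \<eta> * birth_op g \<eta>"
      unfolding marked_integral_def birth_op_def G_def
      using measurable_insert_L[OF \<eta> g] b_measurable_L[OF \<eta>]
      by (subst nn_integral_cmult[symmetric]) (auto simp: mult.left_commute)
    ultimately show "v \<eta> * jump_op g \<eta> = marked_sum F \<eta> + marked_integral G \<eta>"
      by (simp add: jump_op_def distrib_left)
  qed
  also have "\<dots> = (\<integral>\<^sup>+\<eta>. marked_sum F \<eta> \<partial>\<mu>) + (\<integral>\<^sup>+\<eta>. marked_sum G \<eta> \<partial>\<mu>)"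
    unfolding GNZ_equation[OF G]
    using marked_sum_measurable[OF F] marked_integral_measurable[OF G]
    by (intro nn_integral_add) (auto cong: measurable_cong_sets)
  also have "\<dots> = (\<integral>\<^sup>+\<eta>. marked_sum F \<eta> + marked_sum G \<eta> \<partial>\<mu>)"
    using marked_sum_measurable[OF F] marked_sum_measurable[OF G]
    by (intro nn_integral_add[symmetric]) (auto cong: measurable_cong_sets)
  also have "\<dots> = (\<integral>\<^sup>+\<eta>. (\<Sum>x\<in>\<eta>. v \<eta> * g (\<eta> - {x}) + v (\<eta> - {x}) * g \<eta>) \<partial>\<mu>)"
    unfolding marked_sum_def sum.distrib[symmetric] F_def G_def
    by (intro nn_integral_cong sum.cong) (auto simp: insert_absorb)
  finally show ?thesis .
qed

end

locale observable = glauber \<Lambda> lam \<phi> for \<Lambda> :: "'a::euclidean_space set" and lam \<phi> +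
  fixes f :: "'a set \<Rightarrow> ennreal"
  assumes f_measurable: "f \<in> borel_measurable (conf_space \<Lambda>)"
    and f_le_1: "\<And>\<eta>. \<eta> \<in> conf_sets \<Lambda> \<Longrightarrow> f \<eta> \<le> 1"
begin

definition U :: "real \<Rightarrow> 'a set \<Rightarrow> real" where
  "U t \<eta> = enn2real (law f t \<eta>)"

text \<open>The jump part of the generator applied to \<open>U t\<close>; the time derivative of U
  will be KU - r U.\<close>

definition KU :: "real \<Rightarrow> 'a set \<Rightarrow> real" where
  "KU t \<eta> = enn2real (jump_op (law f t) \<eta>)"

lemma law_C_measurable: "law f t \<in> borel_measurable C"
  by (rule measurable_section[OF law_measurable[OF f_measurable]])

lemma U_measurable: "U t \<in> borel_measurable C"
  unfolding U_def[abs_def] using law_C_measurable by measurable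

lemma KU_measurable: "KU t \<in> borel_measurable C"
proof -
  have "(\<lambda>p. law f t (snd p)) \<in> borel_measurable (C \<Otimes>\<^sub>M C)" using law_C_measurable by measurable
  from jump_op_measurable[OF this, of "\<lambda>\<eta>. \<eta>"] have "jump_op (law f t) \<in> borel_measurable C" by simp
  then show ?thesis unfolding KU_def[abs_def] by measurable
qed

lemma ennreal_U: "0 \<le> t \<Longrightarrow> \<eta> \<in> conf_sets \<Lambda> \<Longrightarrow> ennreal (U t \<eta>) = law f t \<eta>"
  unfolding U_def
  by (intro ennreal_enn2real le_less_trans[OF law_le_1[OF f_measurable f_le_1] ennreal_one_less_top])

lemma U_nonneg: "0 \<le> U t \<eta>"
  by (simp add: U_def)

lemma U_le_1: "0 \<le> t \<Longrightarrow> \<eta> \<in> conf_sets \<Lambda> \<Longrightarrow> U t \<eta> \<le> 1"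
  unfolding U_def using law_le_1[OF f_measurable f_le_1, of t \<eta>]
  by (intro enn2real_leI) auto

lemma jump_op_law_le:
  assumes "0 \<le> t" "\<eta> \<in> conf_sets \<Lambda>" shows "jump_op (law f t) \<eta> \<le> ennreal (r \<eta>)"
  unfolding r_eq[OF assms(2)]
  using law_le_1[OF f_measurable f_le_1 assms(1)] assms(2) by (intro jump_op_mono) auto

lemma ennreal_KU: "0 \<le> t \<Longrightarrow> \<eta> \<in> conf_sets \<Lambda> \<Longrightarrow> ennreal (KU t \<eta>) = jump_op (law f t) \<eta>"
  unfolding KU_def using jump_op_law_le[of t \<eta>]
  by (intro ennreal_enn2real) (meson ennreal_less_top le_less_trans)

lemma KU_nonneg: "0 \<le> KU t \<eta>"
  by (simp add: KU_def)

lemma KU_le: "0 \<le> t \<Longrightarrow> \<eta> \<in> conf_sets \<Lambda> \<Longrightarrow> KU t \<eta> \<le> r \<eta>"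
  unfolding KU_def using jump_op_law_le[of t \<eta>] r_nonneg by (intro enn2real_leI) auto

lemma KU_eq:
  assumes t: "0 \<le> t" and \<eta>: "\<eta> \<in> conf_sets \<Lambda>"
  shows "KU t \<eta> = (\<Sum>x\<in>\<eta>. U t (\<eta> - {x})) + (\<integral>x. b \<eta> x * U t (insert x \<eta>) \<partial>L)"
proof -
  have [measurable]: "(\<lambda>x. U t (insert x \<eta>)) \<in> borel_measurable L"
    by (rule measurable_insert_L[OF \<eta> U_measurable])
  note [measurable] = b_measurable_L[OF \<eta>]
  have int: "integrable L (\<lambda>x. b \<eta> x * U t (insert x \<eta>))"
  proof (rule integrable_const_bound[where B = lam])
    show "AE x in L. norm (b \<eta> x * U t (insert x \<eta>)) \<le> lam"
    proof (rule AE_I2)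
      fix x assume "x \<in> space L"
      then have "b \<eta> x * U t (insert x \<eta>) \<le> lam * 1"
        using b_nonneg b_le U_nonneg U_le_1[OF t] \<eta> lam_nonneg by (intro mult_mono) auto
      then show "norm (b \<eta> x * U t (insert x \<eta>)) \<le> lam" using b_nonneg U_nonneg by simp
    qed
  qed measurable
  have "birth_op (law f t) \<eta> = (\<integral>\<^sup>+x. ennreal (b \<eta> x * U t (insert x \<eta>)) \<partial>L)"
    unfolding birth_op_def using \<eta> t b_nonneg U_nonneg
    by (intro nn_integral_cong) (simp add: ennreal_mult ennreal_U)
  also have "\<dots> = ennreal (\<integral>x. b \<eta> x * U t (insert x \<eta>) \<partial>L)"
    using int b_nonneg U_nonneg by (intro nn_integral_eq_integral) auto
  finally have 1: "birth_op (law f t) \<eta> = \<dots>" .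
  have "(\<Sum>x\<in>\<eta>. law f t (\<eta> - {x})) = (\<Sum>x\<in>\<eta>. ennreal (U t (\<eta> - {x})))"
    using t \<eta> by (intro sum.cong) (auto simp: ennreal_U)
  also have "\<dots> = ennreal (\<Sum>x\<in>\<eta>. U t (\<eta> - {x}))" using U_nonneg by simp
  finally have "jump_op (law f t) \<eta> = ennreal ((\<Sum>x\<in>\<eta>. U t (\<eta> - {x})) + (\<integral>x. b \<eta> x * U t (insert x \<eta>) \<partial>L))"
    unfolding jump_op_def 1 using b_nonneg U_nonneg
    by (simp add: ennreal_plus sum_nonneg integral_nonneg_AE)
  moreover have "0 \<le> (\<Sum>x\<in>\<eta>. U t (\<eta> - {x})) + (\<integral>x. b \<eta> x * U t (insert x \<eta>) \<partial>L)"
    using b_nonneg U_nonneg by (intro add_nonneg_nonneg sum_nonneg integral_nonneg_AE) auto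
  ultimately show ?thesis unfolding KU_def by (simp only: enn2real_ennreal)
qed

lemma KU_time_measurable: "\<eta> \<in> conf_sets \<Lambda> \<Longrightarrow> (\<lambda>s. KU s \<eta>) \<in> borel_measurable borel"
  unfolding KU_def using jump_op_measurable_time[OF law_measurable[OF f_measurable], of \<eta> "\<lambda>s. s" borel]
  by simp

text \<open>Reversing time inside the first-jump integral leaves t only in a prefactor and in the
  upper limit, the form to which the fundamental theorem of calculus applies.\<close>

lemma U_integral_eq:
  assumes t: "0 \<le> t" and \<eta>: "\<eta> \<in> conf_sets \<Lambda>"
  shows "(\<lambda>s. exp (r \<eta> * s) * KU s \<eta>) integrable_on {0..t}" (is "?h integrable_on _")
    and "U t \<eta> = exp (- r \<eta> * t) * (enn2real (f \<eta>) + integral {0..t} (\<lambda>s. exp (r \<eta> * s) * KU s \<eta>))"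
proof -
  note [measurable] = KU_time_measurable[OF \<eta>]
  have nn: "0 \<le> ?h s" for s by (simp add: KU_nonneg)
  have "set_integrable lborel {0..t} ?h"
    unfolding set_integrable_def
  proof (rule integrableI_bounded_set_indicator[where B = "exp (r \<eta> * t) * r \<eta>"])
    show "AE x\<in>{0..t} in lborel. norm (?h x) \<le> exp (r \<eta> * t) * r \<eta>"
      using KU_nonneg KU_le[OF _ \<eta>] r_nonneg
      by (intro AE_I2 impI) (auto simp: abs_mult intro!: mult_mono mult_left_mono)
  qed (use t in auto)
  note int = set_borel_integral_eq_integral[OF this]
  show "?h integrable_on {0..t}" by (rule int(1))
  have "first_jump (law f) t \<eta> =
      (\<integral>\<^sup>+s\<in>{0..t}. ennreal (exp (- r \<eta> * s) * KU (t - s) \<eta>) \<partial>lborel)"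
    unfolding first_jump_def using \<eta>
    by (intro nn_integral_cong) (auto simp: indicator_def ennreal_mult KU_nonneg ennreal_KU)
  also have "\<dots> = (\<integral>\<^sup>+s. ennreal (exp (- r \<eta> * (t + -1 * s)) * KU (t - (t + -1 * s)) \<eta>) *
      indicator {0..t} (t + -1 * s) \<partial>lborel)"
    by (subst nn_integral_real_affine[where c = "-1" and t = t]) auto
  also have "\<dots> = (\<integral>\<^sup>+s. ennreal (exp (- r \<eta> * t) * (?h s * indicator {0..t} s)) \<partial>lborel)"
    by (intro nn_integral_cong) (auto simp: indicator_def algebra_simps simp flip: exp_add)
  also have "\<dots> = ennreal (exp (- r \<eta> * t)) * (\<integral>\<^sup>+s. ennreal (?h s * indicator {0..t} s) \<partial>lborel)"
    by (subst nn_integral_cmult[symmetric]) (auto simp: ennreal_mult nn)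
  also have "(\<integral>\<^sup>+s. ennreal (?h s * indicator {0..t} s) \<partial>lborel) = ennreal (integral {0..t} ?h)"
    using \<open>set_integrable lborel {0..t} ?h\<close> nn unfolding int(2)[symmetric] set_lebesgue_integral_def set_integrable_def
    by (subst nn_integral_eq_integral) (auto simp: mult.commute)
  finally have "law f t \<eta> = ennreal (exp (- r \<eta> * t)) * f \<eta> + ennreal (exp (- r \<eta> * t)) * ennreal (integral {0..t} ?h)"
    by (simp add: law_eq[OF f_measurable \<eta>])
  moreover have "f \<eta> = ennreal (enn2real (f \<eta>))"
    using f_le_1[OF \<eta>] by (metis ennreal_enn2real ennreal_one_less_top le_less_trans)
  moreover have I: "0 \<le> integral {0..t} ?h" using nn int(1) by (intro integral_nonneg) auto
  ultimately have "law f t \<eta> = ennreal (exp (- r \<eta> * t) * (enn2real (f \<eta>) + integral {0..t} ?h))"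
    by (simp add: distrib_left ennreal_mult ennreal_plus)
  then show "U t \<eta> = exp (- r \<eta> * t) * (enn2real (f \<eta>) + integral {0..t} ?h)"
    unfolding U_def using I by simp
qed

section \<open>Differentiability of the semigroup in time\<close>

lemma U_0: "\<eta> \<in> conf_sets \<Lambda> \<Longrightarrow> U 0 \<eta> = enn2real (f \<eta>)"
  using U_integral_eq(2)[of 0 \<eta>] by simp

lemma U_continuous:
  assumes \<eta>: "\<eta> \<in> conf_sets \<Lambda>" and T: "0 \<le> T" shows "continuous_on {0..T} (\<lambda>t. U t \<eta>)"
proof -
  have "continuous_on {0..T} (\<lambda>t. exp (- r \<eta> * t) *
      (enn2real (f \<eta>) + integral {0..t} (\<lambda>s. exp (r \<eta> * s) * KU s \<eta>)))"
    using indefinite_integral_continuous_1[OF U_integral_eq(1)[OF T \<eta>]] by (intro continuous_intros)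
  then show ?thesis by (rule continuous_on_eq) (simp add: U_integral_eq(2)[OF _ \<eta>])
qed

text \<open>A bootstrap: U is continuous as an indefinite integral; dominated convergence with the
  bound lam passes this to the birth integral in KU, and a continuous integrand then makes U
  differentiable.\<close>

lemma KU_continuous:
  assumes \<eta>: "\<eta> \<in> conf_sets \<Lambda>" and T: "0 \<le> T" shows "continuous_on {0..T} (\<lambda>t. KU t \<eta>)"
proof -
  have "continuous_on {0..T} (\<lambda>t. \<integral>x. b \<eta> x * U t (insert x \<eta>) \<partial>L)"
    unfolding continuous_on_sequentially comp_def
  proof (intro allI ballI impI)
    fix X t assume t: "t \<in> {0..T}" and X: "(\<forall>n. X n \<in> {0..T}) \<and> X \<longlonglongrightarrow> t"
    have [measurable]: "(\<lambda>x. U t (insert x \<eta>)) \<in> borel_measurable L" for t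
      by (rule measurable_insert_L[OF \<eta> U_measurable])
    note [measurable] = b_measurable_L[OF \<eta>]
    show "(\<lambda>n. \<integral>x. b \<eta> x * U (X n) (insert x \<eta>) \<partial>L) \<longlonglongrightarrow> (\<integral>x. b \<eta> x * U t (insert x \<eta>) \<partial>L)"
    proof (rule integral_dominated_convergence[where w = "\<lambda>_. lam"])
      show "AE x in L. (\<lambda>n. b \<eta> x * U (X n) (insert x \<eta>)) \<longlonglongrightarrow> b \<eta> x * U t (insert x \<eta>)"
      proof (rule AE_I2)
        fix x assume "x \<in> space L"
        then have "continuous_on {0..T} (\<lambda>t. U t (insert x \<eta>))" using \<eta> T by (intro U_continuous) auto
        then have "(\<lambda>n. U (X n) (insert x \<eta>)) \<longlonglongrightarrow> U t (insert x \<eta>)"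
          using X t unfolding continuous_on_sequentially comp_def by blast
        then show "(\<lambda>n. b \<eta> x * U (X n) (insert x \<eta>)) \<longlonglongrightarrow> b \<eta> x * U t (insert x \<eta>)"
          by (intro tendsto_intros)
      qed
      show "AE x in L. norm (b \<eta> x * U (X n) (insert x \<eta>)) \<le> lam" for n
      proof (rule AE_I2)
        fix x assume "x \<in> space L"
        moreover have "0 \<le> X n" using X by auto
        ultimately have "b \<eta> x * U (X n) (insert x \<eta>) \<le> lam * 1"
          using b_nonneg b_le U_nonneg U_le_1 \<eta> lam_nonneg by (intro mult_mono) auto
        then show "norm (b \<eta> x * U (X n) (insert x \<eta>)) \<le> lam" using b_nonneg U_nonneg by simp
      qed
    qed auto
  qed
  then have "continuous_on {0..T} (\<lambda>t. (\<Sum>x\<in>\<eta>. U t (\<eta> - {x})) + (\<integral>x. b \<eta> x * U t (insert x \<eta>) \<partial>L))"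
    using \<eta> T by (intro continuous_intros U_continuous) auto
  then show ?thesis by (rule continuous_on_eq) (simp add: KU_eq[OF _ \<eta>])
qed

lemma U_has_derivative:
  assumes \<eta>: "\<eta> \<in> conf_sets \<Lambda>" and t: "t \<in> {0..T}"
  shows "((\<lambda>t. U t \<eta>) has_real_derivative KU t \<eta> - r \<eta> * U t \<eta>) (at t within {0..T})"
proof -
  let ?h = "\<lambda>s. exp (r \<eta> * s) * KU s \<eta>"
  let ?I = "\<lambda>t. exp (- r \<eta> * t) * (enn2real (f \<eta>) + integral {0..t} ?h)"
  have T: "0 \<le> T" using t by auto
  have "continuous_on {0..T} ?h" using KU_continuous[OF \<eta> T] by (intro continuous_intros)
  from integral_has_real_derivative[OF this t]
  have "(?I has_real_derivative (exp (- r \<eta> * t) * ?h t - r \<eta> * ?I t)) (at t within {0..T})"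
    by (auto intro!: derivative_eq_intros simp: algebra_simps)
  moreover have "exp (- r \<eta> * t) * ?h t = KU t \<eta>" by (simp add: exp_minus)
  moreover have "?I t = U t \<eta>" using t by (simp add: U_integral_eq(2)[OF _ \<eta>])
  ultimately have "(?I has_real_derivative KU t \<eta> - r \<eta> * U t \<eta>) (at t within {0..T})" by (simp only:)
  then show ?thesis
    by (rule has_field_derivative_transform_within[where d = 1])
      (use t in \<open>auto simp: U_integral_eq(2)[OF _ \<eta>]\<close>)
qed

section \<open>Stationarity, dissipation and decay of the variance\<close>

sublocale P: prob_space \<mu>
  by (rule prob_space_\<mu>)

lemma measurable_\<mu>: "h \<in> borel_measurable C \<Longrightarrow> h \<in> borel_measurable \<mu>"
  by (simp cong: measurable_cong_sets)

lemma integrable_le_r: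
  assumes "h \<in> borel_measurable C" "\<And>\<eta>. \<eta> \<in> conf_sets \<Lambda> \<Longrightarrow> \<bar>h \<eta>\<bar> \<le> c * r \<eta>"
  shows "integrable \<mu> h"
proof (rule Bochner_Integration.integrable_bound)
  show "integrable \<mu> (\<lambda>\<eta>. c * r \<eta>)" using r_integrable by simp
  show "AE \<eta> in \<mu>. norm (h \<eta>) \<le> norm (c * r \<eta>)"
    using assms(2) by (intro AE_I2) (auto intro: order_trans[OF _ abs_ge_self])
qed (rule measurable_\<mu>[OF assms(1)])

lemma r_C_measurable: "r \<in> borel_measurable C"
  by (rule r_measurable[where h = "\<lambda>\<eta>. \<eta>"]) simp

lemma U_integrable: "0 \<le> t \<Longrightarrow> integrable \<mu> (U t)" "0 \<le> t \<Longrightarrow> integrable \<mu> (\<lambda>\<eta>. (U t \<eta>)\<^sup>2)"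
  using measurable_\<mu>[OF U_measurable] U_nonneg U_le_1
  by (auto intro!: P.integrable_const_bound[where B = 1] simp: abs_square_le_1)

lemma KU_integrable: "0 \<le> t \<Longrightarrow> integrable \<mu> (KU t)"
  using KU_measurable KU_nonneg KU_le by (intro integrable_le_r[where c = 1]) auto

lemma rU_integrable: "0 \<le> t \<Longrightarrow> integrable \<mu> (\<lambda>\<eta>. r \<eta> * U t \<eta>)"
  using r_C_measurable U_measurable r_nonneg U_nonneg U_le_1
  by (intro integrable_le_r[where c = 1] borel_measurable_times) (auto simp: mult_left_le)

text \<open>Stationarity of \<mu>, obtained from the symmetry of
  \<open>nn_integral_mult_jump_op\<close> with one of the two functions constant.\<close>

lemma integral_generator_U:
  assumes t: "0 \<le> t" shows "(\<integral>\<eta>. KU t \<eta> - r \<eta> * U t \<eta> \<partial>\<mu>) = 0"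
proof -
  have "(\<integral>\<^sup>+\<eta>. 1 * jump_op (law f t) \<eta> \<partial>\<mu>) = (\<integral>\<^sup>+\<eta>. law f t \<eta> * jump_op (\<lambda>_. 1) \<eta> \<partial>\<mu>)"
    using law_C_measurable by (subst (1 2) nn_integral_mult_jump_op) (auto simp: add.commute)
  moreover have "(\<integral>\<^sup>+\<eta>. 1 * jump_op (law f t) \<eta> \<partial>\<mu>) = (\<integral>\<^sup>+\<eta>. ennreal (KU t \<eta>) \<partial>\<mu>)"
    using t by (intro nn_integral_cong) (simp add: ennreal_KU)
  moreover have "(\<integral>\<^sup>+\<eta>. law f t \<eta> * jump_op (\<lambda>_. 1) \<eta> \<partial>\<mu>) = (\<integral>\<^sup>+\<eta>. ennreal (r \<eta> * U t \<eta>) \<partial>\<mu>)"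
    using t by (intro nn_integral_cong) (simp add: r_eq[symmetric] ennreal_U[symmetric] ennreal_mult r_nonneg U_nonneg mult.commute)
  ultimately have "ennreal (\<integral>\<eta>. KU t \<eta> \<partial>\<mu>) = ennreal (\<integral>\<eta>. r \<eta> * U t \<eta> \<partial>\<mu>)"
    using KU_integrable[OF t] rU_integrable[OF t] KU_nonneg r_nonneg U_nonneg
    by (simp add: nn_integral_eq_integral)
  then show ?thesis
    using KU_integrable[OF t] rU_integrable[OF t] KU_nonneg r_nonneg U_nonneg
    by (simp add: integral_nonneg_AE)
qed

lemma sum_pairs_measurable:
  fixes G :: "real \<Rightarrow> real \<Rightarrow> real"
  assumes G: "(\<lambda>p. G (fst p) (snd p)) \<in> borel_measurable (borel \<Otimes>\<^sub>M borel)"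
  shows "(\<lambda>\<eta>. \<Sum>x\<in>\<eta>. ennreal (G (U t (\<eta> - {x})) (U t \<eta>))) \<in> borel_measurable C"
proof -
  have "marked (\<lambda>x \<eta>. ennreal (G (U t \<eta>) (U t (insert x \<eta>))))"
  proof -
    have ins: "(\<lambda>p. insert (fst p) (snd p)) \<in> points \<Lambda> \<Otimes>\<^sub>M C \<rightarrow>\<^sub>M C" by measurable
    have snd: "snd \<in> points \<Lambda> \<Otimes>\<^sub>M C \<rightarrow>\<^sub>M C" by measurable
    have "(\<lambda>p. (U t (snd p), U t (insert (fst p) (snd p)))) \<in> points \<Lambda> \<Otimes>\<^sub>M C \<rightarrow>\<^sub>M borel \<Otimes>\<^sub>M borel"
      by (intro measurable_Pair measurable_compose[OF ins U_measurable] measurable_compose[OF snd U_measurable])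
    from measurable_compose[OF this G] show ?thesis unfolding marked_def by simp
  qed
  from marked_sum_measurable[OF this] show ?thesis
    by (simp add: marked_sum_def[abs_def] insert_absorb cong: sum.cong)
qed

lemma sum_square_diff_measurable: "(\<lambda>\<eta>. \<Sum>x\<in>\<eta>. (U t (\<eta> - {x}) - U t \<eta>)\<^sup>2) \<in> borel_measurable C"
proof -
  have "(\<lambda>\<eta>. enn2real (\<Sum>x\<in>\<eta>. ennreal ((U t (\<eta> - {x}) - U t \<eta>)\<^sup>2))) \<in> borel_measurable C"
    by (intro measurable_compose[OF sum_pairs_measurable borel_measurable_enn2real]) measurable
  then show ?thesis by (simp add: sum_nonneg)
qed

text \<open>The square identity (a - b)^2 + 2 a b = a^2 + b^2, summed over all deaths. The mixed
  term is the reversible pairing of U with itself, and the squares are the pairing of U^2 with 1,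
  which brings in r. Everything is added in \<open>ennreal\<close>; subtraction happens only after
  passing to real integrals.\<close>

lemma integral_U_generator_U:
  assumes t: "0 \<le> t"
  shows "(\<integral>\<eta>. U t \<eta> * (KU t \<eta> - r \<eta> * U t \<eta>) \<partial>\<mu>) = - dirichlet_form \<mu> (U t)"
proof -
  let ?e = "\<lambda>\<eta>. \<Sum>x\<in>\<eta>. (U t (\<eta> - {x}) - U t \<eta>)\<^sup>2"
  have e_int: "integrable \<mu> ?e"
  proof (rule integrable_le_r[OF sum_square_diff_measurable, where c = 1])
    fix \<eta> assume \<eta>: "\<eta> \<in> conf_sets \<Lambda>"
    have "?e \<eta> \<le> (\<Sum>x\<in>\<eta>. 1)"
    proof (rule sum_mono)
      fix x
      have "\<bar>U t (\<eta> - {x}) - U t \<eta>\<bar> \<le> 1"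
        using U_nonneg[of t \<eta>] U_nonneg[of t "\<eta> - {x}"] U_le_1[OF t \<eta>] U_le_1[OF t, of "\<eta> - {x}"] \<eta> by auto
      then show "(U t (\<eta> - {x}) - U t \<eta>)\<^sup>2 \<le> 1" by (simp add: abs_square_le_1)
    qed
    also have "\<dots> \<le> r \<eta>" by (simp add: exit_rate_def b_nonneg integral_nonneg_AE)
    finally show "\<bar>?e \<eta>\<bar> \<le> 1 * r \<eta>" by (simp add: sum_nonneg)
  qed
  have UK_int: "integrable \<mu> (\<lambda>\<eta>. U t \<eta> * KU t \<eta>)"
  proof (rule integrable_le_r[where c = 1])
    show "(\<lambda>\<eta>. U t \<eta> * KU t \<eta>) \<in> borel_measurable C"
      using U_measurable KU_measurable by (rule borel_measurable_times)
    fix \<eta> assume \<eta>: "\<eta> \<in> conf_sets \<Lambda>"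
    then show "\<bar>U t \<eta> * KU t \<eta>\<bar> \<le> 1 * r \<eta>"
      using mult_mono[OF U_le_1[OF t \<eta>] KU_le[OF t \<eta>]] U_nonneg KU_nonneg by simp
  qed
  have rU_int: "integrable \<mu> (\<lambda>\<eta>. r \<eta> * (U t \<eta>)\<^sup>2)"
  proof (rule integrable_le_r[where c = 1])
    show "(\<lambda>\<eta>. r \<eta> * (U t \<eta>)\<^sup>2) \<in> borel_measurable C"
      using r_C_measurable U_measurable by (intro borel_measurable_times borel_measurable_power)
    fix \<eta> assume \<eta>: "\<eta> \<in> conf_sets \<Lambda>"
    then show "\<bar>r \<eta> * (U t \<eta>)\<^sup>2\<bar> \<le> 1 * r \<eta>"
      using r_nonneg U_le_1[OF t \<eta>] U_nonneg[of t \<eta>] by (simp add: mult_left_le power_le_one)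
  qed
  have sq: "law f t \<eta> * law f t \<eta> = ennreal ((U t \<eta>)\<^sup>2)" if "\<eta> \<in> conf_sets \<Lambda>" for \<eta>
    using ennreal_U[OF t that] by (simp add: power2_eq_square ennreal_mult U_nonneg)
  have "(\<integral>\<^sup>+\<eta>. ennreal (?e \<eta>) \<partial>\<mu>) + (\<integral>\<^sup>+\<eta>. ennreal (U t \<eta> * KU t \<eta>) \<partial>\<mu>) =
      (\<integral>\<^sup>+\<eta>. ennreal (r \<eta> * (U t \<eta>)\<^sup>2) \<partial>\<mu>)"
  proof -
    have "(\<integral>\<^sup>+\<eta>. ennreal (U t \<eta> * KU t \<eta>) \<partial>\<mu>) = (\<integral>\<^sup>+\<eta>. law f t \<eta> * jump_op (law f t) \<eta> \<partial>\<mu>)"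
      using t by (intro nn_integral_cong) (simp add: ennreal_mult U_nonneg KU_nonneg ennreal_U ennreal_KU)
    also have "\<dots> = (\<integral>\<^sup>+\<eta>. (\<Sum>x\<in>\<eta>. law f t \<eta> * law f t (\<eta> - {x}) + law f t (\<eta> - {x}) * law f t \<eta>) \<partial>\<mu>)"
      using law_C_measurable by (intro nn_integral_mult_jump_op)
    also have "\<dots> = (\<integral>\<^sup>+\<eta>. ennreal (\<Sum>x\<in>\<eta>. 2 * U t \<eta> * U t (\<eta> - {x})) \<partial>\<mu>)"
    proof (intro nn_integral_cong)
      fix \<eta> assume "\<eta> \<in> space \<mu>"
      then have \<eta>: "\<eta> \<in> conf_sets \<Lambda>" by simp
      have "(\<Sum>x\<in>\<eta>. law f t \<eta> * law f t (\<eta> - {x}) + law f t (\<eta> - {x}) * law f t \<eta>) =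
          (\<Sum>x\<in>\<eta>. ennreal (2 * U t \<eta> * U t (\<eta> - {x})))"
      proof (rule sum.cong)
        fix x
        have "law f t \<eta> * law f t (\<eta> - {x}) = ennreal (U t \<eta> * U t (\<eta> - {x}))"
          using ennreal_U[OF t \<eta>] ennreal_U[OF t, of "\<eta> - {x}"] \<eta> by (simp add: ennreal_mult U_nonneg)
        then show "law f t \<eta> * law f t (\<eta> - {x}) + law f t (\<eta> - {x}) * law f t \<eta> = ennreal (2 * U t \<eta> * U t (\<eta> - {x}))"
          by (simp add: mult.commute[of "law f t (\<eta> - {x})"] U_nonneg flip: ennreal_plus) 
      qed simp
      then show "(\<Sum>x\<in>\<eta>. law f t \<eta> * law f t (\<eta> - {x}) + law f t (\<eta> - {x}) * law f t \<eta>) =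
          ennreal (\<Sum>x\<in>\<eta>. 2 * U t \<eta> * U t (\<eta> - {x}))" by (simp add: U_nonneg)
    qed
    finally have "(\<integral>\<^sup>+\<eta>. ennreal (?e \<eta>) \<partial>\<mu>) + (\<integral>\<^sup>+\<eta>. ennreal (U t \<eta> * KU t \<eta>) \<partial>\<mu>) =
        (\<integral>\<^sup>+\<eta>. ennreal (?e \<eta>) \<partial>\<mu>) + (\<integral>\<^sup>+\<eta>. ennreal (\<Sum>x\<in>\<eta>. 2 * U t \<eta> * U t (\<eta> - {x})) \<partial>\<mu>)" by simp
    also have "\<dots> = (\<integral>\<^sup>+\<eta>. ennreal (\<Sum>x\<in>\<eta>. 2 * U t \<eta> * U t (\<eta> - {x})) + ennreal (?e \<eta>) \<partial>\<mu>)"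
    proof (subst add.commute, rule nn_integral_add[symmetric])
      have "(\<lambda>\<eta>. \<Sum>x\<in>\<eta>. ennreal (2 * U t \<eta> * U t (\<eta> - {x}))) \<in> borel_measurable C"
        by (rule sum_pairs_measurable[where G = "\<lambda>a b. 2 * b * a"]) measurable
      then show "(\<lambda>\<eta>. ennreal (\<Sum>x\<in>\<eta>. 2 * U t \<eta> * U t (\<eta> - {x}))) \<in> borel_measurable \<mu>"
        by (intro measurable_\<mu>) (simp add: U_nonneg)
      show "(\<lambda>\<eta>. ennreal (?e \<eta>)) \<in> borel_measurable \<mu>"
        using measurable_\<mu>[OF sum_square_diff_measurable] by measurable
    qed
    \<comment> \<open>The factors 1 bring the sum into the shape of
      \<open>nn_integral_mult_jump_op\<close> with v the square and g = 1.\<close>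
    also have "\<dots> = (\<integral>\<^sup>+\<eta>. (\<Sum>x\<in>\<eta>. law f t \<eta> * law f t \<eta> * 1 + law f t (\<eta> - {x}) * law f t (\<eta> - {x}) * 1) \<partial>\<mu>)"
    proof (intro nn_integral_cong)
      fix \<eta> assume "\<eta> \<in> space \<mu>"
      then have \<eta>: "\<eta> \<in> conf_sets \<Lambda>" by simp
      have "ennreal (\<Sum>x\<in>\<eta>. 2 * U t \<eta> * U t (\<eta> - {x})) + ennreal (?e \<eta>)
          = ennreal (\<Sum>x\<in>\<eta>. 2 * U t \<eta> * U t (\<eta> - {x}) + (U t (\<eta> - {x}) - U t \<eta>)\<^sup>2)"
        unfolding sum.distrib by (intro ennreal_plus[symmetric] sum_nonneg) (auto simp: U_nonneg)
      also have "\<dots> = ennreal (\<Sum>x\<in>\<eta>. (U t \<eta>)\<^sup>2 + (U t (\<eta> - {x}))\<^sup>2)"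
        by (intro arg_cong[where f = ennreal] sum.cong) (auto simp: power2_eq_square algebra_simps)
      also have "\<dots> = (\<Sum>x\<in>\<eta>. ennreal ((U t \<eta>)\<^sup>2 + (U t (\<eta> - {x}))\<^sup>2))"
        by (intro sum_ennreal[symmetric]) auto
      also have "\<dots> = (\<Sum>x\<in>\<eta>. law f t \<eta> * law f t \<eta> * 1 + law f t (\<eta> - {x}) * law f t (\<eta> - {x}) * 1)"
        using \<eta> by (intro sum.cong) (auto simp: sq)
      finally show "ennreal (\<Sum>x\<in>\<eta>. 2 * U t \<eta> * U t (\<eta> - {x})) + ennreal (?e \<eta>) = \<dots>" .
    qed
    also have "\<dots> = (\<integral>\<^sup>+\<eta>. (law f t \<eta> * law f t \<eta>) * jump_op (\<lambda>_. 1) \<eta> \<partial>\<mu>)"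
      using law_C_measurable by (intro nn_integral_mult_jump_op[symmetric]) auto
    also have "\<dots> = (\<integral>\<^sup>+\<eta>. ennreal (r \<eta> * (U t \<eta>)\<^sup>2) \<partial>\<mu>)"
      by (intro nn_integral_cong) (simp add: sq r_eq[symmetric] ennreal_mult r_nonneg mult.commute)
    finally show ?thesis .
  qed
  then have "ennreal ((\<integral>\<eta>. ?e \<eta> \<partial>\<mu>) + (\<integral>\<eta>. U t \<eta> * KU t \<eta> \<partial>\<mu>)) = ennreal (\<integral>\<eta>. r \<eta> * (U t \<eta>)\<^sup>2 \<partial>\<mu>)"
    using e_int UK_int rU_int U_nonneg KU_nonneg r_nonneg
    by (simp add: nn_integral_eq_integral sum_nonneg ennreal_plus integral_nonneg_AE)
  then have "(\<integral>\<eta>. ?e \<eta> \<partial>\<mu>) + (\<integral>\<eta>. U t \<eta> * KU t \<eta> \<partial>\<mu>) = (\<integral>\<eta>. r \<eta> * (U t \<eta>)\<^sup>2 \<partial>\<mu>)"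
    using U_nonneg KU_nonneg r_nonneg
    by (subst (asm) ennreal_inj) (auto intro!: integral_nonneg_AE add_nonneg_nonneg simp: sum_nonneg)
  moreover have "(\<integral>\<eta>. U t \<eta> * (KU t \<eta> - r \<eta> * U t \<eta>) \<partial>\<mu>) =
      (\<integral>\<eta>. U t \<eta> * KU t \<eta> \<partial>\<mu>) - (\<integral>\<eta>. r \<eta> * (U t \<eta>)\<^sup>2 \<partial>\<mu>)"
    using UK_int rU_int by (simp flip: Bochner_Integration.integral_diff add: power2_eq_square algebra_simps)
  ultimately show ?thesis by (simp add: dirichlet_form_def)
qed

lemma U_mean:
  assumes T: "0 \<le> T" shows "(\<integral>\<eta>. U T \<eta> \<partial>\<mu>) = (\<integral>\<eta>. U 0 \<eta> \<partial>\<mu>)"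
proof -
  have "((\<lambda>t. \<integral>\<eta>. U t \<eta> \<partial>\<mu>) has_real_derivative 0) (at t within {0..T})" if t: "t \<in> {0..T}" for t
  proof -
    have "((\<lambda>t. \<integral>\<eta>. U t \<eta> \<partial>\<mu>) has_real_derivative (\<integral>\<eta>. KU t \<eta> - r \<eta> * U t \<eta> \<partial>\<mu>)) (at t within {0..T})"
    proof (rule has_real_derivative_integral[OF _ _ _ _ r_integrable t])
      fix t \<eta> assume *: "t \<in> {0..T}" "\<eta> \<in> space \<mu>"
      then show "((\<lambda>t. U t \<eta>) has_real_derivative KU t \<eta> - r \<eta> * U t \<eta>) (at t within {0..T})"
        by (intro U_has_derivative) auto
      have "0 \<le> r \<eta> * U t \<eta>" "r \<eta> * U t \<eta> \<le> r \<eta>"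
        using * r_nonneg U_nonneg U_le_1 by (auto simp: mult_left_le)
      then show "\<bar>KU t \<eta> - r \<eta> * U t \<eta>\<bar> \<le> r \<eta>"
        using * KU_nonneg[of t \<eta>] KU_le[of t \<eta>] by auto
    next
      fix t assume "t \<in> {0..T}"
      then show "integrable \<mu> (U t)" by (auto intro: U_integrable)
      show "(\<lambda>\<eta>. KU t \<eta> - r \<eta> * U t \<eta>) \<in> borel_measurable \<mu>"
        using KU_measurable r_C_measurable U_measurable
        by (intro measurable_\<mu> borel_measurable_diff borel_measurable_times)
    qed
    then show ?thesis using integral_generator_U[of t] t by simp
  qed
  from has_field_derivative_zero_constant[OF _ this] obtain c where "\<And>t. t \<in> {0..T} \<Longrightarrow> (\<integral>\<eta>. U t \<eta> \<partial>\<mu>) = c"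
    by auto
  then show ?thesis using T by simp
qed

lemma U_square_has_derivative:
  assumes t: "t \<in> {0..T}"
  shows "((\<lambda>t. \<integral>\<eta>. (U t \<eta>)\<^sup>2 \<partial>\<mu>) has_real_derivative - 2 * dirichlet_form \<mu> (U t)) (at t within {0..T})"
proof -
  have "((\<lambda>t. \<integral>\<eta>. (U t \<eta>)\<^sup>2 \<partial>\<mu>) has_real_derivative
      (\<integral>\<eta>. 2 * (U t \<eta> * (KU t \<eta> - r \<eta> * U t \<eta>)) \<partial>\<mu>)) (at t within {0..T})"
  proof (rule has_real_derivative_integral[where W = "\<lambda>\<eta>. 2 * r \<eta>", OF _ _ _ _ _ t])
    fix t \<eta> assume *: "t \<in> {0..T}" "\<eta> \<in> space \<mu>"
    then have "((\<lambda>t. U t \<eta>) has_real_derivative KU t \<eta> - r \<eta> * U t \<eta>) (at t within {0..T})"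
      by (intro U_has_derivative) auto
    then show "((\<lambda>t. (U t \<eta>)\<^sup>2) has_real_derivative 2 * (U t \<eta> * (KU t \<eta> - r \<eta> * U t \<eta>))) (at t within {0..T})"
      by (auto intro!: derivative_eq_intros)
    have "0 \<le> r \<eta> * U t \<eta>" "r \<eta> * U t \<eta> \<le> r \<eta>"
      using * r_nonneg U_nonneg U_le_1 by (auto simp: mult_left_le)
    then have "\<bar>KU t \<eta> - r \<eta> * U t \<eta>\<bar> \<le> r \<eta>"
      using * KU_nonneg[of t \<eta>] KU_le[of t \<eta>] by auto
    then have "\<bar>U t \<eta>\<bar> * \<bar>KU t \<eta> - r \<eta> * U t \<eta>\<bar> \<le> 1 * r \<eta>"
      using * U_nonneg U_le_1 by (intro mult_mono) auto
    then show "\<bar>2 * (U t \<eta> * (KU t \<eta> - r \<eta> * U t \<eta>))\<bar> \<le> 2 * r \<eta>" by (simp add: abs_mult)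
  next
    fix t assume "t \<in> {0..T}"
    then show "integrable \<mu> (\<lambda>\<eta>. (U t \<eta>)\<^sup>2)" by (auto intro: U_integrable)
    show "(\<lambda>\<eta>. 2 * (U t \<eta> * (KU t \<eta> - r \<eta> * U t \<eta>))) \<in> borel_measurable \<mu>"
      using KU_measurable r_C_measurable U_measurable
      by (intro measurable_\<mu> borel_measurable_diff borel_measurable_times borel_measurable_const)
  next
    show "integrable \<mu> (\<lambda>\<eta>. 2 * r \<eta>)" using r_integrable by simp
  qed
  moreover have "(\<integral>\<eta>. 2 * (U t \<eta> * (KU t \<eta> - r \<eta> * U t \<eta>)) \<partial>\<mu>) = - 2 * dirichlet_form \<mu> (U t)"
    using integral_U_generator_U[of t] t by simp
  ultimately show ?thesis by simp
qed

text \<open>Gronwall: by the Poincare inequality exp (2 \<gamma> t) times the variance is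
  nonincreasing. The 1 / 4 bounds the initial variance of a function with values in [0, 1].\<close>

lemma variance_decay:
  assumes pi: "poincare_inequality \<mu> \<gamma>" and T: "0 \<le> T"
  shows "(\<integral>\<eta>. (U T \<eta> - (\<integral>\<eta>. U 0 \<eta> \<partial>\<mu>))\<^sup>2 \<partial>\<mu>) \<le> exp (- 2 * \<gamma> * T) / 4"
proof -
  define m where "m = (\<integral>\<eta>. U 0 \<eta> \<partial>\<mu>)"
  define \<Psi> where "\<Psi> t = (\<integral>\<eta>. (U t \<eta>)\<^sup>2 \<partial>\<mu>) - m\<^sup>2" for t
  have var: "(\<integral>\<eta>. (U t \<eta> - m)\<^sup>2 \<partial>\<mu>) = \<Psi> t" if "0 \<le> t" for t
    using P.variance_eq[OF U_integrable[OF that]] U_mean[OF that] by (simp add: m_def \<Psi>_def)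
  have der: "((\<lambda>t. exp (2 * \<gamma> * t) * \<Psi> t) has_real_derivative
      exp (2 * \<gamma> * t) * (2 * \<gamma> * \<Psi> t - 2 * dirichlet_form \<mu> (U t))) (at t within {0..T})"
    if "t \<in> {0..T}" for t
    unfolding \<Psi>_def using U_square_has_derivative[OF that]
    by (auto intro!: derivative_eq_intros simp: algebra_simps)
  have "exp (2 * \<gamma> * T) * \<Psi> T \<le> exp (2 * \<gamma> * 0) * \<Psi> 0"
  proof (rule DERIV_nonpos_imp_decreasing_open[OF T])
    fix t assume t: "0 < t" "t < T"
    have "bounded (U t ` space \<mu>)"
      using U_nonneg U_le_1[of t] t by (intro boundedI[where B = 1]) auto
    then have "\<gamma> * \<Psi> t \<le> dirichlet_form \<mu> (U t)"
      using pi measurable_\<mu>[OF U_measurable] var[of t] U_mean[of t] t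
      unfolding poincare_inequality_def m_def by fastforce
    then have "exp (2 * \<gamma> * t) * (2 * \<gamma> * \<Psi> t - 2 * dirichlet_form \<mu> (U t)) \<le> 0"
      by (intro mult_nonneg_nonpos) auto
    then show "\<exists>y. ((\<lambda>t. exp (2 * \<gamma> * t) * \<Psi> t) has_real_derivative y) (at t) \<and> y \<le> 0"
      using der[of t] t at_within_Icc_at[of 0 t T] by auto
  next
    show "continuous_on {0..T} (\<lambda>t. exp (2 * \<gamma> * t) * \<Psi> t)"
      using der by (rule DERIV_continuous_on)
  qed
  \<comment> \<open>Since 0 \<le> U 0 \<le> 1, the second moment is at most m, and m - m^2 is
    largest at m = 1 / 2.\<close>
  also have "\<Psi> 0 \<le> 1 / 4"
  proof -
    have "(\<integral>\<eta>. (U 0 \<eta>)\<^sup>2 \<partial>\<mu>) \<le> m"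
      unfolding m_def using U_nonneg U_le_1[of 0]
      by (intro integral_mono U_integrable) (auto simp: power2_eq_square mult_left_le)
    moreover have "m - m\<^sup>2 \<le> 1 / 4" using zero_le_power2[of "m - 1 / 2"] by (simp add: power2_eq_square algebra_simps)
    ultimately show ?thesis by (simp add: \<Psi>_def)
  qed
  finally have "exp (2 * \<gamma> * T) * \<Psi> T \<le> 1 / 4" by simp
  then show ?thesis using var[OF T] by (simp add: m_def exp_minus field_simps)
qed

text \<open>Both estimates meet here: the variance has decayed for time t1, and the density bound is
  available after a further time t0. The three summands are the survival of S, the stationary mean,
  and the fluctuation.\<close>

lemma law_upper_bound:
  assumes pi: "poincare_inequality \<mu> \<gamma>" and t: "0 \<le> t1" "0 \<le> t0"
    and S: "S \<in> conf_sets \<Lambda>"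
  shows "law f (t1 + t0) S \<le> ennreal (real (card S) * exp (- t0) + (\<integral>\<eta>. U 0 \<eta> \<partial>\<mu>)
    + exp (lam * vol / 2 - \<gamma> * t1) / 2)"
proof -
  define m where "m = (\<integral>\<eta>. U 0 \<eta> \<partial>\<mu>)"
  \<comment> \<open>The minimiser of \<kappa> / 2 + A / (2 \<kappa>), with A = exp (lam vol) exp (-
    2 \<gamma> t1) / 4 the variance bound times the density constant; both halves then equal
    \<kappa> / 2.\<close>
  define \<kappa> where "\<kappa> = exp (lam * vol / 2 - \<gamma> * t1) / 2"
  define q where "q \<eta> = (U t1 \<eta> - m)\<^sup>2 / (2 * \<kappa>)" for \<eta>
  have \<kappa>: "0 < \<kappa>" by (simp add: \<kappa>_def)
  have m: "0 \<le> m" "m \<le> 1"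
    using U_nonneg U_le_1[of 0]
    by (auto simp: m_def integral_nonneg_AE intro!: P.integral_le_const U_integrable AE_I2)
  have q: "0 \<le> q \<eta>" for \<eta> using \<kappa> by (simp add: q_def)
  have qm: "q \<in> borel_measurable C"
    unfolding q_def[abs_def] using U_measurable[of t1] by measurable
  have q_le: "q \<eta> \<le> 1 / (2 * \<kappa>)" if "\<eta> \<in> conf_sets \<Lambda>" for \<eta>
  proof -
    have "\<bar>U t1 \<eta> - m\<bar> \<le> 1" using U_nonneg[of t1 \<eta>] U_le_1[OF t(1) that] m by auto
    then show ?thesis unfolding q_def using \<kappa> by (intro divide_right_mono) (auto simp: abs_square_le_1)
  qed
  have am_gm: "U t1 \<eta> \<le> m + \<kappa> / 2 + q \<eta>" for \<eta>
  proof -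
    have "0 \<le> (U t1 \<eta> - m - \<kappa>)\<^sup>2 / (2 * \<kappa>)" using \<kappa> by simp
    also have "\<dots> = q \<eta> + \<kappa> / 2 - (U t1 \<eta> - m)"
      using \<kappa> by (simp add: q_def power2_eq_square field_simps)
    finally show ?thesis by simp
  qed
  have g: "ennreal (q \<eta>) \<le> ennreal (1 / (2 * \<kappa>))" if "\<eta> \<in> conf_sets \<Lambda>" for \<eta>
    using q_le[OF that] by (rule ennreal_leI)
  have K: "0 \<le> 1 / (2 * \<kappa>)" using \<kappa> by simp
  have gm: "(\<lambda>\<eta>. ennreal (q \<eta>)) \<in> borel_measurable C" using qm by measurable
  have "law f (t1 + t0) S \<le> law (law f t1) t0 S"
    by (rule law_semigroup_le[OF f_measurable f_le_1 t S])
  also have "\<dots> \<le> ennreal (dominating (\<lambda>\<eta>. ennreal (q \<eta>)) S (m + \<kappa> / 2) t0 S)"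
  proof (rule law_le_dominating[OF law_C_measurable _ gm g K _ _ _ S t(2)])
    fix \<eta> assume \<eta>: "\<eta> \<in> conf_sets \<Lambda>"
    show "law f t1 \<eta> \<le> 1" using law_le_1[OF f_measurable f_le_1 t(1) \<eta>] .
    have "law f t1 \<eta> \<le> ennreal (m + \<kappa> / 2 + q \<eta>)"
      unfolding ennreal_U[OF t(1) \<eta>, symmetric] by (rule ennreal_leI[OF am_gm])
    then show "law f t1 \<eta> \<le> ennreal (m + \<kappa> / 2) + ennreal (q \<eta>)"
      using m \<kappa> q by (simp add: ennreal_plus)
  qed (use m \<kappa> conf_setsD[OF S] in auto)
  also have "\<dots> \<le> ennreal (real (card S) * exp (- t0) + m + \<kappa>)"
  proof (rule ennreal_leI)
    \<comment> \<open>At the starting configuration \<eta> - S is empty, so the thinning is trivial.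
      Raising the parameter to 1 only increases the series and turns it into the full Gibbs
      sum.\<close>
    have "birth_exp (\<lambda>\<eta>. ennreal (q \<eta>)) (1 - exp (- t0)) {} \<le> birth_exp (\<lambda>\<eta>. ennreal (q \<eta>)) 1 {}"
      unfolding birth_exp_def using t(2)
      by (intro suminf_le birth_exp_summable[OF g K] mult_left_mono power_mono) auto
    also have "\<dots> \<le> \<kappa> / 2"
    proof -
      have "ennreal (birth_exp (\<lambda>\<eta>. ennreal (q \<eta>)) 1 {}) = gibbs_sum (\<lambda>\<eta>. ennreal (q \<eta>))"
        unfolding gibbs_sum_def by (subst ennreal_birth_exp[OF g K]) auto
      also have "\<dots> \<le> ennreal (exp (lam * vol)) * (\<integral>\<^sup>+\<eta>. ennreal (q \<eta>) \<partial>\<mu>)"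
        by (rule gibbs_sum_le[OF gm])
      also have "(\<integral>\<^sup>+\<eta>. ennreal (q \<eta>) \<partial>\<mu>) = ennreal (\<integral>\<eta>. q \<eta> \<partial>\<mu>)"
        using q q_le measurable_\<mu>[OF qm]
        by (intro nn_integral_eq_integral P.integrable_const_bound[where B = "1 / (2 * \<kappa>)"]) auto
      also have "ennreal (exp (lam * vol)) * ennreal (\<integral>\<eta>. q \<eta> \<partial>\<mu>) = ennreal (exp (lam * vol) * (\<integral>\<eta>. q \<eta> \<partial>\<mu>))"
        using q by (simp add: ennreal_mult integral_nonneg_AE)
      also have "\<dots> \<le> ennreal (\<kappa> / 2)"
      proof (rule ennreal_leI)
        have "(\<integral>\<eta>. q \<eta> \<partial>\<mu>) = (\<integral>\<eta>. (U t1 \<eta> - m)\<^sup>2 \<partial>\<mu>) / (2 * \<kappa>)" by (simp add: q_def)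
        also have "\<dots> \<le> exp (- 2 * \<gamma> * t1) / 4 / (2 * \<kappa>)"
          using variance_decay[OF pi t(1)] \<kappa> unfolding m_def by (intro divide_right_mono) auto
        finally have "exp (lam * vol) * (\<integral>\<eta>. q \<eta> \<partial>\<mu>) \<le> exp (lam * vol) * (exp (- 2 * \<gamma> * t1) / 4 / (2 * \<kappa>))"
          by (intro mult_left_mono) auto
        also have "\<dots> = \<kappa>\<^sup>2 / (2 * \<kappa>)"
          by (simp add: \<kappa>_def power2_eq_square algebra_simps flip: exp_add)
        also have "\<dots> = \<kappa> / 2" using \<kappa> by (simp add: power2_eq_square)
        finally show "exp (lam * vol) * (\<integral>\<eta>. q \<eta> \<partial>\<mu>) \<le> \<kappa> / 2" .
      qed
      finally show ?thesis using \<kappa> by (simp add: ennreal_le_iff)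
    qed
    finally show "dominating (\<lambda>\<eta>. ennreal (q \<eta>)) S (m + \<kappa> / 2) t0 S \<le> real (card S) * exp (- t0) + m + \<kappa>"
      by (simp add: dominating_def)
  qed
  finally show ?thesis by (simp add: m_def \<kappa>_def)
qed

end

theorem mainTheorem9:
  fixes \<Lambda> S :: "'a::euclidean_space set"
    and \<phi> :: "'a \<Rightarrow> 'a \<Rightarrow> ennreal"
    and lam \<gamma> \<epsilon> t :: real
  assumes "bounded \<Lambda>" and "\<Lambda> \<in> sets lebesgue"
    and "repulsive_finite_range \<phi>"
    and "lam \<ge> 0"
    and "\<gamma> > 0" and "poincare_inequality (gibbs_measure \<Lambda> lam \<phi>) \<gamma>"
    and "finite S" and "S \<noteq> {}" and "S \<subseteq> \<Lambda>"
    and "0 < \<epsilon>" and "\<epsilon> < 1"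
    and "t \<ge> 1 / \<gamma> * (lam * measure lebesgue \<Lambda> / 2 + ln (1 / \<epsilon>)) + ln (2 * real (card S) / \<epsilon>)"
  shows "tv_dist (glauber_law \<Lambda> lam \<phi> S t) (gibbs_measure \<Lambda> lam \<phi>) \<le> \<epsilon>"
proof -
  interpret glauber \<Lambda> lam \<phi> using assms(1-4) by unfold_locales
  interpret \<mu>: prob_space \<mu> by (rule prob_space_\<mu>)
  define \<nu> where "\<nu> = glauber_law \<Lambda> lam \<phi> S t"
  \<comment> \<open>Chosen so that the union bound for the survival of S equals \<epsilon> /
    2.\<close>
  define t0 where "t0 = ln (2 * real (card S) / \<epsilon>)"
  define t1 where "t1 = t - t0"
  have S: "S \<in> conf_sets \<Lambda>" using assms(7,9) by (simp add: conf_sets_def)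
  have card: "1 \<le> real (card S)" using assms(7,8) by (simp add: Suc_le_eq card_gt_0_iff)
  have t0: "0 \<le> t0" "real (card S) * exp (- t0) = \<epsilon> / 2"
    using card assms(10,11) by (auto simp: t0_def exp_minus)
  have "1 / \<gamma> * (lam * vol / 2 + ln (1 / \<epsilon>)) \<le> t1" using assms(12) by (simp add: t1_def t0_def)
  then have \<gamma>t1: "lam * vol / 2 + ln (1 / \<epsilon>) \<le> \<gamma> * t1" using assms(5) by (simp add: field_simps)
  have ln_nonneg: "0 \<le> ln (1 / \<epsilon>)" using assms(10,11) by simp
  then have "0 \<le> \<gamma> * t1" using \<gamma>t1 lam_nonneg by (intro order_trans[OF _ \<gamma>t1] add_nonneg_nonneg) auto
  then have t1: "0 \<le> t1" using assms(5) by (simp add: zero_le_mult_iff)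
  \<comment> \<open>The other half of \<epsilon>: the time left after t0 is what the fluctuation
    term needs.\<close>
  have \<kappa>: "exp (lam * vol / 2 - \<gamma> * t1) / 2 \<le> \<epsilon> / 2"
  proof -
    have "exp (lam * vol / 2 - \<gamma> * t1) \<le> exp (- ln (1 / \<epsilon>))" using \<gamma>t1 by simp
    then show ?thesis using assms(10) by (simp add: exp_minus ln_div)
  qed
  have [simp]: "sets \<nu> = sets C" "space \<nu> = conf_sets \<Lambda>"
    unfolding \<nu>_def glauber_law_def using sets.sigma_sets_eq[of C] sets.space_closed[of C]
    by (auto simp: sets_measure_of_conv space_measure_of_conv)
  have t_eq: "t = t1 + t0" by (simp add: t1_def)
  have em: "emeasure \<nu> A = law (indicator A) t S" if "A \<in> sets C" for A
    unfolding \<nu>_def by (rule emeasure_glauber_law[OF S that])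
  interpret \<nu>: prob_space \<nu>
  proof
    have "law (indicator (conf_sets \<Lambda>)) t S = law (\<lambda>_. 1) t S"
    proof (intro antisym)
      \<comment> \<open>The two functions differ only outside \<open>conf_sets \<Lambda>\<close>,
        where the dynamics never goes.\<close>
      have cong: "jumps (indicator (conf_sets \<Lambda>)) n s \<eta> = jumps (\<lambda>_. 1) n s \<eta>"
        if "\<eta> \<in> conf_sets \<Lambda>" for n s \<eta> using that
      proof (induction n arbitrary: s \<eta>)
        case (Suc n)
        then show ?case by (auto intro!: first_jump_cong)
      qed simp
      show "law (indicator (conf_sets \<Lambda>)) t S \<le> law (\<lambda>_. 1) t S"
        "law (\<lambda>_. 1) t S \<le> law (indicator (conf_sets \<Lambda>)) t S"
        unfolding law_def using cong[OF S] by auto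
    qed
    then show "emeasure \<nu> (space \<nu>) = 1"
      using em[OF sets.top, simplified] law_1[OF S, of t] t0 t1 by (simp add: t_eq)
  qed
  have upper: "measure \<nu> A \<le> measure \<mu> A + \<epsilon>" if A: "A \<in> sets C" for A
  proof -
    interpret observable \<Lambda> lam \<phi> "indicator A"
      using A by unfold_locales (auto simp: indicator_def)
    have "U 0 \<eta> = indicator A \<eta>" if "\<eta> \<in> conf_sets \<Lambda>" for \<eta>
      using U_0[OF that] by (simp add: indicator_def)
    then have "(\<integral>\<eta>. U 0 \<eta> \<partial>\<mu>) = (\<integral>\<eta>. indicator A \<eta> \<partial>\<mu>)" by (intro Bochner_Integration.integral_cong) auto
    also have "\<dots> = measure \<mu> A" using A sets.sets_into_space[OF A] by (simp add: Int_absorb2)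
    finally have mean: "(\<integral>\<eta>. U 0 \<eta> \<partial>\<mu>) = measure \<mu> A" .
    have "ennreal (measure \<nu> A) = law (indicator A) (t1 + t0) S"
      using em[OF A] by (simp add: t_eq \<nu>.emeasure_eq_measure)
    also have "\<dots> \<le> ennreal (real (card S) * exp (- t0) + measure \<mu> A + exp (lam * vol / 2 - \<gamma> * t1) / 2)"
      using law_upper_bound[OF assms(6) t1 t0(1) S] by (simp add: mean)
    finally have "measure \<nu> A \<le> real (card S) * exp (- t0) + measure \<mu> A + exp (lam * vol / 2 - \<gamma> * t1) / 2"
      by (subst (asm) ennreal_le_iff) (auto intro!: add_nonneg_nonneg)
    then show ?thesis using t0(2) \<kappa> by linarith
  qed
  have "\<bar>measure \<nu> A - measure \<mu> A\<bar> \<le> \<epsilon>" if A: "A \<in> sets \<nu>" for A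
  proof -
    have AC: "A \<in> sets C" using A by simp
    have "measure \<nu> (conf_sets \<Lambda> - A) = 1 - measure \<nu> A" "measure \<mu> (conf_sets \<Lambda> - A) = 1 - measure \<mu> A"
      using \<nu>.prob_compl[of A] \<mu>.prob_compl[of A] AC by auto
    moreover have "measure \<nu> (conf_sets \<Lambda> - A) \<le> measure \<mu> (conf_sets \<Lambda> - A) + \<epsilon>"
      using sets.compl_sets[OF AC] by (intro upper) simp
    ultimately show ?thesis using upper[OF AC] by simp
  qed
  moreover have "sets \<nu> \<noteq> {}" using sets.top[of \<nu>] by blast
  ultimately show ?thesis unfolding tv_dist_def \<nu>_def[symmetric] by (intro cSUP_least) auto
qed

end
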